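(* For any $D$-invariant subspace $W\subset\mathcal U_a$, there exists its residual interval $I_W$, and it equals $[c_{\mathcal J};d_{\mathcal J}]\cap(-a;a)$, where $\mathcal J=\mathcal F(W^0)$.
   Context: Weight. $\omega:[0;\infty)\to[0;\infty)$ is a non-decreasing continuous function such that: $\varphi_\omega(t):=\omega(e^t)$ is convex on $[0;\infty)$; $\omega(x)=o(x)$ and $\ln x=o(\omega(x))$ as $x\to\infty$; for every $\sigma>1$ there is $C>0$ with $\omega(x+y)\le\sigma(\omega(x)+\omega(y))+C$ for all $x,y\ge0$; $\int_1^\infty\omega(x)x^{-2}\,dx<\infty$. Fix $0<a\le+\infty$, a sequence $0<c_k\nearrow a$ such that $\{[-c_k;c_k]\}$ is an increasing sequence of closed intervals exhausting $(-a;a)$, and a sequence $0<r_k\nearrow1$. Ultradifferentiable functions. Put $\varphi_\omega^*(s)=\sup_t(st-\varphi_\omega(t))$ and, for $f\in C^\infty(-a;a)$, $q\in(0;1)$, $k\in\mathbb N$, $\|f\|_{\omega,q,k}=\sup_{j\in\mathbb N_0}\sup_{|x|\le c_k}|f^{(j)}(x)|e^{-q\varphi_\omega^*(j/q)}$. $\mathcal U_a$ is the space of all $f\in C^\infty(-a;a)$ with $\|f\|_{\omega,q,k}<\infty$ for all $q\in(0;1)$, $k\in\mathbb N$, with the locally convex topology given by these semi-norms; $\mathcal U_a'$ is its strong dual. $D=d/dx$. A $D$-invariant subspace is a closed subspace $W\subset\mathcal U_a$ with $D(W)\subset W$. $W^0=\{S\in\mathcal U_a': S(f)=0\ \forall f\in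 W\}$. Residual interval. For an interval $I\subset(-a;a)$ relatively closed in $(-a;a)$ put $W_I=\{f\in\mathcal U_a: f=0\text{ on }I\}$. The residual interval $I_W$ of $W$ is defined by the requirements: $I_W$ is relatively closed in $(-a;a)$, $W_{I_W}\subset W$, and $W_I\setminus W\ne\emptyset$ for every relatively closed interval $I\subsetneq I_W$. Module. $P_k$ is the Banach space of entire functions $\varphi$ with $\|\varphi\|_k=\sup_{z\in\mathbb C}|\varphi(z)|e^{-r_k\omega(|z|)-c_k|\mathrm{Im}\,z|}<\infty$, and $\mathcal P_a$ is the locally convex inductive limit of the $P_k$. The Fourier-Laplace transform $\mathcal F(S)(z)=S(e^{-\mathrm itz})$ is a linear topological isomorphism of $\mathcal U_a'$ onto $\mathcal P_a$, and $\mathcal F(W^0)$ is a closed submodule of $\mathcal P_a$ over $\mathbb C[z]$. For $\varphi\in\mathcal P_a$, $h_\varphi(\theta)=\limsup_{r\to\infty}r^{-1}\ln|\varphi(re^{\mathrm i\theta})|$ is its indicator function. The indicator segment of a closed submodule $\mathcal J\subset\mathcal P_a$ is $[c_{\mathcal J};d_{\mathcal J}]\subset\overline{\mathbb R}$, where $c_{\mathcal J}=-\sup_{\varphi\in\mathcal J}h_\varphi(-\pi/2)$ and $d_{\mathcal J}=\sup_{\varphi\in\mathcal J}h_\varphi(\pi/2)$.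
   Formalization: W_I is taken to consist of f vanishing on I together with all derivatives; this differs from "f = 0 on I" only for one-point I, where the literal version fails: W = {f : f^(j)(0) = 0 for all j} would have no residual interval. *)

theory Defs
  imports "HOL-Analysis.Analysis" "HOL-Library.Landau_Symbols"
begin

definition weight :: "(real \<Rightarrow> real) \<Rightarrow> bool" where
  "weight \<omega> \<longleftrightarrow>
     (\<forall>x\<ge>0. \<omega> x \<ge> 0) \<and> mono_on {0..} \<omega> \<and> continuous_on {0..} \<omega> \<and>
     convex_on {0..} (\<lambda>t. \<omega> (exp t)) \<and>
     \<omega> \<in> o[at_top](\<lambda>x. x) \<and> ln \<in> o[at_top](\<omega>) \<and>
     (\<forall>\<sigma>>1. \<exists>C>0. \<forall>x\<ge>0. \<forall>y\<ge>0. \<omega> (x + y) \<le> \<sigma> * (\<omega> x + \<omega> y) + C) \<and>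
     set_integrable lborel {1..} (\<lambda>x. \<omega> x / x\<^sup>2)"

text \<open>The conjugate of \<open>t \<mapsto> \<omega> (e\<^sup>t)\<close>, regarded as a function on \<open>[0;\<infinity>)\<close>. For a weight and \<open>s \<ge> 0\<close>
  the supremum is finite because \<open>ln x = o(\<omega>(x))\<close>.\<close>
definition young_conj :: "(real \<Rightarrow> real) \<Rightarrow> real \<Rightarrow> real" where
  "young_conj \<omega> s = (SUP t\<in>{0..}. s * t - \<omega> (exp t))"

text \<open>The interval \<open>(-a;a)\<close>, where \<open>a = \<infinity>\<close> is allowed.\<close>
definition dom_int :: "ereal \<Rightarrow> real set" where
  "dom_int a = {x. - a < ereal x \<and> ereal x < a}"

definition exhausting_seq :: "ereal \<Rightarrow> (nat \<Rightarrow> real) \<Rightarrow> bool" where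
  "exhausting_seq a c \<longleftrightarrow>
     (\<forall>k. 0 < c k) \<and> incseq c \<and> (\<lambda>k. ereal (c k)) \<longlonglongrightarrow> a \<and> (\<Union>k. {- c k..c k}) = dom_int a"

text \<open>Functions on \<open>(-a;a)\<close> are represented by total functions that vanish outside \<open>(-a;a)\<close>;
  accordingly the derivative is set to \<open>0\<close> there.\<close>
definition D_op :: "ereal \<Rightarrow> (real \<Rightarrow> complex) \<Rightarrow> real \<Rightarrow> complex" where
  "D_op a f = (\<lambda>x. if x \<in> dom_int a then vector_derivative f (at x) else 0)"

definition smooth_fun :: "ereal \<Rightarrow> (real \<Rightarrow> complex) set" where
  "smooth_fun a = {f. (\<forall>x. x \<notin> dom_int a \<longrightarrow> f x = 0) \<and>
     (\<forall>j. \<forall>x\<in>dom_int a. (D_op a ^^ j) f differentiable (at x))}"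

definition udiff_norm ::
  "ereal \<Rightarrow> (real \<Rightarrow> real) \<Rightarrow> (nat \<Rightarrow> real) \<Rightarrow> real \<Rightarrow> nat \<Rightarrow> (real \<Rightarrow> complex) \<Rightarrow> ereal" where
  "udiff_norm a \<omega> c q k f =
     (SUP j. SUP x\<in>{- c k..c k}.
        ereal (cmod ((D_op a ^^ j) f x) * exp (- q * young_conj \<omega> (real j / q))))"

definition udiff_space ::
  "ereal \<Rightarrow> (real \<Rightarrow> real) \<Rightarrow> (nat \<Rightarrow> real) \<Rightarrow> (real \<Rightarrow> complex) set" where
  "udiff_space a \<omega> c =
     {f \<in> smooth_fun a. \<forall>q\<in>{0<..<1}. \<forall>k. udiff_norm a \<omega> c q k f < \<infinity>}"

text \<open>All semi-norm balls with arbitrary centres form a subbase of the locally convex topology.\<close>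
definition udiff_topology ::
  "ereal \<Rightarrow> (real \<Rightarrow> real) \<Rightarrow> (nat \<Rightarrow> real) \<Rightarrow> (real \<Rightarrow> complex) topology" where
  "udiff_topology a \<omega> c = topology_generated_by
     {{g \<in> udiff_space a \<omega> c. udiff_norm a \<omega> c q k (\<lambda>x. g x - f x) < ereal \<epsilon>} | f q k \<epsilon>.
        f \<in> udiff_space a \<omega> c \<and> 0 < q \<and> q < 1 \<and> 0 < \<epsilon>}"

text \<open>The dual space as a set. Functionals are normalised to be \<open>0\<close> outside the function space.\<close>
definition udiff_dual ::
  "ereal \<Rightarrow> (real \<Rightarrow> real) \<Rightarrow> (nat \<Rightarrow> real) \<Rightarrow> ((real \<Rightarrow> complex) \<Rightarrow> complex) set" where
  "udiff_dual a \<omega> c = {S.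
     (\<forall>f\<in>udiff_space a \<omega> c. \<forall>g\<in>udiff_space a \<omega> c. S (\<lambda>x. f x + g x) = S f + S g) \<and>
     (\<forall>\<alpha>. \<forall>f\<in>udiff_space a \<omega> c. S (\<lambda>x. \<alpha> * f x) = \<alpha> * S f) \<and>
     continuous_map (udiff_topology a \<omega> c) euclidean S \<and>
     (\<forall>f. f \<notin> udiff_space a \<omega> c \<longrightarrow> S f = 0)}"

definition D_invariant_subspace ::
  "ereal \<Rightarrow> (real \<Rightarrow> real) \<Rightarrow> (nat \<Rightarrow> real) \<Rightarrow> (real \<Rightarrow> complex) set \<Rightarrow> bool" where
  "D_invariant_subspace a \<omega> c W \<longleftrightarrow>
     W \<subseteq> udiff_space a \<omega> c \<and>
     (\<lambda>_. 0) \<in> W \<and> (\<forall>f\<in>W. \<forall>g\<in>W. (\<lambda>x. f x + g x) \<in> W) \<and> (\<forall>\<alpha>. \<forall>f\<in>W. (\<lambda>x. \<alpha> * f x) \<in> W) \<and>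
     closedin (udiff_topology a \<omega> c) W \<and>
     D_op a ` W \<subseteq> W"

definition polar ::
  "ereal \<Rightarrow> (real \<Rightarrow> real) \<Rightarrow> (nat \<Rightarrow> real) \<Rightarrow> (real \<Rightarrow> complex) set \<Rightarrow>
     ((real \<Rightarrow> complex) \<Rightarrow> complex) set" where
  "polar a \<omega> c W = {S \<in> udiff_dual a \<omega> c. \<forall>f\<in>W. S f = 0}"

definition rel_closed_interval :: "ereal \<Rightarrow> real set \<Rightarrow> bool" where
  "rel_closed_interval a I \<longleftrightarrow> is_interval I \<and> closedin (top_of_set (dom_int a)) I"

text \<open>Vanishing on \<open>I\<close> is understood for \<open>f\<close> together with all its derivatives. For an interval with
  more than one point this is the same as \<open>f = 0\<close> on \<open>I\<close> (lemma \<open>vanishing_space_eq\<close> below). For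
  \<open>I = {p}\<close> the derivatives are needed: the closed subspace of all functions that are flat at \<open>p\<close>
  would otherwise have no residual interval.\<close>
definition vanishing_space ::
  "ereal \<Rightarrow> (real \<Rightarrow> real) \<Rightarrow> (nat \<Rightarrow> real) \<Rightarrow> real set \<Rightarrow> (real \<Rightarrow> complex) set" where
  "vanishing_space a \<omega> c I = {f \<in> udiff_space a \<omega> c. \<forall>j. \<forall>x\<in>I. (D_op a ^^ j) f x = 0}"

lemma vanishing_space_eq:
  assumes I: "rel_closed_interval a I" and "p \<in> I" "q \<in> I" "p \<noteq> q"
  shows "vanishing_space a \<omega> c I = {f \<in> udiff_space a \<omega> c. \<forall>x\<in>I. f x = 0}"
proof -
  have sub: "I \<subseteq> dom_int a" and conn: "connected I"
    using I by (auto simp: rel_closed_interval_def closedin_subset is_interval_connected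
        dest: closedin_imp_subset)
  have "(D_op a ^^ j) f x = 0"
    if f: "f \<in> udiff_space a \<omega> c" "\<forall>x\<in>I. f x = 0" and "x \<in> I" for f j x
    using \<open>x \<in> I\<close>
  proof (induction j arbitrary: x)
    case 0
    then show ?case using f by simp
  next
    case (Suc j)
    let ?g = "(D_op a ^^ j) f"
    have x: "x \<in> dom_int a" using Suc.prems sub by blast
    then have "?g differentiable (at x)"
      using f by (auto simp: udiff_space_def smooth_fun_def)
    then have "(?g has_vector_derivative vector_derivative ?g (at x)) (at x within I)"
      using has_vector_derivative_at_within vector_derivative_works by blast
    moreover have "(?g has_vector_derivative 0) (at x within I)"
      by (rule has_vector_derivative_transform[OF Suc.prems _ has_vector_derivative_const])
        (use Suc.IH in auto)
    moreover have "x islimpt I"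
      using connected_imp_perfect[OF conn Suc.prems] assms(2-4) by blast
    then have "at x within I \<noteq> bot"
      by (simp add: trivial_limit_within)
    ultimately have "vector_derivative ?g (at x) = 0"
      using vector_derivative_unique_within by blast
    then show ?case using x by (simp add: D_op_def[of a ?g])
  qed
  moreover have "f x = 0" if "\<forall>j. \<forall>x\<in>I. (D_op a ^^ j) f x = 0" "x \<in> I" for f x
    using that(1)[rule_format, of x 0] that(2) by simp
  ultimately show ?thesis
    by (auto simp: vanishing_space_def)
qed

text \<open>The empty set counts as an interval; it is the residual interval of the whole space.\<close>
definition residual_interval ::
  "ereal \<Rightarrow> (real \<Rightarrow> real) \<Rightarrow> (nat \<Rightarrow> real) \<Rightarrow> (real \<Rightarrow> complex) set \<Rightarrow> real set \<Rightarrow> bool" where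
  "residual_interval a \<omega> c W I \<longleftrightarrow>
     rel_closed_interval a I \<and> vanishing_space a \<omega> c I \<subseteq> W \<and>
     (\<forall>I'. rel_closed_interval a I' \<and> I' \<subset> I \<longrightarrow> vanishing_space a \<omega> c I' - W \<noteq> {})"

definition fourier_laplace ::
  "ereal \<Rightarrow> ((real \<Rightarrow> complex) \<Rightarrow> complex) \<Rightarrow> complex \<Rightarrow> complex" where
  "fourier_laplace a S z =
     S (\<lambda>t. if t \<in> dom_int a then exp (- \<i> * complex_of_real t * z) else 0)"

text \<open>Logarithm with \<open>ln 0 = -\<infinity>\<close>, so that the zero function has indicator \<open>-\<infinity>\<close>.\<close>
definition ln_ext :: "real \<Rightarrow> ereal" where
  "ln_ext x = (if x = 0 then -\<infinity> else ereal (ln x))"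

definition indicator_fn :: "(complex \<Rightarrow> complex) \<Rightarrow> real \<Rightarrow> ereal" where
  "indicator_fn \<phi> \<theta> =
     Limsup at_top (\<lambda>r::real. ereal (1 / r) * ln_ext (cmod (\<phi> (complex_of_real r * cis \<theta>))))"

definition seg_lower :: "(complex \<Rightarrow> complex) set \<Rightarrow> ereal" where
  "seg_lower J = - (SUP \<phi>\<in>J. indicator_fn \<phi> (- pi / 2))"

definition seg_upper :: "(complex \<Rightarrow> complex) set \<Rightarrow> ereal" where
  "seg_upper J = (SUP \<phi>\<in>J. indicator_fn \<phi> (pi / 2))"

definition indicator_segment :: "(complex \<Rightarrow> complex) set \<Rightarrow> ereal set" where
  "indicator_segment J = {seg_lower J..seg_upper J}"

end

(* By Hahn-Banach, a function lies in W once every functional S annihilating W kills it. The indicator of F(S) on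
   the imaginary axis is the growth of S(exp(rt)) as r tends to plus or minus infinity, and it determines the convex
   hull of the support of S (Paley-Wiener). If S kills all functions that are flat on (-a;b], a non-quasianalytic
   cutoff applied to exp(rt) shows that the indicator at pi/2 is at most b. Conversely, the functions
   1 - exp(-exp(n(t-s))) approximate the step at s and are series in exp(knt), k >= 1; averaging them against the
   derivative of a test function supported to the right of b shows that S kills that test function. So the closed
   hull of the supports of all functionals in the polar of W is [c_J;d_J], and it is the residual interval. *)

theory Submission
  imports Defs "HOL-Real_Asymp.Real_Asymp"
begin

section \<open>Weights and their conjugates\<close>

text \<open>All that is known of a functional \<open>S\<close> is a bound by one semi-norm, with
  some \<open>q < 1\<close> and some \<open>k\<close>. Hence \<open>S\<close> sees only
  \<open>{- c k..c k}\<close>: the exponential series may be truncated there, and functions may be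
  cut off nearer to the ends of \<open>(-a;a)\<close> without changing \<open>S f\<close>.
  Multiplication by a cutoff costs an arbitrarily small part of \<open>q\<close>, so products are
  estimated with a pair \<open>q' < q\<close>; the weight factors that exponentials carry are
  invisible to the indicator, since \<open>\<omega>\<close> is sublinear. The obstacle in the
  converse is that \<open>S (exp_fun r)\<close> may exceed \<open>exp (r * b)\<close> by any factor
  \<open>exp (r * \<epsilon>)\<close>, so the approximating series need not tend to 0 under
  \<open>S\<close>. Approximating instead the test function translated by \<open>\<delta>\<close> to
  the right gains \<open>exp (- r * \<delta>)\<close>; one half of this pays for the excess, and
  \<open>\<delta>\<close> tends to 0 at the end. The segment may miss \<open>(-a;a)\<close>, be
  reversed or be a point: a reversed segment leaves room for a cutoff, and otherwise a function flat
  on it is truncated at one of its points.\<close>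

locale udiff_setting =
  fixes a :: ereal and \<omega> :: "real \<Rightarrow> real" and c :: "nat \<Rightarrow> real"
  assumes weight: "weight \<omega>" and a_pos: "0 < a" and exhaust: "exhausting_seq a c"
begin

lemma omega_nonneg: "x \<ge> 0 \<Longrightarrow> 0 \<le> \<omega> x"
  using weight by (auto simp: weight_def)

lemma omega_mono: "0 \<le> x \<Longrightarrow> x \<le> y \<Longrightarrow> \<omega> x \<le> \<omega> y"
  using weight by (auto simp: weight_def mono_on_def)

lemma omega_subadd:
  assumes "\<sigma> > 1"
  obtains C where "C > 0" "\<And>x y. x \<ge> 0 \<Longrightarrow> y \<ge> 0 \<Longrightarrow> \<omega> (x + y) \<le> \<sigma> * (\<omega> x + \<omega> y) + C"
  using weight assms unfolding weight_def by meson

text \<open>The range below the threshold of the little-o relation is absorbed into the constant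
  \<open>B\<close>, so the bound holds from 1 on.\<close>

lemma ln_le_omega:
  assumes "e > 0"
  obtains B where "B \<ge> 0" "\<And>x. x \<ge> 1 \<Longrightarrow> ln x \<le> e * \<omega> x + B"
proof -
  have "ln \<in> o[at_top](\<omega>)" using weight by (simp add: weight_def)
  then have "eventually (\<lambda>x. norm (ln x) \<le> e * norm (\<omega> x)) at_top"
    using assms by (rule landau_o.smallD)
  then obtain N where N: "\<And>x. x \<ge> N \<Longrightarrow> \<bar>ln x\<bar> \<le> e * \<bar>\<omega> x\<bar>"
    by (auto simp: eventually_at_top_linorder)
  define N' where "N' = max N 1"
  have "ln x \<le> e * \<omega> x + ln N'" if "x \<ge> 1" for x
  proof (cases "x \<ge> N")
    case True
    then have "ln x \<le> e * \<omega> x" using N[of x] omega_nonneg[of x] that by simp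
    moreover have "0 \<le> ln N'" by (simp add: N'_def)
    ultimately show ?thesis by linarith
  next
    case False
    then have "ln x \<le> ln N'" using that by (subst ln_le_cancel_iff) (auto simp: N'_def)
    moreover have "0 \<le> e * \<omega> x" using assms omega_nonneg[of x] that by simp
    ultimately show ?thesis by linarith
  qed
  moreover have "0 \<le> ln N'" by (simp add: N'_def)
  ultimately show thesis using that by blast
qed

lemma omega_sublinear: "((\<lambda>r. \<omega> r / r) \<longlongrightarrow> 0) at_top"
proof -
  have "\<omega> \<in> o[at_top](\<lambda>x. x)" using weight by (simp add: weight_def)
  then show ?thesis by (rule smalloD_tendsto)
qed

lemma omega_unbounded: "\<exists>x\<ge>X. \<omega> x \<ge> y"
proof -
  obtain B where B: "\<And>x. x \<ge> 1 \<Longrightarrow> ln x \<le> 1 * \<omega> x + B"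
    using ln_le_omega[of 1] by auto
  define x where "x = max (max X 1) (exp (y + B))"
  have "y + B \<le> ln x" unfolding x_def
    by (subst ln_ge_iff) auto
  moreover have "x \<ge> 1" by (simp add: x_def)
  ultimately have "y \<le> \<omega> x" using B[of x] by linarith
  then show ?thesis by (intro exI[of _ x]) (simp add: x_def)
qed

text \<open>Convexity of \<open>\<omega> (exp t)\<close> between \<open>ln x\<close> and
  \<open>ln x + 1\<close> interpolates between dilation by 1 and by \<open>exp 1\<close>. The latter
  costs a fixed factor, by two doublings and \<open>exp 1 \<le> 4\<close>; so for small
  \<open>h\<close> dilation by \<open>exp h\<close> multiplies \<open>\<omega>\<close> by a factor
  close to 1, up to the additive term \<open>h * K\<close>.\<close>

lemma omega_dilate:
  obtains K where "K > 0" "\<And>h x. 0 \<le> h \<Longrightarrow> h \<le> 1 \<Longrightarrow> x \<ge> 1 \<Longrightarrow> \<omega> (exp h * x) \<le> (1 + h * K) * \<omega> x + h * K"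
proof -
  obtain C where C: "C > 0" "\<And>x y. x \<ge> 0 \<Longrightarrow> y \<ge> 0 \<Longrightarrow> \<omega> (x + y) \<le> 2 * (\<omega> x + \<omega> y) + C"
    using omega_subadd[of 2] by auto
  define K where "K = max 16 (5 * C)"
  have e4: "\<omega> (exp 1 * x) \<le> K * \<omega> x + K" if "x \<ge> 1" for x
  proof -
    have "exp 1 * x \<le> 4 * x" using that exp_le by (intro mult_right_mono) auto
    then have "\<omega> (exp 1 * x) \<le> \<omega> (4 * x)" using that by (intro omega_mono) auto
    also have "4 * x = 2 * x + 2 * x" by simp
    also have "\<omega> \<dots> \<le> 2 * (\<omega> (2 * x) + \<omega> (2 * x)) + C" using that by (intro C) auto
    finally have "\<omega> (exp 1 * x) \<le> 2 * (\<omega> (2 * x) + \<omega> (2 * x)) + C" .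
    moreover have "\<omega> (2 * x) \<le> 2 * (\<omega> x + \<omega> x) + C" using C(2)[of x x] that by simp
    ultimately have "\<omega> (exp 1 * x) \<le> 16 * \<omega> x + 5 * C" by argo
    also have "\<dots> \<le> K * \<omega> x + K" unfolding K_def
      using omega_nonneg[of x] that by (intro add_mono mult_right_mono) auto
    finally show ?thesis .
  qed
  have "\<omega> (exp h * x) \<le> (1 + h * K) * \<omega> x + h * K" if h: "0 \<le> h" "h \<le> 1" and x: "x \<ge> 1" for h x
  proof -
    have cv: "convex_on {0..} (\<lambda>t. \<omega> (exp t))" using weight by (simp add: weight_def)
    have *: "\<omega> (exp ((1 - h) *\<^sub>R ln x + h *\<^sub>R (ln x + 1)))
        \<le> (1 - h) * \<omega> (exp (ln x)) + h * \<omega> (exp (ln x + 1))"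
      by (rule convex_onD[OF cv]) (use h x in auto)
    have **: "(1 - h) *\<^sub>R ln x + h *\<^sub>R (ln x + 1) = h + ln x" by (simp add: algebra_simps)
    have "\<omega> (exp h * x) \<le> (1 - h) * \<omega> x + h * \<omega> (exp 1 * x)"
    proof -
      have "exp (h + ln x) = exp h * x" "exp (ln x + 1) = exp 1 * x" "exp (ln x) = x"
        using x by (simp_all add: exp_add)
      then show ?thesis using * ** by metis
    qed
    also have "\<dots> \<le> (1 - h) * \<omega> x + h * (K * \<omega> x + K)"
      using e4[OF x] h by (intro add_left_mono mult_left_mono) auto
    also have "\<dots> \<le> (1 + h * K) * \<omega> x + h * K"
      using h omega_nonneg[of x] x by (simp add: algebra_simps)
    finally show ?thesis .
  qed
  moreover have "K > 0" by (simp add: K_def)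
  ultimately show thesis using that by blast
qed

text \<open>For \<open>q > 0\<close> and with \<open>x = exp t\<close>, this is the supremum of
  \<open>x ^ j * exp (- q * \<omega> x)\<close> over \<open>x \<ge> 1\<close>.
  \<open>M_upper\<close> and \<open>M_least\<close> say just that, and the comparisons between
  different \<open>M q j\<close> rest on them.\<close>

definition M :: "real \<Rightarrow> nat \<Rightarrow> real" where
  "M q j = exp (q * young_conj \<omega> (real j / q))"

lemma M_pos [simp]: "0 < M q j"
  by (simp add: M_def)

lemma M_nonneg [simp]: "0 \<le> M q j"
  by (simp add: M_def)

lemma M_upper:
  assumes "q > 0" "x \<ge> 1"
  shows "x ^ j * exp (- q * \<omega> x) \<le> M q j"
proof -
  \<comment> \<open>The factor \<open>q / (j + 1)\<close> makes the linear term at most the fraction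
    \<open>j / (j + 1)\<close> of \<open>\<omega>\<close>, up to a constant. So the family is
    bounded above and its real supremum is a genuine one.\<close>
  obtain B where B: "\<And>x. x \<ge> 1 \<Longrightarrow> ln x \<le> (q / (j + 1)) * \<omega> x + B" "B \<ge> 0"
    using ln_le_omega[of "q / (j + 1)"] assms by auto
  have bdd: "bdd_above ((\<lambda>t. real j / q * t - \<omega> (exp t)) ` {0..})"
  proof (rule bdd_aboveI2)
    fix t :: real assume t: "t \<in> {0..}"
    have "t \<le> (q / (j + 1)) * \<omega> (exp t) + B" using B(1)[of "exp t"] t by simp
    then have "real j / q * t \<le> real j / q * ((q / (j + 1)) * \<omega> (exp t) + B)"
      using assms by (intro mult_left_mono) auto
    also have "\<dots> = (j / (j + 1)) * \<omega> (exp t) + real j / q * B"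
      using assms by (simp add: field_simps)
    also have "\<dots> \<le> 1 * \<omega> (exp t) + real j / q * B"
      using omega_nonneg[of "exp t"] by (intro add_right_mono mult_right_mono) auto
    finally show "real j / q * t - \<omega> (exp t) \<le> real j / q * B" by simp
  qed
  have "real j / q * ln x - \<omega> (exp (ln x)) \<le> young_conj \<omega> (real j / q)"
    unfolding young_conj_def using assms by (intro cSUP_upper bdd) auto
  then have "q * (real j / q * ln x - \<omega> x) \<le> q * young_conj \<omega> (real j / q)"
    using assms by (intro mult_left_mono) auto
  then have "real j * ln x - q * \<omega> x \<le> q * young_conj \<omega> (real j / q)"
    using assms by (simp add: right_diff_distrib)
  then have "exp (real j * ln x + (- q * \<omega> x)) \<le> M q j"
    by (simp add: M_def)
  moreover have "exp (real j * ln x) = x ^ j"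
    using assms by (simp add: exp_of_nat_mult)
  ultimately show ?thesis by (simp only: exp_add)
qed

lemma M_least:
  assumes "q > 0" and le: "\<And>x. x \<ge> 1 \<Longrightarrow> x ^ j * exp (- q * \<omega> x) \<le> B"
  shows "M q j \<le> B"
proof -
  have "exp (- q * \<omega> 1) \<le> B" using le[of 1] by simp
  then have B: "B > 0" using exp_gt_zero less_le_trans by blast
  have "young_conj \<omega> (real j / q) \<le> ln B / q"
    unfolding young_conj_def
  proof (rule cSUP_least)
    fix t :: real assume t: "t \<in> {0..}"
    have "exp (real j * t + (- q * \<omega> (exp t))) \<le> B"
      using le[of "exp t"] t unfolding exp_add by (simp add: exp_of_nat_mult)
    then have "real j * t - q * \<omega> (exp t) \<le> ln B"
      using B by (subst ln_ge_iff) auto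
    then have "(real j * t - q * \<omega> (exp t)) / q \<le> ln B / q"
      using assms(1) by (intro divide_right_mono) auto
    then show "real j / q * t - \<omega> (exp t) \<le> ln B / q"
      using assms(1) by (simp add: diff_divide_distrib)
  qed auto
  then have "q * young_conj \<omega> (real j / q) \<le> ln B"
    using assms(1) by (simp add: field_simps)
  then have "M q j \<le> exp (ln B)" unfolding M_def by simp
  then show ?thesis using B by simp
qed

lemma M_antimono:
  assumes "0 < q" "q \<le> q'"
  shows "M q' j \<le> M q j"
proof (rule M_least)
  fix x :: real assume x: "x \<ge> 1"
  have "x ^ j * exp (- q' * \<omega> x) \<le> x ^ j * exp (- q * \<omega> x)"
    using x assms omega_nonneg[of x] by (intro mult_left_mono) (auto intro: mult_right_mono)
  also have "\<dots> \<le> M q j" by (rule M_upper) (use x assms in auto)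
  finally show "x ^ j * exp (- q' * \<omega> x) \<le> M q j" .
qed (use assms in auto)

text \<open>The extra factor \<open>x = exp (ln x)\<close> is absorbed by
  \<open>exp ((q - q') * \<omega> x)\<close>, because \<open>ln x = o(\<omega> x)\<close>. This is
  what makes tameness stable under differentiation.\<close>

lemma M_Suc:
  assumes "0 < q'" "q' < q"
  obtains K where "K > 0" "\<And>j. M q (Suc j) \<le> K * M q' j"
proof -
  obtain B where B: "\<And>x. x \<ge> 1 \<Longrightarrow> ln x \<le> (q - q') * \<omega> x + B"
    using ln_le_omega[of "q - q'"] assms by auto
  have "M q (Suc j) \<le> exp B * M q' j" for j
  proof (rule M_least)
    fix x :: real assume x: "x \<ge> 1"
    have "x = exp (ln x)" using x by simp
    also have "\<dots> \<le> exp ((q - q') * \<omega> x + B)" using B[OF x] by simp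
    finally have "x * (x ^ j * exp (- q * \<omega> x)) \<le> exp ((q - q') * \<omega> x + B) * (x ^ j * exp (- q * \<omega> x))"
      using x by (intro mult_right_mono) auto
    also have "\<dots> = exp B * (x ^ j * exp (- q' * \<omega> x))"
    proof -
      have "exp ((q - q') * \<omega> x + B) * exp (- q * \<omega> x) = exp B * exp (- q' * \<omega> x)"
        unfolding mult_exp_exp by (simp add: algebra_simps)
      then show ?thesis by (simp only: mult.assoc mult.left_commute mult.commute)
    qed
    also have "\<dots> \<le> exp B * M q' j"
      using x assms by (intro mult_left_mono M_upper) auto
    finally show "x ^ Suc j * exp (- q * \<omega> x) \<le> exp B * M q' j" by (simp add: mult.assoc)
  qed (use assms in auto)
  then show thesis using that[of "exp B"] by simp
qed

text \<open>Dilating \<open>x\<close> by \<open>exp h\<close> produces the factor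
  \<open>exp h ^ j\<close> and enlarges \<open>\<omega>\<close> by a factor
  \<open>1 + h * L\<close>, up to a constant; for small \<open>h\<close> the gap between
  \<open>q'\<close> and \<open>q\<close> allows this. The geometric gain later swallows the number
  of terms in the Leibniz sum.\<close>

lemma M_geometric:
  assumes "0 < q'" "q' < q"
  obtains A K where "A > 1" "K > 0" "\<And>j. A ^ j * M q j \<le> K * M q' j"
proof -
  obtain L where L: "L > 0" "\<And>h x. 0 \<le> h \<Longrightarrow> h \<le> 1 \<Longrightarrow> x \<ge> 1 \<Longrightarrow> \<omega> (exp h * x) \<le> (1 + h * L) * \<omega> x + h * L"
    using omega_dilate by blast
  define h where "h = min 1 ((q / q' - 1) / L)"
  have h: "0 < h" "h \<le> 1" using assms L by (auto simp: h_def field_simps)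
  have "h * L \<le> q / q' - 1" using L(1) by (simp add: h_def min_def field_simps)
  then have hq: "q' * (1 + h * L) \<le> q" using assms by (simp add: field_simps)
  have "exp h ^ j * M q j \<le> exp (q' * (h * L)) * M q' j" for j
  proof -
    have "M q j \<le> exp (q' * (h * L)) * M q' j / exp h ^ j"
    proof (rule M_least)
      fix x :: real assume x: "x \<ge> 1"
      have "1 * x \<le> exp h * x" using h x by (intro mult_right_mono) auto
      then have "1 \<le> exp h * x" using x by linarith
      then have "(exp h * x) ^ j * exp (- q' * \<omega> (exp h * x)) \<le> M q' j"
        using assms x by (intro M_upper) auto
      moreover have "q' * \<omega> (exp h * x) \<le> q * \<omega> x + q' * (h * L)"
      proof -
        have "q' * \<omega> (exp h * x) \<le> q' * ((1 + h * L) * \<omega> x + h * L)"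
          using L(2)[of h x] h x assms by (intro mult_left_mono) auto
        also have "\<dots> = q' * (1 + h * L) * \<omega> x + q' * (h * L)" by (simp add: algebra_simps)
        also have "\<dots> \<le> q * \<omega> x + q' * (h * L)"
          using hq omega_nonneg[of x] x by (intro add_right_mono mult_right_mono) auto
        finally show ?thesis .
      qed
      then have "(exp h * x) ^ j * exp (- (q * \<omega> x + q' * (h * L))) \<le> (exp h * x) ^ j * exp (- q' * \<omega> (exp h * x))"
        using x by (intro mult_left_mono) auto
      ultimately have "(exp h * x) ^ j * exp (- (q * \<omega> x + q' * (h * L))) \<le> M q' j" by linarith
      then show "x ^ j * exp (- q * \<omega> x) \<le> exp (q' * (h * L)) * M q' j / exp h ^ j"
      proof -
        assume le: "(exp h * x) ^ j * exp (- (q * \<omega> x + q' * (h * L))) \<le> M q' j"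
        have "exp (q' * (h * L)) * exp (- (q * \<omega> x + q' * (h * L))) = exp (- q * \<omega> x)"
          unfolding mult_exp_exp by simp
        then have "x ^ j * exp (- q * \<omega> x) * exp h ^ j
          = exp (q' * (h * L)) * ((exp h * x) ^ j * exp (- (q * \<omega> x + q' * (h * L))))"
          by (simp only: power_mult_distrib mult.assoc mult.left_commute mult.commute)
        also have "\<dots> \<le> exp (q' * (h * L)) * M q' j"
          using le by (intro mult_left_mono) auto
        finally show ?thesis by (simp add: pos_le_divide_eq)
      qed
    qed (use assms in auto)
    then show ?thesis by (simp add: field_simps)
  qed
  then show thesis using that[of "exp h" "exp (q' * (h * L))"] h by auto
qed

text \<open>Here almost subadditivity of \<open>\<omega>\<close> with factors \<open>\<sigma>\<close> close to \<open>1\<close> keeps the loss from \<open>q\<close> to \<open>q'\<close>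
  arbitrarily small, so that the function space is closed under multiplication.\<close>

lemma M_binomial:
  assumes "0 < q'" "q' < q"
  obtains K where "K > 0" "\<And>i j. i \<le> j \<Longrightarrow> real (j choose i) * M q i * M q (j - i) \<le> K * M q' j"
proof -
  define \<sigma> where "\<sigma> = q / q'"
  have \<sigma>: "\<sigma> > 1" using assms by (simp add: \<sigma>_def)
  obtain C where C: "C > 0" "\<And>x y. x \<ge> 0 \<Longrightarrow> y \<ge> 0 \<Longrightarrow> \<omega> (x + y) \<le> \<sigma> * (\<omega> x + \<omega> y) + C"
    using omega_subadd[OF \<sigma>] by blast
  define K where "K = exp (q' * C)"
  have "real (j choose i) * M q i * M q (j - i) \<le> K * M q' j" if ij: "i \<le> j" for i j
  proof -
    have ch: "real (j choose i) > 0" using ij by simp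
    \<comment> \<open>One binomial term is at most \<open>(x + y) ^ j\<close>, and almost
      subadditivity pays for replacing the two weights by the one at \<open>x + y\<close>. The
      suprema behind \<open>M q i\<close> and \<open>M q (j - i)\<close> are then taken one variable
      at a time, first over \<open>x\<close>, then over \<open>y\<close>.\<close>
    have key: "real (j choose i) * (x ^ i * exp (- q * \<omega> x)) * (y ^ (j - i) * exp (- q * \<omega> y)) \<le> K * M q' j"
      if x: "x \<ge> 1" and y: "y \<ge> 1" for x y :: real
    proof -
      have "real (j choose i) * x ^ i * y ^ (j - i) \<le> (\<Sum>i\<le>j. real (j choose i) * x ^ i * y ^ (j - i))"
        using ij x y by (intro member_le_sum) auto
      also have "\<dots> = (x + y) ^ j" by (simp add: binomial_ring)
      finally have 1: "real (j choose i) * x ^ i * y ^ (j - i) \<le> (x + y) ^ j" .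
      have "q' * \<omega> (x + y) \<le> q' * (\<sigma> * (\<omega> x + \<omega> y) + C)"
        using C(2)[of x y] x y assms by (intro mult_left_mono) auto
      also have "\<dots> = q * (\<omega> x + \<omega> y) + q' * C" using assms by (simp add: \<sigma>_def field_simps)
      finally have 2: "exp (- q * \<omega> x) * exp (- q * \<omega> y) \<le> K * exp (- q' * \<omega> (x + y))"
        by (simp add: K_def mult_exp_exp algebra_simps)
      have "(real (j choose i) * x ^ i * y ^ (j - i)) * (exp (- q * \<omega> x) * exp (- q * \<omega> y))
          \<le> (x + y) ^ j * (K * exp (- q' * \<omega> (x + y)))"
        using x y by (intro mult_mono 1 2) auto
      also have "\<dots> = K * ((x + y) ^ j * exp (- q' * \<omega> (x + y)))" by simp
      also have "\<dots> \<le> K * M q' j"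
        using x y assms by (intro mult_left_mono M_upper) (auto simp: K_def)
      finally show ?thesis by (simp add: mult_ac)
    qed
    have key2: "M q i \<le> K * M q' j / (real (j choose i) * (y ^ (j - i) * exp (- q * \<omega> y)))"
      if y: "y \<ge> 1" for y :: real
    proof (rule M_least)
      fix x :: real assume x: "x \<ge> 1"
      have "0 < real (j choose i) * (y ^ (j - i) * exp (- q * \<omega> y))" using ch y by simp
      then show "x ^ i * exp (- q * \<omega> x) \<le> K * M q' j / (real (j choose i) * (y ^ (j - i) * exp (- q * \<omega> y)))"
        using key[OF x y] by (simp add: pos_le_divide_eq mult_ac)
    qed (use assms in auto)
    have "M q (j - i) \<le> K * M q' j / (real (j choose i) * M q i)"
    proof (rule M_least)
      fix y :: real assume y: "y \<ge> 1"
      have "0 < real (j choose i) * (y ^ (j - i) * exp (- q * \<omega> y))" using ch y by simp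
      then have "M q i * (real (j choose i) * (y ^ (j - i) * exp (- q * \<omega> y))) \<le> K * M q' j"
        using key2[OF y] by (simp add: pos_le_divide_eq)
      then show "y ^ (j - i) * exp (- q * \<omega> y) \<le> K * M q' j / (real (j choose i) * M q i)"
        using ch by (simp add: pos_le_divide_eq mult_ac)
    qed (use assms in auto)
    then show ?thesis using ch by (simp add: pos_le_divide_eq mult_ac)
  qed
  moreover have "K > 0" by (simp add: K_def)
  ultimately show thesis using that by blast
qed

lemma Suc_le_geometric:
  fixes A :: real
  assumes "A > 1"
  obtains K where "K > 0" "\<And>j::nat. real (Suc j) \<le> K * A ^ j"
proof -
  have "(\<lambda>n. of_nat n * (inverse A) ^ n) \<longlonglongrightarrow> 0"
    using assms by (intro powser_times_n_limit_0) (simp add: inverse_less_1_iff)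
  then have "Bseq (\<lambda>n. of_nat n * (inverse A) ^ n)"
    by (intro convergent_imp_Bseq) (auto simp: convergent_def)
  then obtain K where K: "K > 0" "\<And>n. norm (real n * inverse A ^ n) \<le> K"
    by (auto simp: Bseq_def)
  have "real (Suc j) \<le> (K + 1) * A ^ j" for j
  proof -
    have "real j \<le> K * A ^ j" using K(2)[of j] assms by (simp add: field_simps power_inverse)
    moreover have "1 \<le> A ^ j" using assms by simp
    ultimately show ?thesis by (simp add: algebra_simps)
  qed
  then show thesis using that[of "K + 1"] K by auto
qed

text \<open>Half of the gap between \<open>q\<close> and \<open>q'\<close> pays for the single terms
  of the sum, the other half for their number \<open>Suc j\<close>.\<close>

lemma M_leibniz:
  assumes "0 < q'" "q' < q"
  obtains K where "K > 0" "\<And>j. (\<Sum>i\<le>j. real (j choose i) * M q i * M q (j - i)) \<le> K * M q' j"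
proof -
  define p where "p = (q + q') / 2"
  have p: "0 < p" "q' < p" "p < q" using assms by (auto simp: p_def)
  obtain K1 where K1: "K1 > 0" "\<And>i j. i \<le> j \<Longrightarrow> real (j choose i) * M q i * M q (j - i) \<le> K1 * M p j"
    using M_binomial[OF p(1,3)] by blast
  obtain A K2 where A: "A > 1" "K2 > 0" "\<And>j. A ^ j * M p j \<le> K2 * M q' j"
    using M_geometric[OF assms(1) p(2)] by blast
  obtain K3 where K3: "K3 > 0" "\<And>j::nat. real (Suc j) \<le> K3 * A ^ j"
    using Suc_le_geometric[OF A(1)] by blast
  have "(\<Sum>i\<le>j. real (j choose i) * M q i * M q (j - i)) \<le> K1 * K3 * K2 * M q' j" for j
  proof -
    have "(\<Sum>i\<le>j. real (j choose i) * M q i * M q (j - i)) \<le> (\<Sum>i\<le>j. K1 * M p j)"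
      by (intro sum_mono K1) auto
    also have "\<dots> = K1 * (real (Suc j) * M p j)" by simp
    also have "\<dots> \<le> K1 * ((K3 * A ^ j) * M p j)"
      using K1 K3(2)[of j] by (intro mult_left_mono mult_right_mono) auto
    also have "\<dots> = K1 * K3 * (A ^ j * M p j)" by simp
    also have "\<dots> \<le> K1 * K3 * (K2 * M q' j)"
      using A(3)[of j] K1 K3 by (intro mult_left_mono) auto
    finally show ?thesis by simp
  qed
  then show thesis using that[of "K1 * K3 * K2"] A K1 K3 by auto
qed

end

section \<open>Jets and the function space\<close>

text \<open>A function carried together with all its derivatives. Sums, products, truncations and
  reflections act on the whole family, so the iterates of \<open>D_op\<close> are computed once and
  for all in \<open>D_iter\<close>.\<close>

definition jet_on :: "real set \<Rightarrow> (nat \<Rightarrow> real \<Rightarrow> complex) \<Rightarrow> bool" where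
  "jet_on X F \<longleftrightarrow> (\<forall>j. \<forall>x\<in>X. (F j has_vector_derivative F (Suc j) x) (at x))"

lemma jet_onD: "jet_on X F \<Longrightarrow> x \<in> X \<Longrightarrow> (F j has_vector_derivative F (Suc j) x) (at x)"
  by (simp add: jet_on_def)

lemma jet_on_subset: "jet_on X F \<Longrightarrow> Y \<subseteq> X \<Longrightarrow> jet_on Y F"
  by (auto simp: jet_on_def)

lemma jet_on_add: "jet_on X F \<Longrightarrow> jet_on X G \<Longrightarrow> jet_on X (\<lambda>j x. F j x + G j x)"
  by (auto simp: jet_on_def intro!: has_vector_derivative_add)

lemma jet_on_scale: "jet_on X F \<Longrightarrow> jet_on X (\<lambda>j x. \<alpha> * F j x)"
  by (auto simp: jet_on_def intro!: has_vector_derivative_mult_right)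

definition leibniz :: "(nat \<Rightarrow> real \<Rightarrow> complex) \<Rightarrow> (nat \<Rightarrow> real \<Rightarrow> complex) \<Rightarrow> nat \<Rightarrow> real \<Rightarrow> complex" where
  "leibniz F X j x = (\<Sum>i\<le>j. of_nat (j choose i) * F i x * X (j - i) x)"

lemma leibniz_0: "leibniz F X 0 x = F 0 x * X 0 x"
  by (simp add: leibniz_def)

text \<open>Pascal's rule, arranged so that the right-hand side is the term-by-term derivative of
  \<open>leibniz F X j\<close>.\<close>

lemma leibniz_Suc:
  "leibniz F X (Suc j) x
    = (\<Sum>i\<le>j. of_nat (j choose i) * (F (Suc i) x * X (j - i) x + F i x * X (Suc (j - i)) x))"
proof -
  have "leibniz F X (Suc j) x = F 0 x * X (Suc j) x
      + (\<Sum>i\<le>j. of_nat (Suc j choose Suc i) * F (Suc i) x * X (j - i) x)"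
    unfolding leibniz_def by (subst sum.atMost_Suc_shift) simp
  also have "\<dots> = F 0 x * X (Suc j) x + (\<Sum>i\<le>j. of_nat (j choose Suc i) * F (Suc i) x * X (j - i) x)
      + (\<Sum>i\<le>j. of_nat (j choose i) * F (Suc i) x * X (j - i) x)"
    by (simp add: algebra_simps sum.distrib)
  also have "F 0 x * X (Suc j) x + (\<Sum>i\<le>j. of_nat (j choose Suc i) * F (Suc i) x * X (j - i) x)
      = (\<Sum>i\<le>Suc j. of_nat (j choose i) * F i x * X (Suc j - i) x)"
    by (subst sum.atMost_Suc_shift) simp
  also have "\<dots> = (\<Sum>i\<le>j. of_nat (j choose i) * F i x * X (Suc (j - i)) x)"
    by (simp add: Suc_diff_le binomial_eq_0)
  finally show ?thesis by (simp add: algebra_simps sum.distrib)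
qed

lemma jet_on_leibniz:
  assumes "jet_on X F" "jet_on X G"
  shows "jet_on X (leibniz F G)"
  unfolding jet_on_def
proof (intro allI ballI)
  fix j x assume x: "x \<in> X"
  have "((\<lambda>x. \<Sum>i\<le>j. of_nat (j choose i) * (F i x * G (j - i) x)) has_vector_derivative
     (\<Sum>i\<le>j. of_nat (j choose i) * (F i x * G (Suc (j - i)) x + F (Suc i) x * G (j - i) x))) (at x)"
    by (intro has_vector_derivative_sum has_vector_derivative_mult_right has_vector_derivative_mult
        jet_onD[OF assms(1) x] jet_onD[OF assms(2) x])
  moreover have "leibniz F G j = (\<lambda>x. \<Sum>i\<le>j. of_nat (j choose i) * (F i x * G (j - i) x))"
    by (simp add: leibniz_def fun_eq_iff mult.assoc)
  ultimately show "(leibniz F G j has_vector_derivative leibniz F G (Suc j) x) (at x)"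
    unfolding leibniz_Suc by (simp only: add.commute)
qed

definition trunc :: "real \<Rightarrow> (nat \<Rightarrow> real \<Rightarrow> complex) \<Rightarrow> nat \<Rightarrow> real \<Rightarrow> complex" where
  "trunc p F j x = (if x > p then F j x else 0)"

text \<open>At \<open>p\<close> every \<open>F j\<close> has value and derivative zero, and the
  truncation is dominated pointwise by \<open>F j\<close>, so its derivative at \<open>p\<close> is
  zero too. No cutoff enters, so a function can be split even where only a single flat point is
  available.\<close>

lemma jet_on_trunc:
  assumes F: "jet_on X F" and flat: "p \<in> X \<Longrightarrow> (\<And>j. F j p = 0)"
  shows "jet_on X (trunc p F)"
  unfolding jet_on_def
proof (intro allI ballI)
  fix j x assume x: "x \<in> X"
  note d = jet_onD[OF F x, of j]
  consider "x > p" | "x < p" | "x = p" by linarith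
  then show "(trunc p F j has_vector_derivative trunc p F (Suc j) x) (at x)"
  proof cases
    case 1
    have "(trunc p F j has_vector_derivative F (Suc j) x) (at x)"
      by (rule has_vector_derivative_transform_within_open[OF d, of "{p<..}"])
        (use 1 in \<open>auto simp: trunc_def\<close>)
    then show ?thesis using 1 by (simp add: trunc_def)
  next
    case 2
    have "(trunc p F j has_vector_derivative 0) (at x)"
      by (rule has_vector_derivative_transform_within_open[OF has_vector_derivative_const[of 0], of "{..<p}"])
        (use 2 in \<open>auto simp: trunc_def\<close>)
    then show ?thesis using 2 by (simp add: trunc_def)
  next
    case 3
    have fl: "F j p = 0" for j using flat x 3 by simp
    have "((F j) has_derivative (\<lambda>h. 0)) (at p)"
      using d fl 3 by (simp add: has_vector_derivative_def)
    then have "((trunc p F j) has_derivative (\<lambda>h. 0)) (at p)"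
      unfolding has_derivative_at_alt
      by (simp add: fl trunc_def) (smt (verit) norm_zero zero_le_mult_iff norm_ge_zero)
    then show ?thesis using 3 by (simp add: has_vector_derivative_def trunc_def)
  qed
qed

lemma jet_on_reflect:
  assumes "jet_on (uminus ` X) F"
  shows "jet_on X (\<lambda>j x. (-1) ^ j * F j (- x))"
  unfolding jet_on_def
proof (intro allI ballI)
  fix j x assume "x \<in> X"
  then have d: "(F j has_vector_derivative F (Suc j) (- x)) (at (- x))"
    using jet_onD[OF assms] by blast
  have m: "(uminus has_vector_derivative (- 1)) (at x)"
    by (auto intro!: derivative_eq_intros simp: has_vector_derivative_def)
  have "((F j \<circ> uminus) has_vector_derivative ((-1) *\<^sub>R F (Suc j) (- x))) (at x)"
    by (rule vector_diff_chain_at[OF m d])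
  then have "((\<lambda>x. (-1) ^ j * (F j \<circ> uminus) x) has_vector_derivative (-1) ^ j * ((-1) *\<^sub>R F (Suc j) (- x))) (at x)"
    by (rule has_vector_derivative_mult_right)
  then show "((\<lambda>x. (-1) ^ j * F j (- x)) has_vector_derivative (-1) ^ Suc j * F (Suc j) (- x)) (at x)"
    by (simp add: o_def)
qed

definition exp_jet :: "real \<Rightarrow> nat \<Rightarrow> real \<Rightarrow> complex" where
  "exp_jet r j t = complex_of_real (r ^ j * exp (r * t))"

lemma jet_on_exp: "jet_on X (exp_jet r)"
  unfolding jet_on_def exp_jet_def
  by (intro allI ballI has_vector_derivative_of_real)
     (auto intro!: derivative_eq_intros simp: has_real_derivative_iff_has_vector_derivative[symmetric])

section \<open>The function space described by jets with weighted bounds\<close>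

context udiff_setting
begin

abbreviation "\<Omega> \<equiv> dom_int a"
abbreviation "U \<equiv> udiff_space a \<omega> c"
abbreviation "Dn j \<equiv> (D_op a ^^ j)"

lemma open_dom: "open \<Omega>"
proof -
  have "\<Omega> = ereal -` {-a<..<a}" by (auto simp: dom_int_def)
  then show ?thesis by (simp add: open_ereal_vimage)
qed

lemma uminus_dom: "x \<in> \<Omega> \<longleftrightarrow> - x \<in> \<Omega>"
proof -
  have "- a < ereal (- x) \<longleftrightarrow> ereal x < a" "ereal (- x) < a \<longleftrightarrow> - a < ereal x"
    by (cases a; auto)+
  then show ?thesis by (auto simp: dom_int_def)
qed

lemma dom_mono: "x \<in> \<Omega> \<Longrightarrow> z \<in> \<Omega> \<Longrightarrow> x \<le> y \<Longrightarrow> y \<le> z \<Longrightarrow> y \<in> \<Omega>"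
proof -
  assume "x \<in> \<Omega>" "z \<in> \<Omega>" "x \<le> y" "y \<le> z"
  then have "- a < ereal x" "ereal x \<le> ereal y" "ereal y \<le> ereal z" "ereal z < a"
    by (auto simp: dom_int_def)
  then show "y \<in> \<Omega>" unfolding dom_int_def
    by (blast intro: less_le_trans le_less_trans)
qed

lemma c_pos: "c k > 0" and c_mono: "k \<le> l \<Longrightarrow> c k \<le> c l" and Union_c: "(\<Union>k. {- c k..c k}) = \<Omega>"
  using exhaust by (auto simp: exhausting_seq_def incseq_def)

lemma c_dom: "x \<in> {- c k..c k} \<Longrightarrow> x \<in> \<Omega>"
  using Union_c by blast

lemma dom_c: "x \<in> \<Omega> \<Longrightarrow> \<exists>k. x \<in> {- c k..c k}"
  using Union_c by blast

lemma dom_above: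
  assumes "x \<in> \<Omega>" obtains y where "y \<in> \<Omega>" "x < y"
proof -
  obtain e where "e > 0" "\<And>y. dist y x < e \<Longrightarrow> y \<in> \<Omega>"
    using open_dom assms unfolding open_dist by blast
  then show thesis using that[of "x + e / 2"] by (auto simp: dist_real_def)
qed

definition restr :: "(real \<Rightarrow> complex) \<Rightarrow> real \<Rightarrow> complex" where
  "restr f x = (if x \<in> \<Omega> then f x else 0)"

text \<open>Since \<open>\<Omega>\<close> is open, extension by zero does not disturb derivatives
  inside it, and \<open>D_op\<close> is zero outside by convention.\<close>

lemma D_iter:
  assumes "jet_on \<Omega> F"
  shows "Dn j (restr (F 0)) = restr (F j)"
proof (induction j)
  case (Suc j)
  have "D_op a (restr (F j)) x = restr (F (Suc j)) x" for x
  proof (cases "x \<in> \<Omega>")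
    case True
    have "(restr (F j) has_vector_derivative F (Suc j) x) (at x)"
      by (rule has_vector_derivative_transform_within_open[OF jet_onD[OF assms True] open_dom True])
        (simp add: restr_def)
    then show ?thesis using True by (simp add: D_op_def restr_def vector_derivative_at)
  qed (simp add: D_op_def restr_def)
  then show ?case using Suc by auto
qed auto

text \<open>The relation \<open>udiff_norm \<le> B\<close> stated in real numbers; working with
  upper bounds \<open>B\<close> avoids suprema in the extended reals.\<close>

definition bd :: "real \<Rightarrow> nat \<Rightarrow> (real \<Rightarrow> complex) \<Rightarrow> real \<Rightarrow> bool" where
  "bd q k f B \<longleftrightarrow> (\<forall>j. \<forall>x\<in>{- c k..c k}. cmod (Dn j f x) \<le> B * M q j)"

lemma udiff_norm_le_iff: "udiff_norm a \<omega> c q k f \<le> ereal B \<longleftrightarrow> bd q k f B"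
proof -
  have "cmod z * exp (- q * young_conj \<omega> (real j / q)) \<le> B \<longleftrightarrow> cmod z \<le> B * M q j" for z j
    by (simp add: M_def exp_minus field_simps)
  then show ?thesis unfolding udiff_norm_def bd_def SUP_le_iff by simp
qed

lemma udiff_norm_nonneg: "0 \<le> udiff_norm a \<omega> c q k f"
proof -
  have "0 \<le> ereal (cmod (Dn 0 f 0) * exp (- q * young_conj \<omega> (real 0 / q)))" by simp
  also have "\<dots> \<le> udiff_norm a \<omega> c q k f"
    unfolding udiff_norm_def by (intro SUP_upper2[of 0 UNIV] SUP_upper2[of 0]) (use c_pos[of k] in auto)
  finally show ?thesis .
qed

lemma udiff_norm_finite_iff: "udiff_norm a \<omega> c q k f < \<infinity> \<longleftrightarrow> (\<exists>B. bd q k f B)"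
proof
  assume "udiff_norm a \<omega> c q k f < \<infinity>"
  then obtain B where "udiff_norm a \<omega> c q k f = ereal B"
    using udiff_norm_nonneg[of q k f] by (cases "udiff_norm a \<omega> c q k f") auto
  then show "\<exists>B. bd q k f B" using udiff_norm_le_iff[of q k f B] by auto
next
  assume "\<exists>B. bd q k f B"
  then obtain B where "udiff_norm a \<omega> c q k f \<le> ereal B" using udiff_norm_le_iff by blast
  also have "\<dots> < \<infinity>" by simp
  finally show "udiff_norm a \<omega> c q k f < \<infinity>" .
qed

lemma bd_nonneg: "bd q k f B \<Longrightarrow> 0 \<le> B"
proof -
  assume "bd q k f B"
  then have "udiff_norm a \<omega> c q k f \<le> ereal B" by (simp add: udiff_norm_le_iff)
  then have "0 \<le> ereal B" using udiff_norm_nonneg order_trans by blast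
  then show ?thesis by simp
qed

lemma U_iff:
  "f \<in> U \<longleftrightarrow> (\<forall>x. x \<notin> \<Omega> \<longrightarrow> f x = 0) \<and> jet_on \<Omega> (\<lambda>j. Dn j f)
     \<and> (\<forall>q k. 0 < q \<longrightarrow> q < 1 \<longrightarrow> (\<exists>B. bd q k f B))"
proof -
  have "(\<forall>j. \<forall>x\<in>\<Omega>. Dn j f differentiable (at x)) \<longleftrightarrow> jet_on \<Omega> (\<lambda>j. Dn j f)"
    unfolding jet_on_def
    by (auto simp: D_op_def vector_derivative_works intro: differentiableI_vector)
  then show ?thesis
    unfolding udiff_space_def smooth_fun_def mem_Collect_eq udiff_norm_finite_iff by auto
qed

lemma U_zero: "f \<in> U \<Longrightarrow> x \<notin> \<Omega> \<Longrightarrow> f x = 0"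
  and U_jet: "f \<in> U \<Longrightarrow> jet_on \<Omega> (\<lambda>j. Dn j f)"
  and U_bd: "f \<in> U \<Longrightarrow> 0 < q \<Longrightarrow> q < 1 \<Longrightarrow> \<exists>B. bd q k f B"
  unfolding U_iff by auto

text \<open>The growth conditions of the space for a jet on an arbitrary set, detached from
  \<open>D_op\<close> and from the intervals \<open>{- c k..c k}\<close>: the cutoffs below are tame
  on the whole line.\<close>

definition tame :: "real set \<Rightarrow> (nat \<Rightarrow> real \<Rightarrow> complex) \<Rightarrow> bool" where
  "tame X F \<longleftrightarrow> (\<forall>q. 0 < q \<longrightarrow> q < 1 \<longrightarrow> (\<exists>B\<ge>0. \<forall>j. \<forall>x\<in>X. cmod (F j x) \<le> B * M q j))"

lemma tameI:
  assumes "\<And>q. 0 < q \<Longrightarrow> q < 1 \<Longrightarrow> \<exists>B. \<forall>j. \<forall>x\<in>X. cmod (F j x) \<le> B * M q j"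
  shows "tame X F"
  unfolding tame_def
proof (intro allI impI)
  fix q :: real assume "0 < q" "q < 1"
  then obtain B where B: "\<forall>j. \<forall>x\<in>X. cmod (F j x) \<le> B * M q j" using assms by blast
  have B': "B * M q j \<le> \<bar>B\<bar> * M q j" for j by (intro mult_right_mono) auto
  have "cmod (F j x) \<le> \<bar>B\<bar> * M q j" if "x \<in> X" for j x
    using B that B'[of j] order_trans by blast
  then show "\<exists>B\<ge>0. \<forall>j. \<forall>x\<in>X. cmod (F j x) \<le> B * M q j"
    by (intro exI[of _ "\<bar>B\<bar>"]) auto
qed

lemma tame_subset: "tame X F \<Longrightarrow> Y \<subseteq> X \<Longrightarrow> tame Y F"
  unfolding tame_def by (meson subsetD)

lemma bd_restr:
  assumes "jet_on \<Omega> F"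
  shows "bd q k (restr (F 0)) B \<longleftrightarrow> (\<forall>j. \<forall>x\<in>{- c k..c k}. cmod (F j x) \<le> B * M q j)"
  unfolding bd_def D_iter[OF assms] using c_dom by (auto simp: restr_def)

lemma restr_in_U:
  assumes F: "jet_on \<Omega> F" and t: "\<And>k. tame {- c k..c k} F"
  shows "restr (F 0) \<in> U"
  unfolding U_iff
proof (intro conjI allI impI)
  show "jet_on \<Omega> (\<lambda>j. Dn j (restr (F 0)))"
    unfolding D_iter[OF F] jet_on_def
  proof (intro allI ballI)
    fix j x assume x: "x \<in> \<Omega>"
    have "(restr (F j) has_vector_derivative F (Suc j) x) (at x)"
      by (rule has_vector_derivative_transform_within_open[OF jet_onD[OF F x] open_dom x])
        (simp add: restr_def)
    then show "(restr (F j) has_vector_derivative restr (F (Suc j)) x) (at x)"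
      using x by (simp add: restr_def)
  qed
  fix q :: real and k assume "0 < q" "q < 1"
  then show "\<exists>B. bd q k (restr (F 0)) B" using t[of k] unfolding bd_restr[OF F] tame_def by blast
qed (auto simp: restr_def)

lemma U_tame: "f \<in> U \<Longrightarrow> tame {- c k..c k} (\<lambda>j. Dn j f)"
  by (rule tameI) (use U_bd[of f _ k] in \<open>auto simp: bd_def\<close>)

lemma tame_add:
  assumes "tame X F" "tame X G" shows "tame X (\<lambda>j x. F j x + G j x)"
proof (rule tameI)
  fix q :: real assume q: "0 < q" "q < 1"
  then obtain A B where AB: "\<And>j x. x \<in> X \<Longrightarrow> cmod (F j x) \<le> A * M q j" "\<And>j x. x \<in> X \<Longrightarrow> cmod (G j x) \<le> B * M q j"
    using assms unfolding tame_def by meson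
  have "cmod (F j x + G j x) \<le> (A + B) * M q j" if "x \<in> X" for j x
    using AB[OF that, of j] norm_triangle_ineq[of "F j x" "G j x"] by (simp add: distrib_right)
  then show "\<exists>B. \<forall>j. \<forall>x\<in>X. cmod (F j x + G j x) \<le> B * M q j" by blast
qed

lemma tame_scale:
  assumes "tame X F" shows "tame X (\<lambda>j x. \<alpha> * F j x)"
proof (rule tameI)
  fix q :: real assume q: "0 < q" "q < 1"
  then obtain A where A: "\<And>j x. x \<in> X \<Longrightarrow> cmod (F j x) \<le> A * M q j"
    using assms unfolding tame_def by meson
  have "cmod (\<alpha> * F j x) \<le> (cmod \<alpha> * A) * M q j" if "x \<in> X" for j x
    using A[OF that, of j] by (simp add: norm_mult mult.assoc mult_left_mono)
  then show "\<exists>B. \<forall>j. \<forall>x\<in>X. cmod (\<alpha> * F j x) \<le> B * M q j" by blast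
qed

text \<open>The constant is fixed before the functions, their bounds and the point. In
  \<open>indicator_le_of_support\<close> one factor is an exponential whose bound \<open>A\<close>
  grows with its frequency \<open>r\<close>, and the constant must not depend on
  \<open>r\<close>.\<close>

lemma leibniz_bound:
  assumes "0 < q'" "q' < q"
  shows "\<exists>K>0. \<forall>F G A B x. (\<forall>i. cmod (F i x) \<le> A * M q i) \<longrightarrow> (\<forall>i. cmod (G i x) \<le> B * M q i) \<longrightarrow>
      (\<forall>j. cmod (leibniz F G j x) \<le> K * A * B * M q' j)"
proof -
  obtain K where K: "K > 0" "\<And>j. (\<Sum>i\<le>j. real (j choose i) * M q i * M q (j - i)) \<le> K * M q' j"
    using M_leibniz[OF assms] by blast
  have "cmod (leibniz F G j x) \<le> K * A * B * M q' j"
    if F: "\<And>i. cmod (F i x) \<le> A * M q i" and G: "\<And>i. cmod (G i x) \<le> B * M q i" for F G A B x j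
  proof -
    have A: "A \<ge> 0" using F[of 0] M_pos[of q 0] by (metis norm_ge_zero order_trans zero_le_mult_iff not_le)
    have B: "B \<ge> 0" using G[of 0] M_pos[of q 0] by (metis norm_ge_zero order_trans zero_le_mult_iff not_le)
    have "cmod (leibniz F G j x) \<le> (\<Sum>i\<le>j. cmod (of_nat (j choose i) * F i x * G (j - i) x))"
      unfolding leibniz_def by (rule norm_sum)
    also have "\<dots> = (\<Sum>i\<le>j. real (j choose i) * (cmod (F i x) * cmod (G (j - i) x)))"
      by (simp add: norm_mult mult.assoc)
    also have "\<dots> \<le> (\<Sum>i\<le>j. real (j choose i) * ((A * M q i) * (B * M q (j - i))))"
      using A by (intro sum_mono mult_left_mono mult_mono F G) auto
    also have "\<dots> = A * B * (\<Sum>i\<le>j. real (j choose i) * M q i * M q (j - i))"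
      by (simp add: sum_distrib_left mult_ac)
    also have "\<dots> \<le> A * B * (K * M q' j)" using K A B by (intro mult_left_mono) auto
    finally show ?thesis by (simp add: mult_ac)
  qed
  then show ?thesis using K(1) by blast
qed

lemma tame_leibniz:
  assumes "tame X F" "tame X G" shows "tame X (leibniz F G)"
proof (rule tameI)
  fix q :: real assume q: "0 < q" "q < 1"
  define p where "p = (q + 1) / 2"
  have p: "0 < p" "q < p" "p < 1" using q by (auto simp: p_def)
  obtain A B where AB: "\<And>j x. x \<in> X \<Longrightarrow> cmod (F j x) \<le> A * M p j" "\<And>j x. x \<in> X \<Longrightarrow> cmod (G j x) \<le> B * M p j"
    using assms p unfolding tame_def by meson
  obtain K where K: "\<forall>F G A B x. (\<forall>i. cmod (F i x) \<le> A * M p i) \<longrightarrow> (\<forall>i. cmod (G i x) \<le> B * M p i) \<longrightarrow>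
      (\<forall>j. cmod (leibniz F G j x) \<le> K * A * B * M q j)"
    using leibniz_bound[OF q(1) p(2)] by blast
  show "\<exists>B. \<forall>j. \<forall>x\<in>X. cmod (leibniz F G j x) \<le> B * M q j"
    by (rule exI[of _ "K * A * B"]) (use K AB in blast)
qed

lemma tame_trunc: "tame X F \<Longrightarrow> tame X (trunc p F)"
proof (rule tameI)
  fix q :: real assume "tame X F" "0 < q" "q < 1"
  then obtain B where B: "B \<ge> 0" "\<forall>j. \<forall>x\<in>X. cmod (F j x) \<le> B * M q j"
    unfolding tame_def by blast
  show "\<exists>B. \<forall>j. \<forall>x\<in>X. cmod (trunc p F j x) \<le> B * M q j"
    by (intro exI[of _ B]) (use B in \<open>auto simp: trunc_def\<close>)
qed

lemma tame_derivative:
  assumes "tame X F" shows "tame X (\<lambda>j. F (Suc j))"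
proof (rule tameI)
  fix q :: real assume q: "0 < q" "q < 1"
  define p where "p = (q + 1) / 2"
  have p: "0 < p" "q < p" "p < 1" using q by (auto simp: p_def)
  obtain A where A: "A \<ge> 0" "\<And>j x. x \<in> X \<Longrightarrow> cmod (F j x) \<le> A * M p j"
    using assms p unfolding tame_def by meson
  obtain K where K: "K > 0" "\<And>j. M p (Suc j) \<le> K * M q j"
    using M_Suc[OF q(1) p(2)] by blast
  have "cmod (F (Suc j) x) \<le> (A * K) * M q j" if "x \<in> X" for j x
  proof -
    have "cmod (F (Suc j) x) \<le> A * M p (Suc j)" using A(2)[OF that] .
    also have "\<dots> \<le> A * (K * M q j)" using K(2) A(1) by (intro mult_left_mono) auto
    finally show ?thesis by simp
  qed
  then show "\<exists>B. \<forall>j. \<forall>x\<in>X. cmod (F (Suc j) x) \<le> B * M q j" by blast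
qed

lemma power_le_M:
  assumes "q > 0" "r \<ge> 1" shows "r ^ j \<le> exp (q * \<omega> r) * M q j"
  using M_upper[OF assms, of j] by (simp add: exp_minus field_simps)

lemma exp_jet_bound:
  assumes "q > 0" "r \<ge> 1" "t \<le> b"
  shows "cmod (exp_jet r j t) \<le> (exp (q * \<omega> r) * exp (r * b)) * M q j"
proof -
  have "cmod (exp_jet r j t) = r ^ j * exp (r * t)"
    using assms unfolding exp_jet_def norm_of_real by simp
  also have "\<dots> \<le> (exp (q * \<omega> r) * M q j) * exp (r * b)"
    using assms power_le_M[of q r j] by (intro mult_mono) auto
  finally show ?thesis by (simp add: mult_ac)
qed

definition exp_fun :: "real \<Rightarrow> real \<Rightarrow> complex" where
  "exp_fun r = restr (exp_jet r 0)"

lemma exp_fun_U: "r \<ge> 1 \<Longrightarrow> exp_fun r \<in> U"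
  unfolding exp_fun_def
proof (rule restr_in_U[OF jet_on_exp], rule tameI)
  fix k :: nat and q :: real assume "r \<ge> 1" "0 < q" "q < 1"
  then show "\<exists>B. \<forall>j. \<forall>x\<in>{- c k..c k}. cmod (exp_jet r j x) \<le> B * M q j"
    using exp_jet_bound[of q r _ "c k"] by (meson atLeastAtMost_iff)
qed

lemma Dn_outside: "f \<in> U \<Longrightarrow> x \<notin> \<Omega> \<Longrightarrow> Dn j f x = 0"
  by (cases j) (auto simp: D_op_def U_zero)

lemma Dn_add: "f \<in> U \<Longrightarrow> g \<in> U \<Longrightarrow> Dn j (\<lambda>x. f x + g x) = (\<lambda>x. Dn j f x + Dn j g x)"
proof -
  assume f: "f \<in> U" and g: "g \<in> U"
  have "(\<lambda>x. f x + g x) = restr (\<lambda>x. Dn 0 f x + Dn 0 g x)"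
    using f g by (auto simp: restr_def fun_eq_iff U_zero)
  then have "Dn j (\<lambda>x. f x + g x) = restr (\<lambda>x. Dn j f x + Dn j g x)"
    using D_iter[OF jet_on_add[OF U_jet[OF f] U_jet[OF g]], of j] by simp
  then show ?thesis by (simp add: fun_eq_iff restr_def Dn_outside f g)
qed

lemma Dn_scale: "f \<in> U \<Longrightarrow> Dn j (\<lambda>x. \<alpha> * f x) = (\<lambda>x. \<alpha> * Dn j f x)"
proof -
  assume f: "f \<in> U"
  have "(\<lambda>x. \<alpha> * f x) = restr (\<lambda>x. \<alpha> * Dn 0 f x)"
    using f by (auto simp: restr_def fun_eq_iff U_zero)
  then have "Dn j (\<lambda>x. \<alpha> * f x) = restr (\<lambda>x. \<alpha> * Dn j f x)"
    using D_iter[OF jet_on_scale[OF U_jet[OF f], where \<alpha> = \<alpha>], of j] by simp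
  then show ?thesis by (simp add: fun_eq_iff restr_def Dn_outside f)
qed

lemma U_add: "f \<in> U \<Longrightarrow> g \<in> U \<Longrightarrow> (\<lambda>x. f x + g x) \<in> U"
proof -
  assume f: "f \<in> U" and g: "g \<in> U"
  have "(\<lambda>x. f x + g x) = restr (\<lambda>x. Dn 0 f x + Dn 0 g x)"
    using f g by (auto simp: restr_def fun_eq_iff U_zero)
  then show ?thesis
    using restr_in_U[OF jet_on_add[OF U_jet[OF f] U_jet[OF g]] tame_add[OF U_tame[OF f] U_tame[OF g]]] by simp
qed

lemma U_scale: "f \<in> U \<Longrightarrow> (\<lambda>x. \<alpha> * f x) \<in> U"
proof -
  assume f: "f \<in> U"
  have "(\<lambda>x. \<alpha> * f x) = restr (\<lambda>x. \<alpha> * Dn 0 f x)"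
    using f by (auto simp: restr_def fun_eq_iff U_zero)
  then show ?thesis
    using restr_in_U[OF jet_on_scale[OF U_jet[OF f], where \<alpha> = \<alpha>] tame_scale[OF U_tame[OF f], where \<alpha> = \<alpha>]] by simp
qed

lemma U_diff: "f \<in> U \<Longrightarrow> g \<in> U \<Longrightarrow> (\<lambda>x. f x - g x) \<in> U"
  using U_add[OF _ U_scale[of g "-1"], of f] by simp

lemma Dn_diff: "f \<in> U \<Longrightarrow> g \<in> U \<Longrightarrow> Dn j (\<lambda>x. f x - g x) = (\<lambda>x. Dn j f x - Dn j g x)"
  using Dn_add[OF _ U_scale[of g "-1"], of f j] Dn_scale[of g j "-1"] by simp

lemma zero_U: "(\<lambda>_. 0) \<in> U"
  using U_scale[OF exp_fun_U[of 1], of 0] by simp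

lemma bd_add: "f \<in> U \<Longrightarrow> g \<in> U \<Longrightarrow> bd q k f A \<Longrightarrow> bd q k g B \<Longrightarrow> bd q k (\<lambda>x. f x + g x) (A + B)"
  by (auto simp: bd_def Dn_add distrib_right intro!: order_trans[OF norm_triangle_ineq add_mono])

lemma bd_scale: "f \<in> U \<Longrightarrow> bd q k f A \<Longrightarrow> bd q k (\<lambda>x. \<alpha> * f x) (cmod \<alpha> * A)"
  by (auto simp: bd_def Dn_scale norm_mult mult.assoc intro: mult_left_mono)

lemma bd_mono: "bd q k f A \<Longrightarrow> A \<le> B \<Longrightarrow> bd q k f B"
  unfolding bd_def by (meson M_nonneg mult_right_mono order_trans)

lemma bd_weaken:
  assumes "0 < q" "q \<le> q'" "k \<le> k'" "bd q' k' f B" shows "bd q k f B"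
  unfolding bd_def
proof (intro allI ballI)
  fix j x assume "x \<in> {- c k..c k}"
  then have "cmod (Dn j f x) \<le> B * M q' j" using assms(4) c_mono[OF assms(3)] by (auto simp: bd_def)
  also have "\<dots> \<le> B * M q j" using bd_nonneg[OF assms(4)] M_antimono[OF assms(1,2)] by (rule mult_left_mono[rotated])
  finally show "cmod (Dn j f x) \<le> B * M q j" .
qed

end

section \<open>The Hahn-Banach theorem\<close>

definition real_subspace :: "('x \<Rightarrow> complex) set \<Rightarrow> bool" where
  "real_subspace V \<longleftrightarrow> (\<lambda>_. 0) \<in> V \<and> (\<forall>f\<in>V. \<forall>g\<in>V. (\<lambda>x. f x + g x) \<in> V) \<and>
     (\<forall>r::real. \<forall>f\<in>V. (\<lambda>x. r * f x) \<in> V)"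

text \<open>Homogeneity is demanded only as an inequality for positive scalars; applied to
  \<open>r\<close> and to \<open>inverse r\<close> it gives the equality in
  \<open>sublinear_onD\<close>.\<close>

definition sublinear_on :: "('x \<Rightarrow> complex) set \<Rightarrow> (('x \<Rightarrow> complex) \<Rightarrow> real) \<Rightarrow> bool" where
  "sublinear_on V p \<longleftrightarrow> p (\<lambda>_. 0) = 0 \<and> (\<forall>f\<in>V. \<forall>g\<in>V. p (\<lambda>x. f x + g x) \<le> p f + p g) \<and>
     (\<forall>r::real. \<forall>f\<in>V. r > 0 \<longrightarrow> p (\<lambda>x. r * f x) \<le> r * p f)"

lemma sublinear_onI:
  assumes "p (\<lambda>_. 0) = 0"
    and "\<And>f g. f \<in> V \<Longrightarrow> g \<in> V \<Longrightarrow> p (\<lambda>x. f x + g x) \<le> p f + p g"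
    and "\<And>r f. f \<in> V \<Longrightarrow> r > 0 \<Longrightarrow> p (\<lambda>x. complex_of_real r * f x) \<le> r * p f"
  shows "sublinear_on V p"
  using assms unfolding sublinear_on_def by blast

context
  fixes V :: "('x \<Rightarrow> complex) set"
  assumes V: "real_subspace V"
begin

lemma V_zero: "(\<lambda>_. 0) \<in> V"
  and V_add: "f \<in> V \<Longrightarrow> g \<in> V \<Longrightarrow> (\<lambda>x. f x + g x) \<in> V"
  and V_scale: "f \<in> V \<Longrightarrow> (\<lambda>x. complex_of_real r * f x) \<in> V"
  using V by (auto simp: real_subspace_def)

lemma V_minus: "f \<in> V \<Longrightarrow> (\<lambda>x. - f x) \<in> V"
  using V_scale[of f "-1"] by simp

lemma sublinear_onD:
  assumes "sublinear_on V p"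
  shows "p (\<lambda>_. 0) = 0"
    and "f \<in> V \<Longrightarrow> g \<in> V \<Longrightarrow> p (\<lambda>x. f x + g x) \<le> p f + p g"
    and "f \<in> V \<Longrightarrow> r \<ge> 0 \<Longrightarrow> p (\<lambda>x. complex_of_real r * f x) = r * p f"
proof -
  show z: "p (\<lambda>_. 0) = 0" using assms by (simp add: sublinear_on_def)
  show "f \<in> V \<Longrightarrow> g \<in> V \<Longrightarrow> p (\<lambda>x. f x + g x) \<le> p f + p g"
    using assms by (simp add: sublinear_on_def)
  have le: "p (\<lambda>x. complex_of_real r * f x) \<le> r * p f" if "f \<in> V" "r > 0" for f r
    using assms that by (simp add: sublinear_on_def)
  assume f: "f \<in> V" and r: "r \<ge> 0"
  show "p (\<lambda>x. complex_of_real r * f x) = r * p f"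
  proof (cases "r = 0")
    case True then show ?thesis using z by simp
  next
    case False
    then have r: "r > 0" using r by simp
    have "p (\<lambda>x. complex_of_real (inverse r) * (complex_of_real r * f x))
        \<le> inverse r * p (\<lambda>x. complex_of_real r * f x)"
      by (rule le[OF V_scale[OF f]]) (use r in simp)
    also have "(\<lambda>x. complex_of_real (inverse r) * (complex_of_real r * f x)) = f"
      using r by (simp add: fun_eq_iff)
    finally have "r * p f \<le> p (\<lambda>x. complex_of_real r * f x)"
      using r by (simp add: field_simps)
    then show ?thesis using le[OF f r] by linarith
  qed
qed

lemma sublinear_on_minus:
  assumes "sublinear_on V p" "f \<in> V" shows "- p (\<lambda>x. - f x) \<le> p f"
  using sublinear_onD(2)[OF assms(1,2) V_minus[OF assms(2)]] sublinear_onD(1)[OF assms(1)] by simp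

text \<open>A minimal sublinear functional \<open>m\<close> is additive, because
  \<open>f \<mapsto> inf\<^sub>t (m (f + t h) - t m h)\<close> over \<open>t \<ge> 0\<close> is again sublinear and below \<open>m\<close>.\<close>

lemma minimal_sublinear_additive:
  assumes m: "sublinear_on V m"
    and min: "\<And>p f. sublinear_on V p \<Longrightarrow> (\<And>f. f \<in> V \<Longrightarrow> p f \<le> m f) \<Longrightarrow> f \<in> V \<Longrightarrow> p f = m f"
    and f: "f \<in> V" and h: "h \<in> V"
  shows "m (\<lambda>x. f x + h x) = m f + m h"
proof -
  note mD = sublinear_onD[OF m]
  define F where "F f t = m (\<lambda>x. f x + complex_of_real t * h x) - t * m h" for f t
  define p where "p f = (INF t\<in>{0..}. F f t)" for f
  \<comment> \<open>This keeps the infimum finite: \<open>t * m h\<close> is the value of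
    \<open>m\<close> at \<open>t h\<close>, and \<open>t h\<close> is the sum of
    \<open>f + t h\<close> and \<open>- f\<close>.\<close>
  have lower: "- m (\<lambda>x. - f x) \<le> F f t" if "f \<in> V" "t \<ge> 0" for f t
  proof -
    have "t * m h = m (\<lambda>x. (f x + complex_of_real t * h x) + - f x)"
      using mD(3)[OF h that(2)] by simp
    also have "\<dots> \<le> m (\<lambda>x. f x + complex_of_real t * h x) + m (\<lambda>x. - f x)"
      by (intro mD(2) V_add V_scale V_minus that h)
    finally show ?thesis by (simp add: F_def)
  qed
  have bdd: "bdd_below (F f ` {0..})" if "f \<in> V" for f
    by (rule bdd_belowI2[of _ "- m (\<lambda>x. - f x)"]) (use lower that in auto)
  have le: "p f \<le> F f t" if "f \<in> V" "t \<ge> 0" for f t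
    unfolding p_def using that by (intro cINF_lower bdd) auto
  have pm: "p f \<le> m f" if "f \<in> V" for f
    using le[OF that, of 0] by (simp add: F_def)
  have "sublinear_on V p"
  proof (rule sublinear_onI)
    have "F (\<lambda>_. 0) t = 0" if "t \<ge> 0" for t using mD(3)[OF h that] by (simp add: F_def)
    then show "p (\<lambda>_. 0) = 0" unfolding p_def by simp
  next
    fix f g assume f: "f \<in> V" and g: "g \<in> V"
    have "p (\<lambda>x. f x + g x) \<le> F f s + F g t" if "s \<ge> 0" "t \<ge> 0" for s t
    proof -
      have "p (\<lambda>x. f x + g x) \<le> F (\<lambda>x. f x + g x) (s + t)"
        using that by (intro le V_add f g) auto
      moreover have "m (\<lambda>x. f x + g x + complex_of_real (s + t) * h x)
          = m (\<lambda>x. (f x + complex_of_real s * h x) + (g x + complex_of_real t * h x))"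
        by (simp add: algebra_simps)
      moreover have "\<dots> \<le> m (\<lambda>x. f x + complex_of_real s * h x) + m (\<lambda>x. g x + complex_of_real t * h x)"
        by (intro mD(2) V_add V_scale f g h)
      moreover have "(s + t) * m h = s * m h + t * m h" by (rule distrib_right)
      ultimately show ?thesis unfolding F_def by linarith
    qed
    then have "p (\<lambda>x. f x + g x) - F f s \<le> p g" if "s \<ge> 0" for s
      unfolding p_def[of g] using that by (intro cINF_greatest) (auto simp: algebra_simps)
    then have "p (\<lambda>x. f x + g x) - p g \<le> p f"
      unfolding p_def[of f] by (intro cINF_greatest) (auto simp: algebra_simps)
    then show "p (\<lambda>x. f x + g x) \<le> p f + p g" by simp
  next
    fix r :: real and f assume f: "f \<in> V" and r: "r > 0"
    have "p (\<lambda>x. complex_of_real r * f x) / r \<le> F f t" if t: "t \<ge> 0" for t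
    proof -
      have "p (\<lambda>x. complex_of_real r * f x) \<le> F (\<lambda>x. complex_of_real r * f x) (r * t)"
        using r t by (intro le V_scale f) auto
      moreover have "m (\<lambda>x. complex_of_real r * f x + complex_of_real (r * t) * h x)
          = m (\<lambda>x. complex_of_real r * (f x + complex_of_real t * h x))"
        by (simp add: algebra_simps)
      moreover have "\<dots> = r * m (\<lambda>x. f x + complex_of_real t * h x)"
        using r by (intro mD(3) V_add V_scale f h) auto
      moreover have "r * F f t = r * m (\<lambda>x. f x + complex_of_real t * h x) - r * t * m h"
        by (simp add: F_def right_diff_distrib)
      ultimately have "p (\<lambda>x. complex_of_real r * f x) \<le> r * F f t" unfolding F_def by linarith
      then show ?thesis using r by (simp add: pos_divide_le_eq mult.commute)
    qed
    then have "p (\<lambda>x. complex_of_real r * f x) / r \<le> p f"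
      unfolding p_def[of f] by (intro cINF_greatest) auto
    then show "p (\<lambda>x. complex_of_real r * f x) \<le> r * p f" using r by (simp add: field_simps)
  qed
  \<comment> \<open>Minimality forces \<open>p = m\<close>, and the competitor \<open>t = 1\<close>
    in the infimum then gives superadditivity.\<close>
  then have "p f = m f" using min pm f by blast
  then have "m f \<le> F f 1" using le[OF f, of 1] by simp
  then have "m f + m h \<le> m (\<lambda>x. f x + h x)" by (simp add: F_def)
  then show ?thesis using mD(2)[OF f h] by linarith
qed

text \<open>Zorn's lemma on the sublinear functionals below \<open>p\<close>, ordered downwards. A
  chain is bounded by its pointwise infimum, which is finite because each member is at least
  \<open>- p (\<lambda>x. - f x)\<close> at \<open>f\<close>. Functionals are set to 0 off
  \<open>V\<close> by \<open>cut\<close>, since the order compares them on \<open>V\<close> only and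
  has to be antisymmetric.\<close>

lemma ex_minimal_sublinear:
  assumes p: "sublinear_on V p"
  obtains m where "sublinear_on V m" "\<And>f. f \<in> V \<Longrightarrow> m f \<le> p f"
    "\<And>q f. sublinear_on V q \<Longrightarrow> (\<And>f. f \<in> V \<Longrightarrow> q f \<le> m f) \<Longrightarrow> f \<in> V \<Longrightarrow> q f = m f"
proof -
  define A where "A = {q. sublinear_on V q \<and> (\<forall>f\<in>V. q f \<le> p f) \<and> (\<forall>f. f \<notin> V \<longrightarrow> q f = 0)}"
  define P where "P q r \<longleftrightarrow> (\<forall>f\<in>V. r f \<le> q f)" for q r :: "('x \<Rightarrow> complex) \<Rightarrow> real"
  define cut where "cut q f = (if f \<in> V then q f else 0)" for q :: "('x \<Rightarrow> complex) \<Rightarrow> real" and f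
  have cut: "sublinear_on V (cut q)" if "sublinear_on V q" for q
    using that V_zero V_add V_scale by (auto simp: sublinear_on_def cut_def)
  have lower: "- p (\<lambda>x. - f x) \<le> q f" if "q \<in> A" "f \<in> V" for q f
  proof -
    have "q (\<lambda>x. - f x) \<le> p (\<lambda>x. - f x)" using that V_minus by (auto simp: A_def)
    moreover have "- q (\<lambda>x. - f x) \<le> q f" using that by (intro sublinear_on_minus) (auto simp: A_def)
    ultimately show ?thesis by linarith
  qed
  have po: "partial_order_on A (relation_of P A)"
  proof (rule partial_order_on_relation_ofI)
    show "P q q" if "q \<in> A" for q by (simp add: P_def)
    show "P q s" if "q \<in> A" "r \<in> A" "s \<in> A" "P q r" "P r s" for q r s
      using that(4,5) unfolding P_def by (meson order_trans)
    show "q = r" if "q \<in> A" "r \<in> A" "P q r" "P r q" for q r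
    proof
      fix f show "q f = r f"
        using that by (cases "f \<in> V") (auto simp: P_def A_def intro: antisym)
    qed
  qed
  have "\<exists>u\<in>A. \<forall>q\<in>C. P q u" if C: "C \<in> Chains (relation_of P A)" for C
  proof (cases "C = {}")
    case True
    have "cut p \<in> A" using cut[OF p] by (auto simp: A_def cut_def)
    then show ?thesis using True by blast
  next
    case False
    have CA: "C \<subseteq> A" using C by (auto simp: Chains_def relation_of_def)
    have tot: "P q r \<or> P r q" if "q \<in> C" "r \<in> C" for q r
      using C that by (auto simp: Chains_def relation_of_def)
    define u where "u f = (INF q\<in>C. q f)" for f
    have bdd: "bdd_below ((\<lambda>q. q f) ` C)" if "f \<in> V" for f
      by (rule bdd_belowI2[of _ "- p (\<lambda>x. - f x)"]) (use lower that CA in auto)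
    have le: "u f \<le> q f" if "f \<in> V" "q \<in> C" for f q
      unfolding u_def using that by (intro cINF_lower bdd)
    have sub: "sublinear_on V q" if "q \<in> C" for q using that CA by (auto simp: A_def)
    have "sublinear_on V u"
    proof (rule sublinear_onI)
      have "q (\<lambda>_. 0) = 0" if "q \<in> C" for q using sub[OF that] by (rule sublinear_onD(1))
      then have "u (\<lambda>_. 0) = (INF q\<in>C. 0)" unfolding u_def by (intro INF_cong) auto
      then show "u (\<lambda>_. 0) = 0" using False by simp
    next
      fix f g assume f: "f \<in> V" and g: "g \<in> V"
      \<comment> \<open>An infimum of sublinear functionals is not subadditive in general; it is so
        along a chain, where the smaller of \<open>q\<close> and \<open>r\<close> serves for both
        summands.\<close>
      have "u (\<lambda>x. f x + g x) \<le> q f + r g" if qr: "q \<in> C" "r \<in> C" for q r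
      proof -
        obtain s where s: "s \<in> C" "P q s" "P r s"
          using tot[OF qr] qr by (auto simp: P_def)
        have "u (\<lambda>x. f x + g x) \<le> s (\<lambda>x. f x + g x)" by (intro le V_add f g s)
        also have "\<dots> \<le> s f + s g" by (rule sublinear_onD(2)[OF sub[OF s(1)] f g])
        also have "\<dots> \<le> q f + r g" using s f g by (intro add_mono) (auto simp: P_def)
        finally show ?thesis .
      qed
      then have *: "u (\<lambda>x. f x + g x) - q f \<le> r g" if "q \<in> C" "r \<in> C" for q r
        using that by (simp add: diff_le_eq add.commute)
      have "u (\<lambda>x. f x + g x) - q f \<le> u g" if "q \<in> C" for q
        unfolding u_def[of g] using False *[OF that] by (intro cINF_greatest)
      then have **: "u (\<lambda>x. f x + g x) - u g \<le> q f" if "q \<in> C" for q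
        using that by (simp add: diff_le_eq add.commute)
      have "u (\<lambda>x. f x + g x) - u g \<le> u f"
        unfolding u_def[of f] using False ** by (intro cINF_greatest)
      then show "u (\<lambda>x. f x + g x) \<le> u f + u g" by simp
    next
      fix r :: real and f assume f: "f \<in> V" and r: "r > 0"
      have "u (\<lambda>x. complex_of_real r * f x) / r \<le> q f" if q: "q \<in> C" for q
        using le[OF V_scale[OF f, of r] q] sublinear_onD(3)[OF sub[OF q] f, of r] r
        by (simp add: field_simps)
      then have "u (\<lambda>x. complex_of_real r * f x) / r \<le> u f"
        unfolding u_def[of f] using False by (intro cINF_greatest) auto
      then show "u (\<lambda>x. complex_of_real r * f x) \<le> r * u f" using r by (simp add: field_simps)
    qed
    moreover have "u f \<le> p f" if "f \<in> V" for f
    proof -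
      obtain q where q: "q \<in> C" using False by blast
      then have "q f \<le> p f" using CA that by (auto simp: A_def)
      then show ?thesis using le[OF that q] by linarith
    qed
    ultimately have "cut u \<in> A" using cut by (auto simp: A_def cut_def)
    moreover have "P q (cut u)" if "q \<in> C" for q
      using le that by (auto simp: P_def cut_def)
    ultimately show ?thesis by blast
  qed
  then obtain m where m: "m \<in> A" "\<And>q. q \<in> A \<Longrightarrow> P m q \<Longrightarrow> q = m"
    using predicate_Zorn[OF po] by blast
  have "q f = m f" if q: "sublinear_on V q" "\<And>f. f \<in> V \<Longrightarrow> q f \<le> m f" and f: "f \<in> V" for q f
  proof -
    have "q f \<le> p f" if "f \<in> V" for f
      using q(2)[OF that] m(1) that by (auto simp: A_def intro: order_trans)
    then have "cut q \<in> A" using cut[OF q(1)] by (auto simp: A_def cut_def)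
    moreover have "P m (cut q)" using q(2) by (auto simp: P_def cut_def)
    ultimately have "cut q = m" by (rule m(2))
    then have "cut q f = m f" by simp
    then show ?thesis using f by (simp add: cut_def)
  qed
  moreover have "sublinear_on V m" "\<And>f. f \<in> V \<Longrightarrow> m f \<le> p f" using m(1) by (auto simp: A_def)
  ultimately show thesis by (rule that[rotated 2])
qed

text \<open>No functional is extended step by step: a minimal sublinear functional below
  \<open>p\<close> is additive, hence odd, and so homogeneous for negative scalars as well.\<close>

theorem Hahn_Banach_sublinear:
  assumes p: "sublinear_on V p"
  obtains u where "\<And>f g. f \<in> V \<Longrightarrow> g \<in> V \<Longrightarrow> u (\<lambda>x. f x + g x) = u f + u g"
    "\<And>r f. f \<in> V \<Longrightarrow> u (\<lambda>x. complex_of_real r * f x) = r * u f"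
    "\<And>f. f \<in> V \<Longrightarrow> u f \<le> p f"
proof -
  obtain m where m: "sublinear_on V m" "\<And>f. f \<in> V \<Longrightarrow> m f \<le> p f"
    "\<And>q f. sublinear_on V q \<Longrightarrow> (\<And>f. f \<in> V \<Longrightarrow> q f \<le> m f) \<Longrightarrow> f \<in> V \<Longrightarrow> q f = m f"
    using ex_minimal_sublinear[OF p] by blast
  have add: "m (\<lambda>x. f x + g x) = m f + m g" if "f \<in> V" "g \<in> V" for f g
    by (rule minimal_sublinear_additive[OF m(1) _ that]) (rule m(3))
  have neg: "m (\<lambda>x. - f x) = - m f" if "f \<in> V" for f
    using add[OF that V_minus[OF that]] sublinear_onD(1)[OF m(1)] by simp
  have "m (\<lambda>x. complex_of_real r * f x) = r * m f" if f: "f \<in> V" for r f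
  proof (cases "r \<ge> 0")
    case True then show ?thesis using sublinear_onD(3)[OF m(1) f] by simp
  next
    case False
    then have "m (\<lambda>x. complex_of_real (- r) * f x) = - r * m f"
      by (intro sublinear_onD(3)[OF m(1) f]) simp
    then show ?thesis using neg[OF V_scale[OF f, of r]] by simp
  qed
  then show thesis using that[of m] add m(2) by blast
qed

end

section \<open>Topology and dual space\<close>

context udiff_setting
begin

abbreviation "utop \<equiv> udiff_topology a \<omega> c"

lemma udiff_norm_less_iff: "udiff_norm a \<omega> c q k f < ereal e \<longleftrightarrow> (\<exists>B<e. bd q k f B)"
proof
  assume l: "udiff_norm a \<omega> c q k f < ereal e"
  then obtain B where "udiff_norm a \<omega> c q k f = ereal B"
    using udiff_norm_nonneg[of q k f] by (cases "udiff_norm a \<omega> c q k f") auto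
  then show "\<exists>B<e. bd q k f B" using udiff_norm_le_iff[of q k f B] l by auto
next
  assume "\<exists>B<e. bd q k f B"
  then obtain B where "udiff_norm a \<omega> c q k f \<le> ereal B" "B < e" using udiff_norm_le_iff by blast
  then show "udiff_norm a \<omega> c q k f < ereal e" by (meson ereal_less(2) less_ereal.simps(1) order_le_less_trans)
qed

definition uball :: "real \<Rightarrow> nat \<Rightarrow> (real \<Rightarrow> complex) \<Rightarrow> real \<Rightarrow> (real \<Rightarrow> complex) set" where
  "uball q k f e = {g \<in> U. \<exists>B<e. bd q k (\<lambda>x. g x - f x) B}"

lemma top_eq: "utop = topology_generated_by {uball q k f e |f q k e. f \<in> U \<and> 0 < q \<and> q < 1 \<and> 0 < e}"
  unfolding udiff_topology_def uball_def udiff_norm_less_iff ..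

lemma openin_uball: "f \<in> U \<Longrightarrow> 0 < q \<Longrightarrow> q < 1 \<Longrightarrow> 0 < e \<Longrightarrow> openin utop (uball q k f e)"
  unfolding top_eq by (rule topology_generated_by_Basis) blast

lemma bd_zero: "0 \<le> B \<Longrightarrow> bd q k (\<lambda>_. 0) B"
  using Dn_scale[OF zero_U, of _ 0] by (simp add: bd_def)

lemma center_uball: "f \<in> U \<Longrightarrow> e > 0 \<Longrightarrow> f \<in> uball q k f e"
  unfolding uball_def using bd_zero[of 0] by auto

lemma topspace_top: "topspace utop = U"
proof
  show "topspace utop \<subseteq> U"
    unfolding top_eq topology_generated_by_topspace by (auto simp: uball_def)
  show "U \<subseteq> topspace utop"
    using openin_uball[of _ "1/2" 1 0] center_uball[of _ 1 "1/2" 0] openin_subset[of utop] by (auto; blast)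
qed

text \<open>The subbase contains balls with arbitrary centres, and the triangle inequality recentres
  them at \<open>f\<close>. The semi-norms grow with \<open>q\<close> and \<open>k\<close>, so two
  balls about \<open>f\<close> contain a third one with the larger indices and the smaller
  radius.\<close>

lemma openin_top_uball:
  assumes "openin utop S" "f \<in> S"
  shows "\<exists>q k e. 0 < q \<and> q < 1 \<and> 0 < e \<and> uball q k f e \<subseteq> S"
  using assms unfolding top_eq openin_topology_generated_by_iff
proof (induction arbitrary: f)
  case (Int S T)
  from Int.prems have fST: "f \<in> S" "f \<in> T" by auto
  obtain q k e where 1: "0 < q" "q < 1" "0 < e" "uball q k f e \<subseteq> S"
    using Int.IH(1)[OF fST(1)] by blast
  obtain q' k' e' where 2: "0 < q'" "q' < 1" "0 < e'" "uball q' k' f e' \<subseteq> T"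
    using Int.IH(2)[OF fST(2)] by blast
  have "uball (max q q') (max k k') f (min e e') \<subseteq> uball q k f e \<inter> uball q' k' f e'"
  proof
    fix g assume "g \<in> uball (max q q') (max k k') f (min e e')"
    then obtain B where B: "g \<in> U" "B < min e e'" "bd (max q q') (max k k') (\<lambda>x. g x - f x) B"
      by (auto simp only: uball_def mem_Collect_eq)
    have "bd q k (\<lambda>x. g x - f x) B" "bd q' k' (\<lambda>x. g x - f x) B"
      using bd_weaken[OF 1(1) max.cobounded1 max.cobounded1 B(3)]
        bd_weaken[OF 2(1) max.cobounded2 max.cobounded2 B(3)] by blast+
    then show "g \<in> uball q k f e \<inter> uball q' k' f e'" using B(1,2) by (auto simp: uball_def)
  qed
  then have "uball (max q q') (max k k') f (min e e') \<subseteq> S \<inter> T" using 1 2 by blast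
  then show ?case using 1 2 by (intro exI[of _ "max q q'"] exI[of _ "max k k'"] exI[of _ "min e e'"]) auto
next
  case (UN K)
  then obtain S where S: "S \<in> K" "f \<in> S" by blast
  then obtain q k e where "0 < q" "q < 1" "0 < e" "uball q k f e \<subseteq> S" using UN.IH by blast
  then show ?case using S by blast
next
  case (Basis S)
  then obtain f0 q k e where S: "S = uball q k f0 e" "f0 \<in> U" "0 < q" "q < 1" "0 < e" by blast
  obtain B where B: "f \<in> U" "B < e" "bd q k (\<lambda>x. f x - f0 x) B" using Basis S by (auto simp: uball_def)
  have "uball q k f (e - B) \<subseteq> S"
  proof
    fix g assume "g \<in> uball q k f (e - B)"
    then obtain A where A: "g \<in> U" "A < e - B" "bd q k (\<lambda>x. g x - f x) A" by (auto simp: uball_def)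
    have "bd q k (\<lambda>x. (g x - f x) + (f x - f0 x)) (A + B)"
      by (intro bd_add U_diff A B S)
    then show "g \<in> S" using A B unfolding S uball_def by (auto intro!: exI[of _ "A + B"])
  qed
  then show ?case using S B by (metis diff_gt_0_iff_gt)
qed auto

abbreviation "dual \<equiv> udiff_dual a \<omega> c"

lemma dual_add: "S \<in> dual \<Longrightarrow> f \<in> U \<Longrightarrow> g \<in> U \<Longrightarrow> S (\<lambda>x. f x + g x) = S f + S g"
  and dual_scale: "S \<in> dual \<Longrightarrow> f \<in> U \<Longrightarrow> S (\<lambda>x. \<alpha> * f x) = \<alpha> * S f"
  by (auto simp: udiff_dual_def)

lemma dual_diff: "S \<in> dual \<Longrightarrow> f \<in> U \<Longrightarrow> g \<in> U \<Longrightarrow> S (\<lambda>x. f x - g x) = S f - S g"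
  using dual_add[OF _ _ U_scale[of g "-1"], of S f] dual_scale[of S g "-1"] by simp

lemma dual_zero: "S \<in> dual \<Longrightarrow> S (\<lambda>_. 0) = 0"
  using dual_scale[OF _ zero_U, of S 0] by simp

lemma dual_bound:
  assumes S: "S \<in> dual"
  shows "\<exists>q k C. 0 < q \<and> q < 1 \<and> C > 0 \<and> (\<forall>f\<in>U. \<forall>B. bd q k f B \<longrightarrow> cmod (S f) \<le> C * B)"
proof -
  have "continuous_map utop euclidean S" using S by (simp add: udiff_dual_def)
  then have "openin utop {f \<in> topspace utop. S f \<in> ball 0 1}"
    by (rule openin_continuous_map_preimage) simp
  then obtain q k e where q: "0 < q" "q < 1" "0 < e" "uball q k (\<lambda>_. 0) e \<subseteq> {f \<in> topspace utop. S f \<in> ball 0 1}"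
    using openin_top_uball[of "{f \<in> topspace utop. S f \<in> ball 0 1}" "\<lambda>_. 0"]
      zero_U topspace_top dual_zero[OF S] by auto
  have unit: "cmod (S f) < 1" if "f \<in> U" "bd q k f B" "B < e" for f B
    using q(4) that by (auto simp: uball_def)
  have pos: "cmod (S f) \<le> 2 / e * B" if f: "f \<in> U" "bd q k f B" and B: "B > 0" for f B
  proof -
    define t where "t = e / (2 * B)"
    have t: "t > 0" using B q by (simp add: t_def)
    have "bd q k (\<lambda>x. complex_of_real t * f x) (cmod (complex_of_real t) * B)"
      by (rule bd_scale[OF f])
    moreover have "cmod (complex_of_real t) * B = e / 2"
      using B q unfolding norm_of_real by (simp add: t_def)
    ultimately have "cmod (S (\<lambda>x. complex_of_real t * f x)) < 1"
      using unit[OF U_scale[OF f(1)], of "complex_of_real t" "cmod (complex_of_real t) * B"] q by simp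
    then have "t * cmod (S f) < 1" using dual_scale[OF S f(1)] t by (simp add: norm_mult)
    then show ?thesis using B q by (simp add: t_def field_simps)
  qed
  \<comment> \<open>The rescaling in \<open>pos\<close> needs \<open>B > 0\<close>; the bound
    \<open>B = 0\<close> is reached by letting a perturbation tend to 0. That case matters, as it
    shows that \<open>S\<close> ignores functions vanishing on \<open>{- c k..c k}\<close> with all
    derivatives.\<close>
  have "cmod (S f) \<le> 2 / e * B" if f: "f \<in> U" "bd q k f B" for f B
  proof (rule field_le_epsilon)
    fix d :: real assume d: "d > 0"
    have "bd q k f (B + d * e / 2)" using f(2) by (rule bd_mono) (use d q in simp)
    moreover have "B + d * e / 2 > 0" using bd_nonneg[OF f(2)] d q by (simp add: add_nonneg_pos)
    ultimately have "cmod (S f) \<le> 2 / e * (B + d * e / 2)" using pos f by blast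
    also have "\<dots> = 2 / e * B + d" using q by (simp add: field_simps)
    finally show "cmod (S f) \<le> 2 / e * B + d" .
  qed
  then have "0 < q \<and> q < 1 \<and> 2 / e > 0 \<and> (\<forall>f\<in>U. \<forall>B. bd q k f B \<longrightarrow> cmod (S f) \<le> 2 / e * B)"
    using q by simp
  then show ?thesis by blast
qed

lemma dualI:
  assumes add: "\<And>f g. f \<in> U \<Longrightarrow> g \<in> U \<Longrightarrow> S (\<lambda>x. f x + g x) = S f + S g"
    and scale: "\<And>\<alpha> f. f \<in> U \<Longrightarrow> S (\<lambda>x. \<alpha> * f x) = \<alpha> * S f"
    and zero: "\<And>f. f \<notin> U \<Longrightarrow> S f = 0"
    and q: "0 < q" "q < 1" and C: "\<And>f B. f \<in> U \<Longrightarrow> bd q k f B \<Longrightarrow> cmod (S f) \<le> C * B"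
  shows "S \<in> dual"
proof -
  have diff: "S (\<lambda>x. g x - f x) = S g - S f" if "f \<in> U" "g \<in> U" for f g
    using add[OF that(2) U_scale[OF that(1), of "-1"]] scale[OF that(1), of "-1"] by simp
  \<comment> \<open>\<open>C\<close> may be zero or negative, and the radius \<open>e / C'\<close>
    has to be positive.\<close>
  define C' where "C' = max C 1"
  have C': "cmod (S f) \<le> C' * B" if "f \<in> U" "bd q k f B" for f B
    using C[OF that] mult_right_mono[of C C' B] bd_nonneg[OF that(2)] by (simp add: C'_def)
  have "openin utop {f \<in> topspace utop. S f \<in> O'}" if O': "open O'" for O'
  proof (subst openin_subopen, intro ballI)
    fix f assume f: "f \<in> {f \<in> topspace utop. S f \<in> O'}"
    then obtain e where e: "e > 0" "ball (S f) e \<subseteq> O'" using O' openE by blast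
    have fU: "f \<in> U" using f topspace_top by simp
    have "uball q k f (e / C') \<subseteq> {f \<in> topspace utop. S f \<in> O'}"
    proof
      fix g assume "g \<in> uball q k f (e / C')"
      then obtain B where B: "g \<in> U" "B < e / C'" "bd q k (\<lambda>x. g x - f x) B" by (auto simp: uball_def)
      have "cmod (S g - S f) \<le> C' * B" using C'[OF U_diff[OF B(1) fU] B(3)] diff[OF fU B(1)] by simp
      also have "\<dots> < e" using B(2) by (simp add: C'_def field_simps)
      finally have "S g \<in> ball (S f) e" by (simp add: dist_norm norm_minus_commute)
      then show "g \<in> {f \<in> topspace utop. S f \<in> O'}" using e B topspace_top by auto
    qed
    moreover have "e / C' > 0" using e by (simp add: C'_def)
    ultimately show "\<exists>T. openin utop T \<and> f \<in> T \<and> T \<subseteq> {f \<in> topspace utop. S f \<in> O'}"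
      using openin_uball[OF fU q, of "e / C'" k] center_uball[OF fU, of "e / C'" q k]
      by (intro exI[of _ "uball q k f (e / C')"]) auto
  qed
  then have "continuous_map utop euclidean S" unfolding continuous_map_def by auto
  then show ?thesis using assms by (auto simp: udiff_dual_def)
qed

text \<open>\<open>P\<close> is a semi-norm scaled so that \<open>h\<close> has distance at least 1
  from \<open>W\<close>; then \<open>P\<close> dominates the real functional sending
  \<open>w + t h\<close> to \<open>t\<close>. Instead of extending that functional, all requirements
  are put into one sublinear \<open>p\<close>, an infimum over shifts by \<open>w + t h\<close>:
  every linear \<open>u \<le> p\<close> vanishes on \<open>W\<close>, has \<open>u h = 1\<close> and
  satisfies \<open>\<bar>u f\<bar> \<le> P f\<close>.\<close>

lemma separating_functional:
  assumes W: "W \<subseteq> U" "(\<lambda>_. 0) \<in> W" "\<And>f g. f \<in> W \<Longrightarrow> g \<in> W \<Longrightarrow> (\<lambda>x. f x + g x) \<in> W"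
      "\<And>\<alpha> f. f \<in> W \<Longrightarrow> (\<lambda>x. \<alpha> * f x) \<in> W"
    and closed: "closedin utop W" and h: "h \<in> U" "h \<notin> W"
  obtains S where "S \<in> dual" "\<And>f. f \<in> W \<Longrightarrow> S f = 0" "S h \<noteq> 0"
proof -
  have "openin utop (U - W)" using closed topspace_top by (simp add: closedin_def)
  then obtain q k e where q: "0 < q" "q < 1" "0 < e" and sub: "uball q k h e \<subseteq> U - W"
    using openin_top_uball[of "U - W" h] h by blast
  define P where "P f = real_of_ereal (udiff_norm a \<omega> c q k f) / e" for f
  have P_bd: "bd q k f (P f * e)" if "f \<in> U" for f
  proof -
    have "udiff_norm a \<omega> c q k f < \<infinity>" using U_bd[OF that q(1,2)] udiff_norm_finite_iff by blast
    then have "udiff_norm a \<omega> c q k f = ereal (P f * e)"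
      using udiff_norm_nonneg[of q k f] q by (cases "udiff_norm a \<omega> c q k f") (auto simp: P_def)
    then show ?thesis using udiff_norm_le_iff by force
  qed
  have P_le: "P f \<le> B / e" if "bd q k f B" for f B
  proof -
    have "udiff_norm a \<omega> c q k f \<le> ereal B" using that udiff_norm_le_iff by blast
    then have "real_of_ereal (udiff_norm a \<omega> c q k f) \<le> B"
      using udiff_norm_nonneg[of q k f] by (cases "udiff_norm a \<omega> c q k f") auto
    then show ?thesis using q unfolding P_def by (intro divide_right_mono) auto
  qed
  have P_nonneg: "P f \<ge> 0" for f
    using udiff_norm_nonneg[of q k f] q by (simp add: P_def real_of_ereal_pos)
  have P_add: "P (\<lambda>x. f x + g x) \<le> P f + P g" if "f \<in> U" "g \<in> U" for f g
    using P_le[OF bd_add[OF that P_bd[OF that(1)] P_bd[OF that(2)]]] q by (simp add: add_divide_distrib)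
  have P_scale: "P (\<lambda>x. \<alpha> * f x) \<le> cmod \<alpha> * P f" if "f \<in> U" for f \<alpha>
    using P_le[OF bd_scale[OF that P_bd[OF that], of \<alpha>]] q by simp
  have P_h: "1 \<le> P (\<lambda>x. f x - h x)" if "f \<in> W" for f
  proof (rule ccontr)
    assume "\<not> 1 \<le> P (\<lambda>x. f x - h x)"
    then have "P (\<lambda>x. f x - h x) * e < e" using q by simp
    then have "f \<in> uball q k h e" using P_bd[OF U_diff[of f h]] that W h by (auto simp: uball_def)
    then show False using sub that by blast
  qed
  \<comment> \<open>Division by \<open>- t\<close> turns \<open>f + t h\<close> into
    \<open>w - h\<close> with \<open>w\<close> in \<open>W\<close>, so that \<open>P_h\<close>
    applies.\<close>
  have P_W: "\<bar>t\<bar> \<le> P (\<lambda>x. f x + complex_of_real t * h x)" if f: "f \<in> W" for f t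
  proof (cases "t = 0")
    case False
    have "1 \<le> P (\<lambda>x. complex_of_real (- 1 / t) * f x - h x)" by (intro P_h W f)
    also have "(\<lambda>x. complex_of_real (- 1 / t) * f x - h x)
        = (\<lambda>x. complex_of_real (- 1 / t) * (f x + complex_of_real t * h x))"
      using False by (simp add: fun_eq_iff field_simps)
    also have "P \<dots> \<le> cmod (complex_of_real (- 1 / t)) * P (\<lambda>x. f x + complex_of_real t * h x)"
      by (intro P_scale U_add U_scale h) (use f W in auto)
    also have "cmod (complex_of_real (- 1 / t)) = 1 / \<bar>t\<bar>" unfolding norm_of_real by simp
    finally show ?thesis using False by (simp add: field_simps)
  qed (use P_nonneg in simp)
  define F where "F f w t = P (\<lambda>x. f x + w x + complex_of_real t * h x) - t" for f w t
  define p where "p f = (INF wt\<in>W \<times> UNIV. F f (fst wt) (snd wt))" for f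
  have lower: "- P (\<lambda>x. - f x) \<le> F f w t" if "f \<in> U" "w \<in> W" for f w t
  proof -
    have "t \<le> P (\<lambda>x. w x + complex_of_real t * h x)" using P_W[OF that(2), of t] by simp
    also have "\<dots> = P (\<lambda>x. (f x + w x + complex_of_real t * h x) + (- 1) * f x)"
      by (simp add: algebra_simps)
    also have "\<dots> \<le> P (\<lambda>x. f x + w x + complex_of_real t * h x) + P (\<lambda>x. (- 1) * f x)"
      using that W by (intro P_add U_add U_scale h) auto
    finally show ?thesis by (simp add: F_def)
  qed
  have p_le: "p f \<le> F f w t" if "f \<in> U" "w \<in> W" for f w t
  proof -
    have "bdd_below ((\<lambda>wt. F f (fst wt) (snd wt)) ` (W \<times> UNIV))"
      by (rule bdd_belowI2[of _ "- P (\<lambda>x. - f x)"]) (use lower that in auto)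
    then show ?thesis unfolding p_def using that
      cINF_lower[of "\<lambda>wt. F f (fst wt) (snd wt)" "W \<times> UNIV" "(w, t)"] by simp
  qed
  have p_ge: "B \<le> p f" if "\<And>w t. w \<in> W \<Longrightarrow> B \<le> F f w t" for B f
    unfolding p_def using that W(2) by (intro cINF_greatest) auto
  have U: "real_subspace U" using zero_U U_add U_scale by (auto simp: real_subspace_def)
  have sub_p: "sublinear_on U p"
  proof (rule sublinear_onI)
    have "P (\<lambda>_. 0) = 0" using P_le[OF bd_zero, of 0] P_nonneg[of "\<lambda>_. 0"] by simp
    then have "p (\<lambda>_. 0) \<le> 0" using p_le[OF zero_U W(2), of 0] by (simp add: F_def)
    moreover have "0 \<le> p (\<lambda>_. 0)"
      by (rule p_ge) (use lower[OF zero_U] \<open>P (\<lambda>_. 0) = 0\<close> in auto)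
    ultimately show "p (\<lambda>_. 0) = 0" by simp
  next
    fix f g assume f: "f \<in> U" and g: "g \<in> U"
    have *: "p (\<lambda>x. f x + g x) \<le> F f v s + F g w t" if vw: "v \<in> W" "w \<in> W" for v w s t
    proof -
      have "p (\<lambda>x. f x + g x) \<le> F (\<lambda>x. f x + g x) (\<lambda>x. v x + w x) (s + t)"
        by (intro p_le U_add W f g vw)
      also have "\<dots> = P (\<lambda>x. (f x + v x + complex_of_real s * h x) + (g x + w x + complex_of_real t * h x)) - (s + t)"
        by (simp add: F_def algebra_simps)
      also have "\<dots> \<le> P (\<lambda>x. f x + v x + complex_of_real s * h x) + P (\<lambda>x. g x + w x + complex_of_real t * h x) - (s + t)"
        using vw W(1) by (intro diff_right_mono P_add U_add U_scale f g h) auto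
      finally show ?thesis by (simp add: F_def)
    qed
    have "p (\<lambda>x. f x + g x) - F f v s \<le> p g" if v: "v \<in> W" for v s
      by (rule p_ge) (use *[OF v] in \<open>simp add: algebra_simps\<close>)
    then have "p (\<lambda>x. f x + g x) - p g \<le> p f"
      by (intro p_ge) (simp add: algebra_simps)
    then show "p (\<lambda>x. f x + g x) \<le> p f + p g" by simp
  next
    fix r :: real and f assume f: "f \<in> U" and r: "r > 0"
    have "p (\<lambda>x. complex_of_real r * f x) / r \<le> F f w t" if w: "w \<in> W" for w t
    proof -
      have "p (\<lambda>x. complex_of_real r * f x) \<le> F (\<lambda>x. complex_of_real r * f x) (\<lambda>x. complex_of_real r * w x) (r * t)"
        by (intro p_le U_scale W f w)
      also have "\<dots> = P (\<lambda>x. complex_of_real r * (f x + w x + complex_of_real t * h x)) - r * t"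
        by (simp add: F_def algebra_simps)
      also have "\<dots> \<le> cmod (complex_of_real r) * P (\<lambda>x. f x + w x + complex_of_real t * h x) - r * t"
        using w W(1) by (intro diff_right_mono P_scale U_add U_scale f h) auto
      also have "\<dots> = r * F f w t" using r by (simp add: F_def right_diff_distrib)
      finally show ?thesis using r by (simp add: pos_divide_le_eq mult.commute)
    qed
    then have "p (\<lambda>x. complex_of_real r * f x) / r \<le> p f" by (rule p_ge)
    then show "p (\<lambda>x. complex_of_real r * f x) \<le> r * p f" using r by (simp add: pos_divide_le_eq mult.commute)
  qed
  obtain u where u: "\<And>f g. f \<in> U \<Longrightarrow> g \<in> U \<Longrightarrow> u (\<lambda>x. f x + g x) = u f + u g"
    "\<And>r f. f \<in> U \<Longrightarrow> u (\<lambda>x. complex_of_real r * f x) = r * u f"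
    "\<And>f. f \<in> U \<Longrightarrow> u f \<le> p f"
    using Hahn_Banach_sublinear[OF U sub_p] by blast
  have u_minus: "u (\<lambda>x. - f x) = - u f" if "f \<in> U" for f using u(2)[OF that, of "-1"] by simp
  have P0: "P (\<lambda>_. 0) = 0" using P_le[OF bd_zero, of 0] P_nonneg[of "\<lambda>_. 0"] by simp
  have uW: "u f = 0" if f: "f \<in> W" for f
  proof -
    have le: "u g \<le> 0" if g: "g \<in> W" for g
    proof -
      have "u g \<le> F g (\<lambda>x. (-1) * g x) 0"
        using u(3)[of g] p_le[OF _ W(4)[OF g, of "-1"], of g 0] W(1) g by auto
      then show ?thesis using P0 by (simp add: F_def)
    qed
    have "u (\<lambda>x. - f x) \<le> 0" using le[OF W(4)[OF f, of "-1"]] by simp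
    then show ?thesis using le[OF f] u_minus[of f] f W(1) by auto
  qed
  have uh: "u h = 1"
  proof -
    have "u (\<lambda>x. - h x) \<le> F (\<lambda>x. - h x) (\<lambda>_. 0) 1"
      using u(3)[OF U_scale[OF h(1), of "-1"]] p_le[OF U_scale[OF h(1), of "-1"] W(2), of 1] by simp
    then have "- u h \<le> - 1" using P0 u_minus[OF h(1)] by (simp add: F_def)
    moreover have "u h \<le> F h (\<lambda>_. 0) (- 1)" using u(3)[OF h(1)] p_le[OF h(1) W(2), of "- 1"] by simp
    then have "u h \<le> 1" using P0 by (simp add: F_def)
    ultimately show ?thesis by simp
  qed
  have u_le: "\<bar>u f\<bar> \<le> P f" if f: "f \<in> U" for f
  proof -
    have le: "u g \<le> P g" if g: "g \<in> U" for g
      using u(3)[OF g] p_le[OF g W(2), of 0] by (simp add: F_def)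
    have "P (\<lambda>x. (-1) * f x) \<le> P f" using P_scale[OF f, of "-1"] by simp
    then show ?thesis using le[OF f] le[OF U_scale[OF f, of "-1"]] u_minus[OF f] by simp
  qed
  \<comment> \<open>A complex linear functional is recovered from its real part, because its
    imaginary part at \<open>f\<close> is minus its real part at \<open>\<i> * f\<close>.\<close>
  define S where "S f = (if f \<in> U then Complex (u f) (- u (\<lambda>x. \<i> * f x)) else 0)" for f
  have "S \<in> dual"
  proof (rule dualI[OF _ _ _ q(1,2)])
    fix f g assume f: "f \<in> U" and g: "g \<in> U"
    then show "S (\<lambda>x. f x + g x) = S f + S g"
      using u(1)[OF f g] u(1)[OF U_scale[OF f, of \<i>] U_scale[OF g, of \<i>]]
      by (simp add: S_def U_add complex_eq_iff distrib_left)
  next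
    fix \<alpha> f assume f: "f \<in> U"
    obtain r s where \<alpha>: "\<alpha> = Complex r s" by (cases \<alpha>)
    have "u (\<lambda>x. \<alpha> * f x) = u (\<lambda>x. complex_of_real r * f x + complex_of_real s * (\<i> * f x))"
      by (simp add: \<alpha> Complex_eq algebra_simps)
    also have "\<dots> = r * u f + s * u (\<lambda>x. \<i> * f x)"
      using u(1)[OF U_scale[OF f] U_scale[OF U_scale[OF f]]] u(2)[OF f] u(2)[OF U_scale[OF f]] by simp
    finally have 1: "u (\<lambda>x. \<alpha> * f x) = r * u f + s * u (\<lambda>x. \<i> * f x)" .
    have "u (\<lambda>x. \<i> * (\<alpha> * f x)) = u (\<lambda>x. complex_of_real r * (\<i> * f x) + complex_of_real (- s) * f x)"
      by (simp add: \<alpha> Complex_eq algebra_simps)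
    also have "\<dots> = u (\<lambda>x. complex_of_real r * (\<i> * f x)) + u (\<lambda>x. complex_of_real (- s) * f x)"
      by (intro u(1) U_scale f)
    also have "\<dots> = r * u (\<lambda>x. \<i> * f x) - s * u f"
      using u(2)[OF f, of "- s"] u(2)[OF U_scale[OF f], of r] by simp
    finally have 2: "u (\<lambda>x. \<i> * (\<alpha> * f x)) = r * u (\<lambda>x. \<i> * f x) - s * u f" .
    show "S (\<lambda>x. \<alpha> * f x) = \<alpha> * S f"
      using 1 2 f U_scale[OF f, of \<alpha>] by (simp add: S_def complex_eq_iff) (simp add: \<alpha> algebra_simps)
  next
    fix f B assume f: "f \<in> U" and B: "bd q k f B"
    have "cmod (S f) \<le> \<bar>u f\<bar> + \<bar>u (\<lambda>x. \<i> * f x)\<bar>"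
      using cmod_le[of "S f"] f by (simp add: S_def)
    also have "\<dots> \<le> P f + P (\<lambda>x. \<i> * f x)" by (intro add_mono u_le U_scale f)
    also have "\<dots> \<le> 2 * P f" using P_scale[OF f, of \<i>] by simp
    also have "\<dots> \<le> (2 / e) * B" using P_le[OF B] by simp
    finally show "cmod (S f) \<le> (2 / e) * B" .
  qed (simp add: S_def)
  moreover have "S f = 0" if "f \<in> W" for f
    using uW[OF that] uW[OF W(4)[OF that, of \<i>]] that by (simp add: S_def complex_eq_iff)
  moreover have "S h \<noteq> 0" using uh h by (simp add: S_def complex_eq_iff)
  ultimately show thesis using that by blast
qed

end

section \<open>Non-quasianalytic cutoffs\<close>

text \<open>Convolution with the normalised indicator function of \<open>[0;h]\<close>. The window
  lies to the left of \<open>x\<close>, so vanishing on the negative half-line is preserved and the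
  transition to 1 merely ends later by \<open>h\<close>.\<close>

definition avg :: "real \<Rightarrow> (real \<Rightarrow> real) \<Rightarrow> real \<Rightarrow> real" where
  "avg h f x = integral {x - h..x} f / h"

lemma avg_le:
  assumes "h > 0" "continuous_on UNIV f" "\<And>y. y \<in> {x - h..x} \<Longrightarrow> f y \<le> B"
  shows "avg h f x \<le> B"
proof -
  have "integral {x - h..x} f \<le> integral {x - h..x} (\<lambda>_. B)"
    by (intro integral_le integrable_continuous_real continuous_on_subset[OF assms(2)] assms(3)) auto
  also have "\<dots> = B * h" using assms(1) by simp
  finally show ?thesis using assms(1) by (simp add: avg_def pos_divide_le_eq)
qed

lemma avg_diff:
  assumes "continuous_on UNIV f" "continuous_on UNIV g"
  shows "avg h (\<lambda>y. f y - g y) x = avg h f x - avg h g x"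
  unfolding avg_def
  by (subst integral_diff)
    (auto intro!: integrable_continuous_real continuous_on_subset[OF assms(1)] continuous_on_subset[OF assms(2)]
      simp: diff_divide_distrib)

lemma avg_minus: "avg h (\<lambda>y. - f y) x = - avg h f x"
  by (simp add: avg_def)

lemma avg_ge:
  assumes "h > 0" "continuous_on UNIV f" "\<And>y. y \<in> {x - h..x} \<Longrightarrow> B \<le> f y"
  shows "B \<le> avg h f x"
  using avg_le[of h "\<lambda>y. - f y" x "- B"] assms by (simp add: avg_minus continuous_on_minus)

lemma avg_diff_le:
  assumes "h > 0" "continuous_on UNIV f" "continuous_on UNIV g" "\<And>y. \<bar>f y - g y\<bar> \<le> e"
  shows "\<bar>avg h f x - avg h g x\<bar> \<le> e"
proof -
  have c: "continuous_on UNIV (\<lambda>y. f y - g y)" by (intro continuous_intros assms)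
  have "f y - g y \<le> e" "- e \<le> f y - g y" for y using assms(4)[of y] by linarith+
  then have "avg h (\<lambda>y. f y - g y) x \<le> e" "- e \<le> avg h (\<lambda>y. f y - g y) x"
    by (auto intro!: avg_le avg_ge assms(1) c)
  then show ?thesis using avg_diff[OF assms(2,3)] by simp
qed

lemma avg_derivative:
  assumes "h > 0" and f: "continuous_on UNIV f"
  shows "(avg h f has_real_derivative (f x - f (x - h)) / h) (at x)"
proof -
  define b where "b = x - h - 1"
  define G where "G y = integral {b..y} f" for y
  have G: "(G has_real_derivative f y) (at y)" if "b < y" for y
  proof -
    have "(G has_real_derivative f y) (at y within {b..y + 1})"
      unfolding G_def using that
      by (intro integral_has_real_derivative continuous_on_subset[OF f]) auto
    then show ?thesis using that by (subst (asm) at_within_interior) (auto simp: interior_atLeastAtMost_real)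
  qed
  have eq: "(G y - G (y - h)) / h = avg h f y" if "y \<in> {x - 1<..}" for y
  proof -
    have "integral {b..y - h} f + integral {y - h..y} f = integral {b..y} f"
      using that assms(1)
      by (intro Henstock_Kurzweil_Integration.integral_combine integrable_continuous_real continuous_on_subset[OF f])
        (auto simp: b_def)
    then show ?thesis by (simp add: avg_def G_def)
  qed
  have "((\<lambda>y. G (y - h)) has_real_derivative f (x - h) * 1) (at x)"
    by (rule DERIV_chain2[OF G]) (auto intro!: derivative_eq_intros simp: b_def)
  moreover have "(G has_real_derivative f x) (at x)" using assms(1) by (intro G) (simp add: b_def)
  ultimately have "((\<lambda>y. (G y - G (y - h)) / h) has_real_derivative (f x - f (x - h) * 1) / h) (at x)"
    by (intro DERIV_cdivide DERIV_diff)
  then have "((\<lambda>y. (G y - G (y - h)) / h) has_real_derivative (f x - f (x - h)) / h) (at x)" by simp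
  then show ?thesis
    by (rule has_field_derivative_transform_within_open[of _ _ _ "{x - 1<..}"]) (use eq in auto)
qed

lemma avg_continuous: "h > 0 \<Longrightarrow> continuous_on UNIV f \<Longrightarrow> continuous_on UNIV (avg h f)"
  by (meson avg_derivative DERIV_continuous_on has_field_derivative_at_within)

text \<open>The iterated averages \<open>A\<^bsub>h 0\<^esub> A\<^bsub>h 1\<^esub> \<dots> A\<^bsub>h (n-1)\<^esub>\<close> of a piecewise linear step; the new average is
  always applied innermost, so consecutive iterates differ by at most \<open>h n / \<delta>\<close>.\<close>

fun box_step :: "real \<Rightarrow> nat \<Rightarrow> (nat \<Rightarrow> real) \<Rightarrow> real \<Rightarrow> real" where
  "box_step \<delta> 0 h x = max 0 (min 1 (x / \<delta>))"
| "box_step \<delta> (Suc n) h x = avg (h 0) (box_step \<delta> n (\<lambda>i. h (Suc i))) x"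

text \<open>The limit of \<open>box_step \<delta> n h\<close> as \<open>n\<close> grows, written as
  a telescoping series so that the Weierstrass test gives uniform convergence.\<close>

definition smooth_step :: "real \<Rightarrow> (nat \<Rightarrow> real) \<Rightarrow> real \<Rightarrow> real" where
  "smooth_step \<delta> h x = box_step \<delta> 0 h x + (\<Sum>n. box_step \<delta> (Suc n) h x - box_step \<delta> n h x)"

text \<open>The derivative of an average of width \<open>h 0\<close> is the difference quotient with
  that increment, so the derivatives of \<open>smooth_step\<close> are iterated difference
  quotients. Each order consumes one width and costs a factor \<open>2 / h i\<close>.\<close>

fun step_jet :: "real \<Rightarrow> nat \<Rightarrow> (nat \<Rightarrow> real) \<Rightarrow> real \<Rightarrow> real" where
  "step_jet \<delta> 0 h x = smooth_step \<delta> h x"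
| "step_jet \<delta> (Suc j) h x
    = (step_jet \<delta> j (\<lambda>i. h (Suc i)) x - step_jet \<delta> j (\<lambda>i. h (Suc i)) (x - h 0)) / h 0"

context
  fixes \<delta> :: real
  assumes \<delta>: "\<delta> > 0"
begin

lemma box_step_Suc: "box_step \<delta> (Suc n) h = avg (h 0) (box_step \<delta> n (\<lambda>i. h (Suc i)))"
  by (simp add: fun_eq_iff)

lemma box_step_continuous: "(\<And>i. h i > 0) \<Longrightarrow> continuous_on UNIV (box_step \<delta> n h)"
proof (induction n arbitrary: h)
  case 0
  have "box_step \<delta> 0 h = (\<lambda>x. max 0 (min 1 (x / \<delta>)))" by (simp add: fun_eq_iff)
  then show ?case using \<delta> by (auto intro!: continuous_intros)
next
  case (Suc n)
  then show ?case unfolding box_step_Suc by (intro avg_continuous Suc.IH) auto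
qed

lemma box_step_bounds:
  assumes "\<And>i. h i > 0" shows "0 \<le> box_step \<delta> n h x \<and> box_step \<delta> n h x \<le> 1"
  using assms
proof (induction n arbitrary: h x)
  case (Suc n)
  then show ?case unfolding box_step_Suc
    by (auto intro!: avg_le avg_ge box_step_continuous)
qed auto

text \<open>The outer averages are contractions for the supremum norm, which leaves the ramp against
  its average of width \<open>h n\<close>; the ramp has Lipschitz constant
  \<open>1 / \<delta>\<close>.\<close>

lemma box_step_diff:
  assumes "\<And>i. h i > 0" shows "\<bar>box_step \<delta> (Suc n) h x - box_step \<delta> n h x\<bar> \<le> h n / \<delta>"
  using assms
proof (induction n arbitrary: h x)
  case 0
  let ?f = "\<lambda>x. max 0 (min 1 (x / \<delta>))"
  have f: "box_step \<delta> 0 g = ?f" for g by (simp add: fun_eq_iff)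
  have c: "continuous_on UNIV ?f" using \<delta> by (auto intro!: continuous_intros)
  have lip: "?f x - h 0 / \<delta> \<le> ?f y \<and> ?f y \<le> ?f x + h 0 / \<delta>" if "y \<in> {x - h 0..x}" for y
  proof -
    have "x / \<delta> - y / \<delta> \<le> h 0 / \<delta>" "y / \<delta> \<le> x / \<delta>"
      using that \<delta> by (auto simp: diff_divide_distrib[symmetric] divide_right_mono)
    moreover have "0 < h 0 / \<delta>" using 0 \<delta> by simp
    ultimately show ?thesis by linarith
  qed
  have "avg (h 0) ?f x \<le> ?f x + h 0 / \<delta>" "?f x - h 0 / \<delta> \<le> avg (h 0) ?f x"
    using lip 0 c by (auto intro!: avg_le avg_ge)
  then show ?case unfolding box_step_Suc f by linarith
next
  case (Suc n)
  show ?case unfolding box_step_Suc[of "Suc n" h] box_step_Suc[of n h]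
    by (intro avg_diff_le box_step_continuous Suc.IH[of "\<lambda>i. h (Suc i)"] Suc.prems)
qed

lemma box_step_left: "(\<And>i. h i > 0) \<Longrightarrow> x \<le> 0 \<Longrightarrow> box_step \<delta> n h x = 0"
proof (induction n arbitrary: h x)
  case 0
  then have "x / \<delta> \<le> 0" using \<delta> by (simp add: divide_nonpos_pos)
  then show ?case by simp
next
  case (Suc n)
  have "box_step \<delta> (Suc n) h x \<le> 0"
    unfolding box_step_Suc using Suc by (intro avg_le box_step_continuous) (auto intro: eq_refl)
  moreover have "0 \<le> box_step \<delta> (Suc n) h x" using box_step_bounds[of h] Suc.prems(1) by blast
  ultimately show ?case by linarith
qed

lemma box_step_right: "(\<And>i. h i > 0) \<Longrightarrow> x \<ge> \<delta> + (\<Sum>i<n. h i) \<Longrightarrow> box_step \<delta> n h x = 1"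
proof (induction n arbitrary: h x)
  case 0
  then show ?case using \<delta> by (simp add: field_simps)
next
  case (Suc n)
  have "1 \<le> box_step \<delta> n (\<lambda>i. h (Suc i)) y" if "y \<in> {x - h 0..x}" for y
  proof -
    have "(\<Sum>i<Suc n. h i) = h 0 + (\<Sum>i<n. h (Suc i))" by (rule sum.lessThan_Suc_shift)
    then show ?thesis using that Suc.prems Suc.IH[of "\<lambda>i. h (Suc i)" y] by (intro eq_refl) auto
  qed
  then have "1 \<le> box_step \<delta> (Suc n) h x"
    unfolding box_step_Suc using Suc.prems by (intro avg_ge box_step_continuous)
  moreover have "box_step \<delta> (Suc n) h x \<le> 1" using box_step_bounds[of h] Suc.prems(1) by blast
  ultimately show ?case by linarith
qed

lemma box_step_uniform_limit:
  assumes h: "\<And>i. h i > 0" "summable h"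
  shows "uniform_limit UNIV (\<lambda>n. box_step \<delta> n h) (smooth_step \<delta> h) sequentially"
proof -
  have "uniform_limit UNIV (\<lambda>n x. \<Sum>i<n. box_step \<delta> (Suc i) h x - box_step \<delta> i h x)
      (\<lambda>x. suminf (\<lambda>i. box_step \<delta> (Suc i) h x - box_step \<delta> i h x)) sequentially"
    by (rule Weierstrass_m_test[of _ _ "\<lambda>i. h i / \<delta>"])
      (use box_step_diff[OF h(1)] h(2) in \<open>auto simp del: box_step.simps intro: summable_divide\<close>)
  then have "uniform_limit UNIV (\<lambda>n x. box_step \<delta> 0 h x + (\<Sum>i<n. box_step \<delta> (Suc i) h x - box_step \<delta> i h x))
      (\<lambda>x. smooth_step \<delta> h x) sequentially"
    unfolding smooth_step_def by (intro uniform_limit_add uniform_limit_const)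
  moreover have "box_step \<delta> 0 h x + (\<Sum>i<n. box_step \<delta> (Suc i) h x - box_step \<delta> i h x) = box_step \<delta> n h x" for n x
    by (subst sum_lessThan_telescope) simp
  ultimately show ?thesis by (simp only:)
qed

lemma box_step_tendsto:
  "(\<And>i. h i > 0) \<Longrightarrow> summable h \<Longrightarrow> (\<lambda>n. box_step \<delta> n h x) \<longlonglongrightarrow> smooth_step \<delta> h x"
  using tendsto_uniform_limitI[OF box_step_uniform_limit] by blast

lemma smooth_step_continuous:
  "(\<And>i. h i > 0) \<Longrightarrow> summable h \<Longrightarrow> continuous_on UNIV (smooth_step \<delta> h)"
  by (rule uniform_limit_theorem[OF _ box_step_uniform_limit]) (auto intro!: always_eventually box_step_continuous)

text \<open>Averaging is a contraction for the supremum norm, so the recursion of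
  \<open>box_step\<close> survives the uniform limit. Smoothness follows, since an average can be
  differentiated once more than the function averaged.\<close>

lemma smooth_step_avg:
  assumes h: "\<And>i. h i > 0" "summable h"
  shows "smooth_step \<delta> h = avg (h 0) (smooth_step \<delta> (\<lambda>i. h (Suc i)))"
proof
  fix x
  let ?h = "\<lambda>i. h (Suc i)"
  have h': "\<And>i. ?h i > 0" "summable ?h" using h by (auto simp: summable_Suc_iff)
  have "(\<lambda>n. box_step \<delta> (Suc n) h x) \<longlonglongrightarrow> avg (h 0) (smooth_step \<delta> ?h) x"
    unfolding box_step_Suc
  proof (rule tendstoI)
    fix e :: real assume e: "e > 0"
    have "\<forall>\<^sub>F n in sequentially. \<forall>x\<in>UNIV. dist (box_step \<delta> n ?h x) (smooth_step \<delta> ?h x) < e / 2"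
      using box_step_uniform_limit[OF h'] e by (intro uniform_limitD) auto
    then show "\<forall>\<^sub>F n in sequentially. dist (avg (h 0) (box_step \<delta> n ?h) x) (avg (h 0) (smooth_step \<delta> ?h) x) < e"
    proof eventually_elim
      case (elim n)
      have "\<bar>avg (h 0) (box_step \<delta> n ?h) x - avg (h 0) (smooth_step \<delta> ?h) x\<bar> \<le> e / 2"
        using elim by (intro avg_diff_le box_step_continuous smooth_step_continuous h' h(1)) (auto simp: dist_real_def less_imp_le)
      then show ?case using e by (simp add: dist_real_def)
    qed
  qed
  moreover have "(\<lambda>n. box_step \<delta> (Suc n) h x) \<longlonglongrightarrow> smooth_step \<delta> h x"
    using box_step_tendsto[OF h] by (rule LIMSEQ_Suc)
  ultimately show "smooth_step \<delta> h x = avg (h 0) (smooth_step \<delta> ?h) x" using LIMSEQ_unique by blast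
qed

lemma smooth_step_bounds:
  assumes h: "\<And>i. h i > 0" "summable h"
  shows "0 \<le> smooth_step \<delta> h x" "smooth_step \<delta> h x \<le> 1"
    "x \<le> 0 \<Longrightarrow> smooth_step \<delta> h x = 0" "x \<ge> \<delta> + suminf h \<Longrightarrow> smooth_step \<delta> h x = 1"
proof -
  note lim = box_step_tendsto[OF h, of x]
  show "0 \<le> smooth_step \<delta> h x"
    by (rule LIMSEQ_le_const[OF lim]) (use box_step_bounds[of h] h(1) in blast)
  show "smooth_step \<delta> h x \<le> 1"
    by (rule LIMSEQ_le_const2[OF lim]) (use box_step_bounds[of h] h(1) in blast)
  show "smooth_step \<delta> h x = 0" if "x \<le> 0"
    using lim box_step_left[OF h(1) that] by (simp add: LIMSEQ_const_iff)
  show "smooth_step \<delta> h x = 1" if x: "x \<ge> \<delta> + suminf h"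
  proof -
    have "box_step \<delta> n h x = 1" for n
    proof (rule box_step_right[OF h(1)])
      have "(\<Sum>i<n. h i) \<le> suminf h" by (rule sum_le_suminf) (use h in \<open>auto simp: less_imp_le\<close>)
      then show "x \<ge> \<delta> + (\<Sum>i<n. h i)" using x by linarith
    qed
    then show ?thesis using lim by (simp add: LIMSEQ_const_iff)
  qed
qed

lemma step_jet_derivative:
  assumes "\<And>i. h i > 0" "summable h"
  shows "(step_jet \<delta> j h has_real_derivative step_jet \<delta> (Suc j) h x) (at x)"
  using assms
proof (induction j arbitrary: h x)
  case 0
  have h': "\<And>i. h (Suc i) > 0" "summable (\<lambda>i. h (Suc i))" using 0 by (auto simp: summable_Suc_iff)
  have "step_jet \<delta> 0 h = avg (h 0) (smooth_step \<delta> (\<lambda>i. h (Suc i)))"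
    using smooth_step_avg[OF 0] by (simp add: fun_eq_iff)
  then show ?case using avg_derivative[OF 0(1) smooth_step_continuous[OF h']] by simp
next
  case (Suc j)
  let ?h = "\<lambda>i. h (Suc i)"
  have h': "\<And>i. ?h i > 0" "summable ?h" using Suc.prems by (auto simp: summable_Suc_iff)
  have pos: "h 0 > 0" using Suc.prems by blast
  have eq: "step_jet \<delta> (Suc j) h = (\<lambda>x. (step_jet \<delta> j ?h x - step_jet \<delta> j ?h (x - h 0)) / h 0)" by auto
  have "((\<lambda>x. step_jet \<delta> j ?h (x - h 0)) has_real_derivative step_jet \<delta> (Suc j) ?h (x - h 0) * 1) (at x)"
    by (rule DERIV_chain2[OF Suc.IH[OF h']]) (auto intro!: derivative_eq_intros)
  then have "((\<lambda>x. (step_jet \<delta> j ?h x - step_jet \<delta> j ?h (x - h 0)) / h 0) has_real_derivative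
      (step_jet \<delta> (Suc j) ?h x - step_jet \<delta> (Suc j) ?h (x - h 0) * 1) / h 0) (at x)"
    by (intro DERIV_cdivide DERIV_diff Suc.IH[OF h'])
  then show ?case
    unfolding eq step_jet.simps(2)[of \<delta> "Suc j" h] by (simp only: mult_1_right)
qed

lemma step_jet_bound:
  assumes "\<And>i. h i > 0" "summable h"
  shows "\<bar>step_jet \<delta> j h x\<bar> \<le> (\<Prod>i<j. 2 / h i)"
  using assms
proof (induction j arbitrary: h x)
  case 0
  then show ?case using smooth_step_bounds[OF 0] by (simp add: abs_le_iff order_trans[of _ 0])
next
  case (Suc j)
  let ?h = "\<lambda>i. h (Suc i)"
  have h': "\<And>i. ?h i > 0" "summable ?h" using Suc.prems by (auto simp: summable_Suc_iff)
  have pos: "h 0 > 0" using Suc.prems by blast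
  have "\<bar>step_jet \<delta> j ?h x - step_jet \<delta> j ?h (x - h 0)\<bar> \<le> 2 * (\<Prod>i<j. 2 / ?h i)"
    using Suc.IH[OF h', of x] Suc.IH[OF h', of "x - h 0"] by linarith
  then have "\<bar>step_jet \<delta> (Suc j) h x\<bar> \<le> (2 * (\<Prod>i<j. 2 / ?h i)) / h 0"
    using pos by (simp add: divide_right_mono)
  also have "\<dots> = (\<Prod>i<Suc j. 2 / h i)" by (subst prod.lessThan_Suc_shift) simp
  finally show ?case .
qed

end

lemma jet_on_locally_const:
  assumes F: "jet_on UNIV F" and O: "open O'" and c: "\<And>x. x \<in> O' \<Longrightarrow> F 0 x = b" and x: "x \<in> O'"
  shows "F (Suc j) x = 0"
  using x
proof (induction j arbitrary: x)
  case 0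
  have "(F 0 has_vector_derivative 0) (at x)"
    by (rule has_vector_derivative_transform_within_open[OF has_vector_derivative_const[of b] O 0]) (simp add: c)
  then show ?case using jet_onD[OF F UNIV_I, of 0 x] vector_derivative_unique_at by blast
next
  case (Suc j)
  have "(F (Suc j) has_vector_derivative 0) (at x)"
    by (rule has_vector_derivative_transform_within_open[OF has_vector_derivative_const[of 0] O Suc.prems]) (simp add: Suc.IH)
  then show ?case using jet_onD[OF F UNIV_I, of "Suc j" x] vector_derivative_unique_at by blast
qed

section \<open>Averaging widths adapted to the weight\<close>

context udiff_setting
begin

text \<open>Non-quasianalyticity: with \<open>\<omega> (X i) = i + const\<close>, the sum of \<open>1 / X i = \<integral>\<^bsub>X i\<^esub>\<^sup>\<infinity> x\<^sup>-\<^sup>2 dx\<close> counts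
  the \<open>X i\<close> below \<open>x\<close>, at most \<open>\<omega> x\<close> of them.\<close>

lemma nonquasianalytic_sequence:
  obtains X :: "nat \<Rightarrow> real" and n0 :: nat
  where "\<And>i. X i \<ge> exp 1" "\<And>i. \<omega> (X i) = real (i + 1 + n0)" "summable (\<lambda>i. 1 / X i)"
proof -
  \<comment> \<open>Values of \<open>\<omega>\<close> not below \<open>\<omega> (exp 1)\<close> let
    the intermediate value theorem on \<open>[exp 1;Y]\<close> supply the points
    \<open>X i\<close>.\<close>
  define n0 where "n0 = nat \<lceil>\<omega> (exp 1)\<rceil>"
  have n0: "\<omega> (exp 1) \<le> real n0" unfolding n0_def by (rule real_nat_ceiling_ge)
  have "\<exists>x\<ge>exp 1. \<omega> x = real (i + 1 + n0)" for i
  proof -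
    obtain Y where Y: "Y \<ge> exp 1" "\<omega> Y \<ge> real (i + 1 + n0)" using omega_unbounded by blast
    have "continuous_on {0..} \<omega>" using weight by (simp add: weight_def)
    then have "continuous_on {exp 1..Y} \<omega>"
      by (rule continuous_on_subset) (auto intro: order_trans[OF less_imp_le[OF exp_gt_zero]])
    then show ?thesis using IVT'[of \<omega> "exp 1" "real (i + 1 + n0)" Y] Y n0 by auto
  qed
  then obtain X where X: "\<And>i. X i \<ge> exp 1" "\<And>i. \<omega> (X i) = real (i + 1 + n0)" by metis
  have X1: "X i \<ge> 1" for i using X(1)[of i] exp_ge_add_one_self[of 1] by linarith
  have Xpos: "X i > 0" for i using X1[of i] by linarith
  have int: "set_integrable lborel {1..} (\<lambda>x. \<omega> x / x\<^sup>2)" using weight by (simp add: weight_def)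
  define I where "I = (LINT x|lborel. indicator {1..} x * (\<omega> x / x\<^sup>2))"
  have count: "(\<Sum>i<n. indicator {X i..} x) \<le> \<omega> x * indicator {1..} x" for n x
  proof (cases "x \<ge> 1")
    case True
    have "(\<Sum>i<n. indicator {X i..} x) = real (card {i\<in>{..<n}. X i \<le> x})"
      by (simp add: indicator_def sum.If_cases Int_def)
    also have "\<dots> \<le> real (card {i. i < nat \<lfloor>\<omega> x\<rfloor>})"
    proof -
      have "i < nat \<lfloor>\<omega> x\<rfloor>" if "X i \<le> x" for i
      proof -
        have "real (i + 1) \<le> \<omega> x" using omega_mono[OF _ that] X(2)[of i] Xpos[of i] by simp
        then have "int (i + 1) \<le> \<lfloor>\<omega> x\<rfloor>" by (simp add: le_floor_iff)
        then show ?thesis by linarith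
      qed
      then show ?thesis by (intro of_nat_mono card_mono) auto
    qed
    also have "\<dots> \<le> \<omega> x" using omega_nonneg[of x] True by simp
    finally show ?thesis using True by simp
  next
    case False
    then have "\<not> X i \<le> x" for i using X1[of i] by linarith
    then show ?thesis using False by simp
  qed
  have partial: "(\<Sum>i<n. 1 / X i) \<le> I" for n
  proof -
    have tail: "(\<integral>\<^sup>+x. ennreal (1 / x\<^sup>2) * indicator {X i..} x \<partial>lborel) = ennreal (1 / X i)" for i
    proof -
      have "((\<lambda>x::real. - (1 / x)) \<longlongrightarrow> - 0) at_top"
        by (intro tendsto_minus tendsto_divide_0[OF tendsto_const] filterlim_at_top_imp_at_infinity filterlim_ident)
      moreover have "DERIV (\<lambda>x. - (1 / x)) x :> 1 / x\<^sup>2" if "X i \<le> x" for x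
        using that Xpos[of i] by (auto intro!: derivative_eq_intros simp: power2_eq_square)
      ultimately have "(\<integral>\<^sup>+x. ennreal (1 / x\<^sup>2) * indicator {X i..} x \<partial>lborel) = (0::real) - (- (1 / X i))"
        by (intro nn_integral_FTC_atLeast) auto
      then show ?thesis by simp
    qed
    have "ennreal (\<Sum>i<n. 1 / X i) = (\<Sum>i<n. ennreal (1 / X i))"
      using Xpos by (simp add: less_imp_le)
    also have "\<dots> = (\<integral>\<^sup>+x. (\<Sum>i<n. ennreal (1 / x\<^sup>2) * indicator {X i..} x) \<partial>lborel)"
      unfolding tail[symmetric] by (intro nn_integral_sum[symmetric]) auto
    also have "\<dots> \<le> (\<integral>\<^sup>+x. ennreal (indicator {1..} x * (\<omega> x / x\<^sup>2)) \<partial>lborel)"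
    proof (rule nn_integral_mono)
      fix x :: real
      have "(\<Sum>i<n. ennreal (1 / x\<^sup>2) * indicator {X i..} x) = ennreal (\<Sum>i<n. 1 / x\<^sup>2 * indicator {X i..} x)"
      proof -
        have "ennreal (1 / x\<^sup>2) * indicator {X i..} x = ennreal (1 / x\<^sup>2 * indicator {X i..} x)" for i
          by (simp add: indicator_def)
        then show ?thesis by (simp only: sum_ennreal[of "{..<n}" "\<lambda>i. 1 / x\<^sup>2 * indicator {X i..} x"] zero_le_mult_iff) simp
      qed
      also have "(\<Sum>i<n. 1 / x\<^sup>2 * indicator {X i..} x) = 1 / x\<^sup>2 * (\<Sum>i<n. indicator {X i..} x)"
        by (rule sum_distrib_left[symmetric])
      also have "\<dots> \<le> 1 / x\<^sup>2 * (\<omega> x * indicator {1..} x)"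
        by (intro mult_left_mono count) auto
      also have "\<dots> = indicator {1..} x * (\<omega> x / x\<^sup>2)" by simp
      finally show "(\<Sum>i<n. ennreal (1 / x\<^sup>2) * indicator {X i..} x) \<le> ennreal (indicator {1..} x * (\<omega> x / x\<^sup>2))"
        by (simp add: ennreal_leI)
    qed
    also have "\<dots> = ennreal I"
      unfolding I_def using int unfolding set_integrable_def
      by (intro nn_integral_eq_integral) (auto simp: omega_nonneg indicator_def)
    finally have "ennreal (\<Sum>i<n. 1 / X i) \<le> ennreal I" .
    moreover have "0 \<le> I" unfolding I_def
      by (intro Bochner_Integration.integral_nonneg) (auto simp: omega_nonneg indicator_def)
    ultimately show ?thesis by (simp add: ennreal_le_iff)
  qed
  have "summable (\<lambda>i. 1 / X i)"
    by (rule bounded_imp_summable[of _ I]) (use Xpos partial[of "Suc _"] in \<open>auto simp: less_imp_le lessThan_Suc_atMost\<close>)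
  then show thesis using that[of X n0] X by blast
qed

text \<open>Widths \<open>2 * exp 1 / Y i\<close>, taken from an index \<open>n\<close> on to make
  their sum small, bound the \<open>j\<close>-th derivative by a product of \<open>j\<close>
  quotients \<open>Y i / exp 1\<close>, hence by \<open>y ^ j * exp (- j)\<close> with
  \<open>y\<close> the last \<open>Y i\<close>. As \<open>\<omega> (Y i)\<close> grows by exactly 1
  with \<open>i\<close>, \<open>exp (- j)\<close> is a constant times
  \<open>exp (- \<omega> y)\<close>, and \<open>M 1 j\<close> is the supremum of such expressions. A
  bound by \<open>M 1 j\<close> serves every \<open>q < 1\<close>.\<close>

lemma cutoff_exists:
  assumes "p < p'"
  obtains X C where "jet_on UNIV X" "\<And>j x. cmod (X j x) \<le> C * M 1 j"
    "\<And>j x. x \<le> p \<Longrightarrow> X j x = 0" "\<And>x. x \<ge> p' \<Longrightarrow> X 0 x = 1" "\<And>j x. x \<ge> p' \<Longrightarrow> X (Suc j) x = 0"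
proof -
  obtain Y :: "nat \<Rightarrow> real" and n0 :: nat where Y: "\<And>i. Y i \<ge> exp 1" "\<And>i. \<omega> (Y i) = real (i + 1 + n0)" "summable (\<lambda>i. 1 / Y i)"
    using nonquasianalytic_sequence by blast
  have Ypos: "Y i > 0" for i using Y(1)[of i] exp_gt_zero[of "1::real"] by linarith
  \<comment> \<open>The four quarters are a margin, the ramp, the averaging widths with sum below
    \<open>\<delta>\<close>, and another margin. The margins make the step constant around each
    point up to \<open>p\<close> and from \<open>p'\<close> on, so that all derivatives vanish
    there.\<close>
  define \<delta> where "\<delta> = (p' - p) / 4"
  have \<delta>: "\<delta> > 0" using assms by (simp add: \<delta>_def)
  have "(\<lambda>n. \<Sum>i. 2 * exp 1 * (1 / Y (i + n))) \<longlonglongrightarrow> 0"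
    using suminf_exist_split2[OF summable_mult[OF Y(3), of "2 * exp 1"]] by simp
  then have "\<forall>\<^sub>F n in sequentially. (\<Sum>i. 2 * exp 1 * (1 / Y (i + n))) < \<delta>"
    using \<delta> by (rule order_tendstoD)
  then obtain n where n: "(\<Sum>i. 2 * exp 1 * (1 / Y (i + n))) < \<delta>"
    by (meson eventually_sequentially order_refl)
  define h where "h i = 2 * exp 1 * (1 / Y (i + n))" for i
  have h: "h i > 0" "summable h" "suminf h < \<delta>" for i
  proof -
    have "summable (\<lambda>i. 1 / Y (i + n))" using Y(3) by (subst summable_iff_shift)
    then show "summable h" unfolding h_def by (rule summable_mult)
    show "h i > 0" using Ypos by (simp add: h_def)
    show "suminf h < \<delta>" using n unfolding h_def[abs_def] .
  qed
  have Y1: "Y i \<ge> 1" for i using Y(1)[of i] exp_ge_add_one_self[of 1] by linarith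
  have Ymono: "Y i \<le> Y m" if "i \<le> m" for i m
  proof (rule ccontr)
    assume "\<not> Y i \<le> Y m"
    then have "\<omega> (Y m) \<le> \<omega> (Y i)" using Ypos[of m] by (intro omega_mono) auto
    then have "i = m" using Y(2) that by simp
    then show False using \<open>\<not> Y i \<le> Y m\<close> by simp
  qed
  \<comment> \<open>\<open>exp (n + n0)\<close> compensates the offset between
    \<open>\<omega> (Y (m + n))\<close> and \<open>j = m + 1\<close>; the additional 1 is for
    \<open>j = 0\<close>.\<close>
  define C where "C = exp (real (n + n0 + 1))"
  have prod: "(\<Prod>i<j. 2 / h i) \<le> C * M 1 j" for j
  proof (cases j)
    case 0
    have "exp (- 1 * \<omega> 1) \<le> M 1 0" using M_upper[of 1 1 0] by simp
    moreover have "\<omega> 1 \<le> \<omega> (Y 0)" using Y1 by (intro omega_mono) auto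
    then have "exp (- real (n + n0 + 1)) \<le> exp (- 1 * \<omega> 1)" using Y(2)[of 0] by simp
    ultimately have "exp (- real (n + n0 + 1)) \<le> M 1 0" by linarith
    then have "C * exp (- real (n + n0 + 1)) \<le> C * M 1 0" by (intro mult_left_mono) (auto simp: C_def)
    moreover have "C * exp (- real (n + n0 + 1)) = 1" unfolding C_def mult_exp_exp by simp
    ultimately show ?thesis using 0 by simp
  next
    case (Suc m)
    have "(\<Prod>i<j. 2 / h i) = (\<Prod>i<j. Y (i + n) / exp 1)" by (simp add: h_def)
    also have "\<dots> \<le> (\<Prod>i<j. Y (m + n) / exp 1)"
      using Suc Ypos by (intro prod_mono) (auto intro!: divide_right_mono Ymono simp: less_imp_le)
    also have "\<dots> = Y (m + n) ^ j * exp (- real j)"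
      by (simp add: power_divide exp_of_nat_mult[symmetric] exp_minus field_simps)
    also have "\<dots> \<le> Y (m + n) ^ j * (C * exp (- 1 * \<omega> (Y (m + n))))"
      using Ypos[of "m + n"] Suc Y(2)[of "m + n"]
      by (intro mult_left_mono) (auto simp: C_def mult_exp_exp)
    also have "\<dots> = C * (Y (m + n) ^ j * exp (- 1 * \<omega> (Y (m + n))))" by simp
    also have "\<dots> \<le> C * M 1 j" by (intro mult_left_mono M_upper Y1) (auto simp: C_def)
    finally show ?thesis .
  qed
  define X where "X j x = complex_of_real (step_jet \<delta> j h (x - (p + \<delta>)))" for j x
  have jX: "jet_on UNIV X"
    unfolding jet_on_def X_def[abs_def]
  proof (intro allI ballI has_vector_derivative_of_real)
    fix j x
    have "((\<lambda>x. step_jet \<delta> j h (x - (p + \<delta>))) has_real_derivative step_jet \<delta> (Suc j) h (x - (p + \<delta>)) * 1) (at x)"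
      by (rule DERIV_chain2[OF step_jet_derivative[OF \<delta> h(1,2)]]) (auto intro!: derivative_eq_intros)
    then show "((\<lambda>x. step_jet \<delta> j h (x - (p + \<delta>))) has_real_derivative step_jet \<delta> (Suc j) h (x - (p + \<delta>))) (at x)"
      by (simp only: mult_1_right)
  qed
  have X0: "X 0 x = 0" if "x < p + \<delta>" for x
    using smooth_step_bounds(3)[OF \<delta> h(1,2), of "x - (p + \<delta>)"] that by (simp add: X_def)
  have X1: "X 0 x = 1" if "x > p' - \<delta>" for x
  proof -
    have "\<delta> + suminf h \<le> x - (p + \<delta>)" using that h(3) by (simp add: \<delta>_def field_simps)
    then show ?thesis using smooth_step_bounds(4)[OF \<delta> h(1,2), of "x - (p + \<delta>)"] by (simp add: X_def)
  qed
  have "X (Suc j) x = 0" if "x \<le> p" for j x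
    by (rule jet_on_locally_const[OF jX, where O' = "{..<p + \<delta>}" and b = 0]) (use X0 that \<delta> in auto)
  then have "X j x = 0" if "x \<le> p" for j x
    using X0[of x] that \<delta> by (cases j) auto
  moreover have "X (Suc j) x = 0" if "x \<ge> p'" for j x
    by (rule jet_on_locally_const[OF jX, where O' = "{p' - \<delta><..}" and b = 1]) (use X1 that \<delta> in auto)
  moreover have "X 0 x = 1" if "x \<ge> p'" for x using X1 that \<delta> by simp
  moreover have "cmod (X j x) \<le> C * M 1 j" for j x
  proof -
    have "cmod (X j x) = \<bar>step_jet \<delta> j h (x - (p + \<delta>))\<bar>" unfolding X_def norm_of_real ..
    also have "\<dots> \<le> (\<Prod>i<j. 2 / h i)" by (rule step_jet_bound[OF \<delta> h(1,2)])
    finally show ?thesis using prod[of j] by linarith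
  qed
  ultimately show thesis using that[of X C] jX by blast
qed

end

section \<open>Paley-Wiener theorem on the real line\<close>

lemma exp_partial_sum_uniform:
  fixes R \<eta> :: real
  assumes "R \<ge> 0" "\<eta> > 0"
  obtains m where "\<And>w. 0 \<le> w \<Longrightarrow> w \<le> R \<Longrightarrow>
    \<bar>(\<Sum>k\<in>{1..m}. (-1) ^ Suc k / fact k * w ^ k) - (1 - exp (- w))\<bar> \<le> \<eta>"
proof -
  define t where "t x k = x ^ k / fact k" for x :: real and k
  have t: "(t x) sums exp x" for x
  proof -
    have "t x = (\<lambda>n. x ^ n /\<^sub>R fact n)" by (simp add: t_def fun_eq_iff divide_inverse mult.commute)
    then show ?thesis using exp_converges[of x] by simp
  qed
  have "(\<lambda>N. \<Sum>k<N. t R k) \<longlonglongrightarrow> exp R" using t[of R] by (simp add: sums_def)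
  then have "\<forall>\<^sub>F N in sequentially. dist (\<Sum>k<N. t R k) (exp R) < \<eta>" using assms(2) by (rule tendstoD)
  then obtain N0 where N0: "\<And>N. N \<ge> N0 \<Longrightarrow> dist (\<Sum>k<N. t R k) (exp R) < \<eta>"
    by (auto simp: eventually_sequentially)
  define m where "m = N0"
  have "\<bar>(\<Sum>k\<in>{1..m}. (-1) ^ Suc k / fact k * w ^ k) - (1 - exp (- w))\<bar> \<le> \<eta>" if w: "0 \<le> w" "w \<le> R" for w
  proof -
    have "(\<Sum>k<Suc m. t (- w) k) = 1 - (\<Sum>k\<in>{1..m}. (-1) ^ Suc k / fact k * w ^ k)"
    proof -
      have "(\<Sum>k<Suc m. t (- w) k) = t (- w) 0 + (\<Sum>k\<in>{1..m}. t (- w) k)"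
        using sum.atMost_shift[of "t (- w)" m]
        by (simp add: lessThan_Suc_atMost sum.atLeast1_atMost_eq)
      also have "(\<Sum>k\<in>{1..m}. t (- w) k) = - (\<Sum>k\<in>{1..m}. (-1) ^ Suc k / fact k * w ^ k)"
        unfolding sum_negf[symmetric] by (intro sum.cong refl) (simp add: t_def power_minus[of w])
      finally show ?thesis by (simp add: t_def)
    qed
    then have "(\<Sum>k\<in>{1..m}. (-1) ^ Suc k / fact k * w ^ k) - (1 - exp (- w))
        = exp (- w) - (\<Sum>k<Suc m. t (- w) k)" by simp
    also have "\<dots> = (\<Sum>k. t (- w) (k + Suc m))"
      using suminf_minus_initial_segment[OF sums_summable[OF t[of "- w"]], of "Suc m"] sums_unique[OF t[of "- w"]] by simp
    also have "\<bar>\<dots>\<bar> \<le> (\<Sum>k. t R (k + Suc m))"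
    proof -
      have le: "norm (t (- w) (k + Suc m)) \<le> t R (k + Suc m)" for k
        using w by (auto simp: t_def power_abs abs_mult intro!: divide_right_mono power_mono mult_mono)
      have s: "summable (\<lambda>k. t R (k + Suc m))" using sums_summable[OF t[of R]] by (subst summable_iff_shift)
      show ?thesis using norm_suminf_le[OF le s] by simp
    qed
    also have "\<dots> = exp R - (\<Sum>k<Suc m. t R k)"
      using suminf_minus_initial_segment[OF sums_summable[OF t[of R]], of "Suc m"] sums_unique[OF t[of R]] by simp
    also have "\<dots> \<le> \<eta>" using N0[of "Suc m"] unfolding m_def dist_real_def by linarith
    finally show ?thesis .
  qed
  then show thesis using that by blast
qed

text \<open>The kernel \<open>v \<mapsto> 1 - exp (- exp (n v))\<close> of Mikusinski approximates the Heaviside step function, and it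
  is a series in the exponentials \<open>exp (k n v)\<close>, \<open>k \<ge> 1\<close>.\<close>

lemma heaviside_kernel:
  fixes n V \<eta> :: real
  assumes "n > 0" "\<eta> > 0"
  obtains m where
    "\<And>v. v \<le> V \<Longrightarrow> v \<ge> 0 \<Longrightarrow> \<bar>(\<Sum>k\<in>{1..m}. (-1) ^ Suc k / fact k * exp (real k * n * v)) - 1\<bar> \<le> exp (- n * v) + \<eta>"
    "\<And>v. v \<le> V \<Longrightarrow> v \<le> 0 \<Longrightarrow> \<bar>\<Sum>k\<in>{1..m}. (-1) ^ Suc k / fact k * exp (real k * n * v)\<bar> \<le> exp (n * v) + \<eta>"
proof -
  \<comment> \<open>The restriction \<open>v \<le> V\<close> confines \<open>exp (n * v)\<close> to
    a compact interval, on which one partial sum suffices. Its length \<open>m\<close> depends on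
    \<open>n\<close>, \<open>V\<close> and \<open>\<eta>\<close>.\<close>
  obtain m where m: "\<And>w. 0 \<le> w \<Longrightarrow> w \<le> exp (n * V) \<Longrightarrow>
    \<bar>(\<Sum>k\<in>{1..m}. (-1) ^ Suc k / fact k * w ^ k) - (1 - exp (- w))\<bar> \<le> \<eta>"
    using exp_partial_sum_uniform[of "exp (n * V)" \<eta>] assms by auto
  define P where "P v = (\<Sum>k\<in>{1..m}. (-1) ^ Suc k / fact k * exp (real k * n * v))" for v
  have P: "\<bar>P v - (1 - exp (- exp (n * v)))\<bar> \<le> \<eta>" if "v \<le> V" for v
    using m[of "exp (n * v)"] that assms by (simp add: P_def exp_of_nat_mult[symmetric] mult.assoc)
  have "\<bar>P v - 1\<bar> \<le> exp (- n * v) + \<eta>" if "v \<le> V" for v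
  proof -
    have "exp (n * v) \<le> exp (exp (n * v))" using exp_ge_add_one_self[of "exp (n * v)"] by linarith
    then have "exp (- exp (n * v)) \<le> exp (- n * v)" by simp
    then show ?thesis using P[OF that] by (smt (verit) exp_gt_zero)
  qed
  moreover have "\<bar>P v\<bar> \<le> exp (n * v) + \<eta>" if "v \<le> V" for v
  proof -
    have "1 - exp (n * v) \<le> exp (- exp (n * v))" using exp_ge_add_one_self[of "- exp (n * v)"] by linarith
    moreover have "exp (- exp (n * v)) \<le> 1" by simp
    ultimately show ?thesis using P[OF that] by linarith
  qed
  ultimately show thesis using that unfolding P_def by blast
qed

lemma exp_integral_le:
  fixes n p q :: real
  assumes "n > 0" "p \<le> q"
  shows "integral {p..q} (\<lambda>s. exp (- n * (q - s))) \<le> 1 / n"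
    and "integral {p..q} (\<lambda>s. exp (- n * (s - p))) \<le> 1 / n"
proof -
  have "((\<lambda>s. exp (- n * (q - s))) has_integral exp (- n * (q - q)) / n - exp (- n * (q - p)) / n) {p..q}"
    using assms by (intro fundamental_theorem_of_calculus)
      (auto intro!: derivative_eq_intros simp: has_real_derivative_iff_has_vector_derivative[symmetric])
  then show "integral {p..q} (\<lambda>s. exp (- n * (q - s))) \<le> 1 / n"
    using assms by (simp add: integral_unique diff_le_eq)
  have "((\<lambda>s. exp (- n * (s - p))) has_integral - exp (- n * (q - p)) / n - (- exp (- n * (p - p)) / n)) {p..q}"
    using assms by (intro fundamental_theorem_of_calculus)
      (auto intro!: derivative_eq_intros simp: has_real_derivative_iff_has_vector_derivative[symmetric])
  then show "integral {p..q} (\<lambda>s. exp (- n * (s - p))) \<le> 1 / n"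
    using assms by (simp add: integral_unique)
qed

lemma jet_on_continuous: "jet_on X F \<Longrightarrow> continuous_on X (F j)"
  unfolding jet_on_def
  by (meson continuous_at_imp_continuous_on has_vector_derivative_continuous)

lemma jet_on_integral:
  assumes "jet_on UNIV F" "p \<le> q"
  shows "(F (Suc j) has_integral F j q - F j p) {p..q}"
  by (rule fundamental_theorem_of_calculus[OF assms(2)])
    (use jet_onD[OF assms(1)] in \<open>auto intro: has_vector_derivative_at_within\<close>)

lemma jet_on_mean_value:
  assumes F: "jet_on UNIV F" and pq: "p \<le> q" and B: "\<And>x. cmod (F (Suc j) x) \<le> B"
  shows "cmod (F j q - F j p) \<le> B * (q - p)"
proof -
  have "F j q - F j p = integral {p..q} (F (Suc j))"
    using integral_unique[OF jet_on_integral[OF assms(1,2)]] by simp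
  also have "norm \<dots> \<le> B * (q - p)"
    using pq B by (intro integral_bound continuous_on_subset[OF jet_on_continuous[OF F]]) auto
  finally show ?thesis .
qed

lemma jet_laplace:
  assumes F: "jet_on UNIV F" and bT: "b \<le> T" and z: "\<And>j. F j b = 0" "\<And>j. F j T = 0"
  shows "integral {b..T} (\<lambda>s. F (Suc j) s * exp (- of_real (l * s)))
    = of_real (l ^ j) * integral {b..T} (\<lambda>s. F 1 s * exp (- of_real (l * s)))"
proof (induction j)
  case (Suc j)
  define e where "e s = exp (- complex_of_real (l * s))" for s
  have ce: "continuous_on A e" for A unfolding e_def by (intro continuous_intros)
  have de: "(e has_vector_derivative - of_real l * e s) (at s)" for s
  proof -
    have "((\<lambda>s. complex_of_real (exp (- (l * s)))) has_vector_derivative of_real (- l * exp (- (l * s)))) (at s)"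
      by (intro has_vector_derivative_of_real) (auto intro!: derivative_eq_intros)
    moreover have "e = (\<lambda>s. complex_of_real (exp (- (l * s))))"
      by (rule ext) (simp only: e_def exp_of_real[symmetric] of_real_minus)
    ultimately show ?thesis by simp
  qed
  have cF: "continuous_on A (F i)" for i A
    by (rule continuous_on_subset[OF jet_on_continuous[OF F]]) simp
  have "((\<lambda>s. F (Suc j) s * (- of_real l * e s) + F (Suc (Suc j)) s * e s) has_integral
      F (Suc j) T * e T - F (Suc j) b * e b) {b..T}"
    by (rule fundamental_theorem_of_calculus[OF bT],
        rule has_vector_derivative_at_within[OF has_vector_derivative_mult])
      (use jet_onD[OF F] de in \<open>blast\<close>)+
  then have "integral {b..T} (\<lambda>s. F (Suc j) s * (- of_real l * e s) + F (Suc (Suc j)) s * e s) = 0"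
    using z by (simp add: integral_unique)
  moreover have "integral {b..T} (\<lambda>s. F (Suc j) s * (- of_real l * e s) + F (Suc (Suc j)) s * e s)
      = integral {b..T} (\<lambda>s. - of_real l * (F (Suc j) s * e s)) + integral {b..T} (\<lambda>s. F (Suc (Suc j)) s * e s)"
    by (subst integral_add[symmetric])
      (auto intro!: integrable_continuous_real continuous_intros cF ce simp: mult_ac)
  moreover have "integral {b..T} (\<lambda>s. - of_real l * (F (Suc j) s * e s)) = - of_real l * integral {b..T} (\<lambda>s. F (Suc j) s * e s)"
    by (rule integral_mult_right)
  ultimately have "integral {b..T} (\<lambda>s. F (Suc (Suc j)) s * e s) = of_real l * integral {b..T} (\<lambda>s. F (Suc j) s * e s)"
    by (simp add: add_eq_0_iff)
  then show ?case using Suc by (simp add: e_def mult.assoc)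
qed simp

text \<open>For the exact step, 1 on positive and 0 on negative \<open>v\<close>, the integral would
  be that of \<open>F (Suc j)\<close> from \<open>b\<close> to \<open>y\<close>, which is
  \<open>F j y\<close>. On either side of \<open>y\<close> the deviation of \<open>K\<close> decays
  exponentially up to \<open>\<eta>\<close>, contributing at most
  \<open>1 / n + \<eta> * (T - b)\<close> times \<open>B\<close>.\<close>

lemma kernel_convolution_close:
  assumes F: "jet_on UNIV F" and bT: "b \<le> T"
    and z: "\<And>x. x \<le> b \<Longrightarrow> F j x = 0" "\<And>x. x \<ge> T \<Longrightarrow> F j x = 0"
    and B: "\<And>x. cmod (F (Suc j) x) \<le> B"
    and K: "continuous_on UNIV K"
      "\<And>v. v \<le> y - b \<Longrightarrow> v \<ge> 0 \<Longrightarrow> \<bar>K v - 1\<bar> \<le> exp (- n * v) + \<eta>"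
      "\<And>v. v \<le> y - b \<Longrightarrow> v \<le> 0 \<Longrightarrow> \<bar>K v\<bar> \<le> exp (n * v) + \<eta>"
    and n: "n > 0" "\<eta> \<ge> 0"
  shows "cmod (integral {b..T} (\<lambda>s. F (Suc j) s * of_real (K (y - s))) - F j y) \<le> B * (2 / n + 2 * \<eta> * (T - b))"
proof -
  \<comment> \<open>\<open>y\<close> is clamped to \<open>[b;T]\<close>. If \<open>y\<close> lies
    outside, one of the two pieces of the integral is empty, and \<open>F j\<close> takes the same
    value at \<open>y\<close> and \<open>y'\<close>.\<close>
  define y' where "y' = max b (min y T)"
  have y': "b \<le> y'" "y' \<le> T" using bT by (auto simp: y'_def)
  have B0: "B \<ge> 0" using B[of 0] norm_ge_zero order_trans by blast
  have cF: "continuous_on A (F i)" for i A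
    by (rule continuous_on_subset[OF jet_on_continuous[OF F]]) simp
  have cK: "continuous_on A (\<lambda>s. complex_of_real (K (y - s)))" for A
    by (intro continuous_intros continuous_on_compose2[OF K(1)]) auto
  have Fy: "F j y = F j y'" using z bT by (auto simp: y'_def max_def min_def)
  have 1: "integral {b..T} (\<lambda>s. F (Suc j) s * of_real (K (y - s)))
    = integral {b..y'} (\<lambda>s. F (Suc j) s * of_real (K (y - s))) + integral {y'..T} (\<lambda>s. F (Suc j) s * of_real (K (y - s)))"
    by (rule Henstock_Kurzweil_Integration.integral_combine[symmetric])
      (use y' in \<open>auto intro!: integrable_continuous_real continuous_intros cF cK\<close>)
  have 2: "integral {b..y'} (F (Suc j)) = F j y"
    using integral_unique[OF jet_on_integral[OF F y'(1), of j]] z Fy by simp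
  have 3: "integral {b..y'} (\<lambda>s. F (Suc j) s * of_real (K (y - s))) - integral {b..y'} (F (Suc j))
      = integral {b..y'} (\<lambda>s. F (Suc j) s * (of_real (K (y - s)) - 1))"
    by (subst integral_diff[symmetric])
      (auto intro!: integrable_continuous_real continuous_intros cF cK simp: algebra_simps)
  have left: "cmod (integral {b..y'} (\<lambda>s. F (Suc j) s * (of_real (K (y - s)) - 1))) \<le> B * (1 / n + \<eta> * (T - b))"
  proof (cases "b < y'")
    case True
    have "norm (integral {b..y'} (\<lambda>s. F (Suc j) s * (of_real (K (y - s)) - 1)))
        \<le> integral {b..y'} (\<lambda>s. B * (exp (- n * (y' - s)) + \<eta>))"
    proof (rule Henstock_Kurzweil_Integration.integral_norm_bound_integral)
      fix s assume s: "s \<in> {b..y'}"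
      have "y' \<le> y" using True by (auto simp: y'_def)
      then have "\<bar>K (y - s) - 1\<bar> \<le> exp (- n * (y - s)) + \<eta>" using s by (intro K(2)) auto
      also have "exp (- n * (y - s)) \<le> exp (- n * (y' - s))" using n \<open>y' \<le> y\<close> by simp
      finally have "\<bar>K (y - s) - 1\<bar> \<le> exp (- n * (y' - s)) + \<eta>" by simp
      moreover have "cmod (of_real (K (y - s)) - 1) = \<bar>K (y - s) - 1\<bar>"
        by (metis norm_of_real of_real_1 of_real_diff)
      ultimately show "norm (F (Suc j) s * (of_real (K (y - s)) - 1)) \<le> B * (exp (- n * (y' - s)) + \<eta>)"
        unfolding norm_mult by (intro mult_mono[OF B _ B0 norm_ge_zero]) simp
    qed (auto intro!: integrable_continuous_real continuous_intros cF cK)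
    also have "\<dots> = B * (integral {b..y'} (\<lambda>s. exp (- n * (y' - s))) + \<eta> * (y' - b))"
      using y' by (simp add: integral_add integrable_continuous_real continuous_intros)
    also have "\<dots> \<le> B * (1 / n + \<eta> * (T - b))"
      using exp_integral_le(1)[OF n(1) y'(1)] n y' B0 by (intro mult_left_mono add_mono) auto
    finally show ?thesis .
  next
    case False
    then have "y' = b" using y' by simp
    then show ?thesis using B0 n bT by simp
  qed
  have right: "cmod (integral {y'..T} (\<lambda>s. F (Suc j) s * of_real (K (y - s)))) \<le> B * (1 / n + \<eta> * (T - b))"
  proof (cases "y' < T")
    case True
    have "norm (integral {y'..T} (\<lambda>s. F (Suc j) s * of_real (K (y - s))))
        \<le> integral {y'..T} (\<lambda>s. B * (exp (- n * (s - y')) + \<eta>))"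
    proof (rule Henstock_Kurzweil_Integration.integral_norm_bound_integral)
      fix s assume s: "s \<in> {y'..T}"
      have "y \<le> y'" using True by (auto simp: y'_def)
      then have "\<bar>K (y - s)\<bar> \<le> exp (n * (y - s)) + \<eta>" using s y' by (intro K(3)) auto
      also have "exp (n * (y - s)) \<le> exp (- n * (s - y'))" using n \<open>y \<le> y'\<close> by (simp add: algebra_simps)
      finally have "\<bar>K (y - s)\<bar> \<le> exp (- n * (s - y')) + \<eta>" by simp
      then show "norm (F (Suc j) s * of_real (K (y - s))) \<le> B * (exp (- n * (s - y')) + \<eta>)"
        unfolding norm_mult norm_of_real by (rule mult_mono[OF B _ B0 abs_ge_zero])
    qed (auto intro!: integrable_continuous_real continuous_intros cF cK)
    also have "\<dots> = B * (integral {y'..T} (\<lambda>s. exp (- n * (s - y'))) + \<eta> * (T - y'))"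
      using y' by (simp add: integral_add integrable_continuous_real continuous_intros)
    also have "\<dots> \<le> B * (1 / n + \<eta> * (T - b))"
      using exp_integral_le(2)[OF n(1) y'(2)] n y' B0 by (intro mult_left_mono add_mono) auto
    finally show ?thesis .
  next
    case False
    then have "y' = T" using y' by simp
    then show ?thesis using B0 n bT by simp
  qed
  have "integral {b..T} (\<lambda>s. F (Suc j) s * of_real (K (y - s))) - F j y
    = integral {b..y'} (\<lambda>s. F (Suc j) s * (of_real (K (y - s)) - 1)) + integral {y'..T} (\<lambda>s. F (Suc j) s * of_real (K (y - s)))"
    using 1 2 3 by simp
  then have "cmod (integral {b..T} (\<lambda>s. F (Suc j) s * of_real (K (y - s))) - F j y)
      \<le> B * (1 / n + \<eta> * (T - b)) + B * (1 / n + \<eta> * (T - b))"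
    using norm_triangle_mono[OF left right] by simp
  then show ?thesis by (simp add: algebra_simps)
qed

section \<open>Growth on the imaginary axis against the support of a functional\<close>

context udiff_setting
begin

abbreviation "FL S \<equiv> fourier_laplace a S"
abbreviation "vanish A \<equiv> vanishing_space a \<omega> c A"

lemma FL_imaginary: "FL S (complex_of_real r * cis (pi / 2)) = S (exp_fun r)"
proof -
  have "(\<lambda>t. if t \<in> \<Omega> then exp (- \<i> * complex_of_real t * (complex_of_real r * cis (pi / 2))) else 0) = exp_fun r"
    by (simp add: fun_eq_iff exp_fun_def restr_def exp_jet_def exp_of_real[symmetric] mult_ac)
  then show ?thesis by (simp only: fourier_laplace_def)
qed

lemma indicator_bound:
  assumes "indicator_fn (FL S) (pi / 2) \<le> ereal b" "b < d"
  shows "\<forall>\<^sub>F r in at_top. cmod (S (exp_fun r)) \<le> exp (r * d)"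
proof -
  have "indicator_fn (FL S) (pi / 2) < ereal d" using assms by (meson ereal_less(2) less_ereal.simps(1) order_le_less_trans)
  then have "\<forall>\<^sub>F r in at_top. ereal (1 / r) * ln_ext (cmod (S (exp_fun r))) < ereal d"
    unfolding indicator_fn_def FL_imaginary by (rule Limsup_lessD)
  then show ?thesis using eventually_gt_at_top[of 0]
  proof eventually_elim
    case (elim r)
    show ?case
    proof (cases "S (exp_fun r) = 0")
      case False
      then have "1 / r * ln (cmod (S (exp_fun r))) < d" using elim by (simp add: ln_ext_def)
      then have "ln (cmod (S (exp_fun r))) < r * d" using elim by (simp add: field_simps)
      then have "exp (ln (cmod (S (exp_fun r)))) \<le> exp (r * d)" by simp
      then show ?thesis using False by simp
    qed simp
  qed
qed

text \<open>\<open>ln C\<close> and, by sublinearity, \<open>\<omega> r\<close> are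
  \<open>o(r)\<close>, so neither the constant nor the weight factor survives division by
  \<open>r\<close>.\<close>

lemma indicator_leI:
  assumes C: "C > 0" and le: "\<And>r. r \<ge> 1 \<Longrightarrow> cmod (S (exp_fun r)) \<le> C * exp (q * \<omega> r + r * d)"
  shows "indicator_fn (FL S) (pi / 2) \<le> ereal d"
proof -
  let ?g = "\<lambda>r. ereal (ln C / r + q * (\<omega> r / r) + d)"
  have "\<forall>\<^sub>F r in at_top. ereal (1 / r) * ln_ext (cmod (S (exp_fun r))) \<le> ?g r"
    using eventually_ge_at_top[of 1]
  proof eventually_elim
    case (elim r)
    show ?case
    proof (cases "S (exp_fun r) = 0")
      case True
      then show ?thesis using elim by (simp add: ln_ext_def)
    next
      case False
      have "ln (cmod (S (exp_fun r))) \<le> ln (C * exp (q * \<omega> r + r * d))"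
        using le[OF elim] False C by (subst ln_le_cancel_iff) auto
      also have "\<dots> = ln C + (q * \<omega> r + r * d)" using C by (simp add: ln_mult)
      finally have "1 / r * ln (cmod (S (exp_fun r))) \<le> 1 / r * (ln C + (q * \<omega> r + r * d))"
        using elim by (intro mult_left_mono) auto
      also have "\<dots> = ln C / r + q * (\<omega> r / r) + d" using elim by (simp add: field_simps)
      finally show ?thesis using False by (simp add: ln_ext_def)
    qed
  qed
  then have "indicator_fn (FL S) (pi / 2) \<le> Limsup at_top ?g"
    unfolding indicator_fn_def FL_imaginary by (rule Limsup_mono)
  also have "Limsup at_top ?g = ereal d"
  proof (rule lim_imp_Limsup)
    have "((\<lambda>r::real. ln C / r) \<longlongrightarrow> 0) at_top"
      by (intro tendsto_divide_0[OF tendsto_const] filterlim_at_top_imp_at_infinity filterlim_ident)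
    then have "((\<lambda>r. ln C / r + q * (\<omega> r / r) + d) \<longlongrightarrow> 0 + q * 0 + d) at_top"
      by (intro tendsto_intros omega_sublinear)
    then show "(?g \<longlongrightarrow> ereal d) at_top" by simp
  qed simp
  finally show ?thesis .
qed

lemma tame_M_one:
  assumes "\<And>j x. cmod (X j x) \<le> C * M 1 j"
  shows "tame A X"
proof (rule tameI)
  fix q :: real assume q: "0 < q" "q < 1"
  have C: "C \<ge> 0" using assms[of 0 0] M_pos[of 1 0]
    by (metis norm_ge_zero order_trans zero_le_mult_iff not_le)
  have "cmod (X j x) \<le> C * M q j" for j x
    using assms[of j x] mult_left_mono[OF M_antimono[of q 1 j] C] q by simp
  then show "\<exists>B. \<forall>j. \<forall>x\<in>A. cmod (X j x) \<le> B * M q j" by blast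
qed

definition one_jet :: "nat \<Rightarrow> real \<Rightarrow> complex" where
  "one_jet j x = (if j = 0 then 1 else 0)"

lemma jet_on_one: "jet_on A one_jet"
  unfolding jet_on_def one_jet_def by (auto intro!: derivative_eq_intros)

lemma tame_one: "tame A one_jet"
proof (rule tameI)
  fix q :: real
  have "cmod (one_jet j x) \<le> (1 / M q 0) * M q j" for j x
    using M_pos[of q 0] by (cases "j = 0") (simp_all add: one_jet_def less_imp_neq[symmetric])
  then show "\<exists>B. \<forall>j. \<forall>x\<in>A. cmod (one_jet j x) \<le> B * M q j" by blast
qed

lemma partition_exists:
  assumes "p < p'"
  obtains X Y where "jet_on UNIV X" "jet_on UNIV Y" "tame UNIV X" "tame UNIV Y"
    "\<And>j x. x \<le> p \<Longrightarrow> X j x = 0" "\<And>j x. x \<ge> p' \<Longrightarrow> Y j x = 0" "\<And>j x. X j x + Y j x = one_jet j x"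
proof -
  obtain X C where X: "jet_on UNIV X" "\<And>j x. cmod (X j x) \<le> C * M 1 j"
    "\<And>j x. x \<le> p \<Longrightarrow> X j x = 0" "\<And>x. x \<ge> p' \<Longrightarrow> X 0 x = 1" "\<And>j x. x \<ge> p' \<Longrightarrow> X (Suc j) x = 0"
    using cutoff_exists[OF assms] by blast
  have tX: "tame UNIV X" by (rule tame_M_one) (rule X(2))
  define Y where "Y j x = one_jet j x + (- 1) * X j x" for j x
  have "jet_on UNIV Y" unfolding Y_def[abs_def]
    by (intro jet_on_add jet_on_one jet_on_scale X(1))
  moreover have "tame UNIV Y" unfolding Y_def[abs_def]
    by (intro tame_add tame_one tame_scale tX)
  moreover have "Y j x = 0" if "x \<ge> p'" for j x
    using X(4,5)[OF that] by (cases j) (auto simp: Y_def one_jet_def)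
  moreover have "X j x + Y j x = one_jet j x" for j x by (simp add: Y_def)
  ultimately show thesis using that[of X Y] X(1,3) tX by blast
qed

lemma leibniz_zero_right: "(\<And>j. X j x = 0) \<Longrightarrow> leibniz F X j x = 0"
  and leibniz_zero_left: "(\<And>j. F j x = 0) \<Longrightarrow> leibniz F X j x = 0"
  by (simp_all add: leibniz_def)

lemma restr_leibniz_U:
  assumes "f \<in> U" "jet_on UNIV X" "tame UNIV X"
  shows "restr (leibniz (\<lambda>j. Dn j f) X 0) \<in> U"
    and "Dn j (restr (leibniz (\<lambda>j. Dn j f) X 0)) = restr (leibniz (\<lambda>j. Dn j f) X j)"
proof -
  have J: "jet_on \<Omega> (leibniz (\<lambda>j. Dn j f) X)"
    by (intro jet_on_leibniz U_jet assms jet_on_subset[OF assms(2)]) auto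
  show "restr (leibniz (\<lambda>j. Dn j f) X 0) \<in> U"
    by (intro restr_in_U J tame_leibniz U_tame assms tame_subset[OF assms(3)]) auto
  show "Dn j (restr (leibniz (\<lambda>j. Dn j f) X 0)) = restr (leibniz (\<lambda>j. Dn j f) X j)"
    by (rule D_iter[OF J])
qed

lemma restr_leibniz_split:
  assumes "f \<in> U" "\<And>x. X 0 x + Y 0 x = one_jet 0 x"
  shows "(\<lambda>x. restr (leibniz (\<lambda>j. Dn j f) X 0) x + restr (leibniz (\<lambda>j. Dn j f) Y 0) x) = f"
  using assms by (auto simp: fun_eq_iff restr_def leibniz_0 distrib_left[symmetric] U_zero one_jet_def)

text \<open>The part of the exponential cut off to the right of \<open>b\<close> is killed. The rest
  lives to the left of \<open>b + e\<close>, where the \<open>i\<close>-th derivative of the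
  exponential is at most \<open>exp (q' * \<omega> r + r * (b + e)) * M q' i\<close>; the constant
  for multiplication by the cutoff is independent of \<open>r\<close>, and \<open>e\<close> is
  arbitrary.\<close>

lemma indicator_le_of_support:
  assumes S: "S \<in> dual" and kills: "\<And>f. f \<in> vanish {x \<in> \<Omega>. x \<le> b} \<Longrightarrow> S f = 0"
  shows "indicator_fn (FL S) (pi / 2) \<le> ereal b"
proof (rule ereal_le_epsilon2)
  fix e :: real assume e: "e > 0"
  obtain X Y where XY: "jet_on UNIV X" "jet_on UNIV Y" "tame UNIV X" "tame UNIV Y"
    "\<And>j x. x \<le> b \<Longrightarrow> X j x = 0" "\<And>j x. x \<ge> b + e \<Longrightarrow> Y j x = 0" "\<And>j x. X j x + Y j x = one_jet j x"
    using partition_exists[of b "b + e"] e by auto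
  obtain q k C where q: "0 < q" "q < 1" "C > 0" and Sbd: "\<forall>f\<in>U. \<forall>B. bd q k f B \<longrightarrow> cmod (S f) \<le> C * B"
    using dual_bound[OF S] by blast
  define q' where "q' = (q + 1) / 2"
  have q': "0 < q'" "q < q'" "q' < 1" using q by (auto simp: q'_def)
  obtain K where K: "K > 0" "\<forall>F G A B x. (\<forall>i. cmod (F i x) \<le> A * M q' i) \<longrightarrow> (\<forall>i. cmod (G i x) \<le> B * M q' i) \<longrightarrow>
      (\<forall>j. cmod (leibniz F G j x) \<le> K * A * B * M q j)"
    using leibniz_bound[OF q(1) q'(2)] by blast
  obtain B where B: "B \<ge> 0" "\<forall>j. \<forall>x\<in>UNIV. cmod (Y j x) \<le> B * M q' j"
    using XY(4) q'(1,3) unfolding tame_def by blast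
  have est: "cmod (S (exp_fun r)) \<le> (C * K * B + 1) * exp (q' * \<omega> r + r * (b + e))" if r: "r \<ge> 1" for r
  proof -
    define A where "A = exp (q' * \<omega> r) * exp (r * (b + e))"
    let ?f = "exp_fun r"
    note eU = exp_fun_U[OF r]
    define g1 g2 where "g1 = restr (leibniz (\<lambda>j. Dn j ?f) X 0)" and "g2 = restr (leibniz (\<lambda>j. Dn j ?f) Y 0)"
    have g: "g1 \<in> U" "g2 \<in> U" unfolding g1_def g2_def by (intro restr_leibniz_U eU XY)+
    have "g1 \<in> vanish {x \<in> \<Omega>. x \<le> b}"
    proof -
      have "Dn j g1 x = 0" if "x \<le> b" for j x
        unfolding g1_def restr_leibniz_U(2)[OF eU XY(1,3)]
        using that by (simp add: restr_def leibniz_zero_right XY(5))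
      then show ?thesis using g by (simp add: vanishing_space_def)
    qed
    then have "S g1 = 0" by (rule kills)
    moreover have "S ?f = S g1 + S g2"
    proof -
      have "?f = (\<lambda>x. g1 x + g2 x)"
        unfolding g1_def g2_def by (rule restr_leibniz_split[symmetric]) (auto simp: eU XY(7))
      then show ?thesis using dual_add[OF S g] by simp
    qed
    ultimately have Sf: "S ?f = S g2" by simp
    have De: "Dn j ?f x = exp_jet r j x" if "x \<in> \<Omega>" for j x
      using D_iter[OF jet_on_exp, of j r] that by (simp add: exp_fun_def restr_def)
    have "bd q k g2 (K * A * B)"
      unfolding bd_def g2_def restr_leibniz_U(2)[OF eU XY(2,4)]
    proof (intro allI ballI)
      fix j x assume x: "x \<in> {- c k..c k}"
      have pos: "0 \<le> K * A * B * M q j" using K B by (auto simp: A_def)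
      show "cmod (restr (leibniz (\<lambda>j. Dn j ?f) Y j) x) \<le> K * A * B * M q j"
      proof (cases "x \<ge> b + e")
        case True
        then show ?thesis using pos by (simp add: restr_def leibniz_zero_right XY(6))
      next
        case False
        have "cmod (Dn i ?f x) \<le> A * M q' i" for i
          unfolding De[OF c_dom[OF x]] A_def using False by (intro exp_jet_bound q' r) auto
        then have "cmod (leibniz (\<lambda>j. Dn j ?f) Y j x) \<le> K * A * B * M q j"
          by (intro K(2)[rule_format]) (use B(2) in auto)
        then show ?thesis using pos by (simp add: restr_def)
      qed
    qed
    then have "cmod (S ?f) \<le> C * (K * A * B)" unfolding Sf using Sbd g(2) by blast
    also have "\<dots> \<le> (C * K * B + 1) * A" by (simp add: algebra_simps A_def)
    finally show ?thesis by (simp add: A_def exp_add)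
  qed
  have "0 < C * K * B + 1" using q K B by (simp add: add_nonneg_pos)
  from indicator_leI[OF this est] show "indicator_fn (FL S) (pi / 2) \<le> ereal b + ereal e" by simp
qed

lemma dual_sum:
  assumes S: "S \<in> dual" and f: "\<And>i. i \<in> A \<Longrightarrow> f i \<in> U" and A: "finite A"
  shows "(\<lambda>x. \<Sum>i\<in>A. \<alpha> i * f i x) \<in> U \<and> S (\<lambda>x. \<Sum>i\<in>A. \<alpha> i * f i x) = (\<Sum>i\<in>A. \<alpha> i * S (f i))"
  using A f
proof (induction A)
  case empty
  then show ?case using zero_U dual_zero[OF S] by simp
next
  case (insert i A)
  have "(\<lambda>x. \<alpha> i * f i x) \<in> U" using insert by (intro U_scale) auto
  then show ?case using insert U_add dual_add[OF S] dual_scale[OF S] by simp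
qed

lemma jet_on_sum:
  assumes "finite A" "\<And>i. i \<in> A \<Longrightarrow> jet_on Z (F i)"
  shows "jet_on Z (\<lambda>j x. \<Sum>i\<in>A. \<alpha> i * F i j x)"
  using assms unfolding jet_on_def
  by (auto intro!: has_vector_derivative_sum has_vector_derivative_mult_right)

text \<open>The convolution \<open>G\<close> of \<open>F 1\<close> with the kernel, evaluated at
  \<open>x - \<delta>\<close>, is a finite combination of exponentials of frequencies
  \<open>l i \<ge> n\<close>. Its coefficients contain \<open>exp (- l i * \<delta>)\<close> from
  the shift and the Laplace integral \<open>L\<close>, of size \<open>exp (- l i * b)\<close>;
  against \<open>exp (l i * (b + \<delta> / 2))\<close> for \<open>S\<close> this leaves
  \<open>exp (- l i * \<delta> / 2)\<close>. So \<open>S\<close> is small on \<open>G\<close>, while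
  \<open>G\<close> is near \<open>F\<close> in the semi-norm bounding \<open>S\<close>. First
  \<open>n\<close> tends to infinity, then \<open>\<delta>\<close> to 0.\<close>

lemma kills_compact_of_indicator:
  assumes S: "S \<in> dual" and ind: "indicator_fn (FL S) (pi / 2) \<le> ereal b"
    and F: "jet_on UNIV F" "tame UNIV F" and bT: "b < T"
    and z: "\<And>j x. x \<le> b \<Longrightarrow> F j x = 0" "\<And>j x. x \<ge> T \<Longrightarrow> F j x = 0"
  shows "S (restr (F 0)) = 0"
proof -
  obtain q k C where q: "0 < q" "q < 1" "C > 0" and Sbd: "\<forall>f\<in>U. \<forall>B. bd q k f B \<longrightarrow> cmod (S f) \<le> C * B"
    using dual_bound[OF S] by blast
  obtain A where A0: "A \<ge> 0" "\<forall>j. \<forall>x\<in>UNIV. cmod (F (Suc j) x) \<le> A * M q j"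
    using tame_derivative[OF F(2)] q(1,2) unfolding tame_def by blast
  have A: "A \<ge> 0" "cmod (F (Suc j) x) \<le> A * M q j" for j x using A0 by auto
  define B where "B = A * M q 0"
  have B: "cmod (F 1 x) \<le> B" "B \<ge> 0" for x using A(2)[of 0 x] A(1) by (auto simp: B_def)
  have FU: "restr (F 0) \<in> U"
    by (intro restr_in_U jet_on_subset[OF F(1)] tame_subset[OF F(2)]) auto
  have jF: "jet_on \<Omega> F" using F(1) by (rule jet_on_subset) simp
  have cF: "continuous_on Z (F i)" for i Z
    by (rule continuous_on_subset[OF jet_on_continuous[OF F(1)]]) simp
  define L where "L l = integral {b..T} (\<lambda>s. F 1 s * exp (- of_real (l * s)))" for l
  have L: "cmod (L l) \<le> B * (T - b) * exp (- l * b)" if "l \<ge> 0" for l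
  proof -
    have "norm (L l) \<le> (B * exp (- l * b)) * (T - b)"
      unfolding L_def
    proof (rule integral_bound)
      fix s assume s: "s \<in> {b..T}"
      have "l * b \<le> l * s" using that s by (intro mult_left_mono) auto
      then show "norm (F 1 s * exp (- complex_of_real (l * s))) \<le> B * exp (- l * b)"
        unfolding norm_mult using B by (intro mult_mono) auto
    qed (use bT in \<open>auto intro!: continuous_intros cF\<close>)
    then show ?thesis by (simp add: mult_ac)
  qed
  have main: "cmod (S (restr (F 0))) \<le> B * (T - b) * exp 1 * exp (- (real n * \<delta> / 2))
      + C * A * (2 + 2 * (T - b)) / real n + C * A * \<delta>"
    if \<delta>: "\<delta> > 0" and n: "real n \<ge> 1"
      and large: "\<And>r. r \<ge> real n \<Longrightarrow> cmod (S (exp_fun r)) \<le> exp (r * (b + \<delta> / 2))" for \<delta> n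
  proof -
    have n0: "real n > 0" using n by linarith
    \<comment> \<open>For \<open>x \<le> c k\<close> and \<open>s \<ge> b\<close> the kernel is
      evaluated at \<open>x - \<delta> - s\<close>, which is at most
      \<open>c k - \<delta> - b\<close>.\<close>
    obtain m where m:
      "\<And>v. v \<le> c k - \<delta> - b \<Longrightarrow> v \<ge> 0 \<Longrightarrow> \<bar>(\<Sum>k\<in>{1..m}. (-1) ^ Suc k / fact k * exp (real k * real n * v)) - 1\<bar> \<le> exp (- real n * v) + 1 / real n"
      "\<And>v. v \<le> c k - \<delta> - b \<Longrightarrow> v \<le> 0 \<Longrightarrow> \<bar>\<Sum>k\<in>{1..m}. (-1) ^ Suc k / fact k * exp (real k * real n * v)\<bar> \<le> exp (real n * v) + 1 / real n"
      using heaviside_kernel[of "real n" "1 / real n" "c k - \<delta> - b"] n0 by auto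
    define K where "K v = (\<Sum>k\<in>{1..m}. (-1) ^ Suc k / fact k * exp (real k * real n * v))" for v
    define l where "l i = real i * real n" for i :: nat
    define \<beta> where "\<beta> i = complex_of_real ((-1) ^ Suc i / fact i * exp (- l i * \<delta>))" for i
    define G where "G j x = (\<Sum>i\<in>{1..m}. (\<beta> i * L (l i)) * exp_jet (l i) j x)" for j x
    have l1: "l i \<ge> real n" if "i \<in> {1..m}" for i using that n0 by (simp add: l_def)
    have jG: "jet_on Z G" for Z unfolding G_def[abs_def] by (intro jet_on_sum jet_on_exp) auto
    have G: "G j x = integral {b..T} (\<lambda>s. F (Suc j) s * of_real (K (x - \<delta> - s)))" for j x
    proof -
      have "F (Suc j) s * of_real (K (x - \<delta> - s))
          = (\<Sum>i\<in>{1..m}. (\<beta> i * exp (of_real (l i * x))) * (F (Suc j) s * exp (- of_real (l i * s))))" for s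
      proof -
        have "complex_of_real (exp (real i * real n * (x - \<delta> - s)))
            = of_real (exp (- l i * \<delta>)) * exp (of_real (l i * x)) * exp (- of_real (l i * s))" for i
        proof -
          have "real i * real n * (x - \<delta> - s) = - l i * \<delta> + l i * x + - (l i * s)"
            by (simp add: l_def algebra_simps)
          moreover have "complex_of_real (exp (A + B + - C)) = of_real (exp A) * exp (of_real B) * exp (- of_real C)"
            for A B C :: real
            by (simp only: exp_add of_real_mult exp_of_real of_real_minus[symmetric])
          ultimately show ?thesis by (simp only:)
        qed
        then have "complex_of_real ((-1) ^ Suc i / fact i * exp (real i * real n * (x - \<delta> - s)))
            = \<beta> i * exp (of_real (l i * x)) * exp (- of_real (l i * s))" for i
          unfolding \<beta>_def of_real_mult by (simp only: mult.assoc)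
        then have "of_real (K (x - \<delta> - s)) = (\<Sum>i\<in>{1..m}. \<beta> i * exp (of_real (l i * x)) * exp (- of_real (l i * s)))"
          unfolding K_def of_real_sum by simp
        then show ?thesis by (simp only: sum_distrib_left) (simp only: mult_ac)
      qed
      then have "integral {b..T} (\<lambda>s. F (Suc j) s * of_real (K (x - \<delta> - s)))
          = integral {b..T} (\<lambda>s. \<Sum>i\<in>{1..m}. (\<beta> i * exp (of_real (l i * x))) * (F (Suc j) s * exp (- of_real (l i * s))))"
        by simp
      also have "\<dots> = (\<Sum>i\<in>{1..m}. integral {b..T} (\<lambda>s. (\<beta> i * exp (of_real (l i * x))) * (F (Suc j) s * exp (- of_real (l i * s)))))"
        by (intro integral_sum) (auto intro!: integrable_continuous_real continuous_intros cF)
      also have "\<dots> = (\<Sum>i\<in>{1..m}. (\<beta> i * exp (of_real (l i * x))) * (of_real (l i ^ j) * L (l i)))"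
        unfolding integral_mult_right
        using jet_laplace[OF F(1) less_imp_le[OF bT] z(1)[OF order_refl] z(2)[OF order_refl]] by (simp only: L_def)
      also have "\<dots> = G j x"
        unfolding G_def exp_jet_def of_real_mult exp_of_real[symmetric] by (intro sum.cong refl) (simp only: mult_ac)
      finally show ?thesis ..
    qed
    have rG: "restr (G 0) = (\<lambda>x. \<Sum>i\<in>{1..m}. (\<beta> i * L (l i)) * exp_fun (l i) x)"
      by (auto simp: fun_eq_iff restr_def G_def exp_fun_def)
    have GS: "restr (G 0) \<in> U \<and> S (restr (G 0)) = (\<Sum>i\<in>{1..m}. (\<beta> i * L (l i)) * S (exp_fun (l i)))"
      unfolding rG by (rule dual_sum[OF S]) (use l1 n in \<open>force intro: exp_fun_U\<close>)+
    \<comment> \<open>The bound must not depend on \<open>m\<close>, which is uncontrolled in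
      \<open>n\<close>: the \<open>1 / fact i\<close> of the exponential series sum to at most
      \<open>exp 1\<close>.\<close>
    have SG: "cmod (S (restr (G 0))) \<le> B * (T - b) * exp 1 * exp (- (real n * \<delta> / 2))"
    proof -
      have "cmod (\<beta> i * L (l i) * S (exp_fun (l i))) \<le> B * (T - b) * exp (- (real n * \<delta> / 2)) * (1 / fact i)"
        if i: "i \<in> {1..m}" for i
      proof -
        have l0: "l i \<ge> 0" "l i \<ge> real n" using l1[OF i] n0 by linarith+
        have "cmod (\<beta> i) = 1 / fact i * exp (- l i * \<delta>)"
          unfolding \<beta>_def norm_of_real by (simp add: abs_mult power_abs)
        then have "cmod (\<beta> i * L (l i) * S (exp_fun (l i)))
            \<le> (1 / fact i * exp (- l i * \<delta>)) * (B * (T - b) * exp (- l i * b)) * exp (l i * (b + \<delta> / 2))"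
          unfolding norm_mult using L[OF l0(1)] large[OF l0(2)] B bT
          by (intro mult_mono) auto
        also have "\<dots> = B * (T - b) * (1 / fact i) * (exp (- l i * \<delta>) * exp (- l i * b) * exp (l i * (b + \<delta> / 2)))"
          by (simp only: mult_ac)
        also have "exp (- l i * \<delta>) * exp (- l i * b) * exp (l i * (b + \<delta> / 2)) = exp (- (l i * \<delta> / 2))"
          unfolding mult_exp_exp by (simp add: algebra_simps)
        also have "B * (T - b) * (1 / fact i) * exp (- (l i * \<delta> / 2)) \<le> B * (T - b) * (1 / fact i) * exp (- (real n * \<delta> / 2))"
          using l0 \<delta> B bT by (intro mult_left_mono) auto
        finally show ?thesis by (simp only: mult_ac)
      qed
      then have "cmod (S (restr (G 0))) \<le> (\<Sum>i\<in>{1..m}. B * (T - b) * exp (- (real n * \<delta> / 2)) * (1 / fact i))"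
        using GS by (auto intro!: sum_norm_le)
      also have "\<dots> = B * (T - b) * exp (- (real n * \<delta> / 2)) * (\<Sum>i\<in>{1..m}. 1 / fact i)"
        by (rule sum_distrib_left[symmetric])
      also have "\<dots> \<le> B * (T - b) * exp (- (real n * \<delta> / 2)) * exp (1::real)"
      proof -
        have eq: "(\<lambda>i. 1 / fact i) sums exp (1::real)"
          using exp_converges[of "1::real"] by (simp add: divide_inverse)
        have "(\<Sum>i\<in>{1..m}. 1 / fact i) \<le> exp (1::real)"
          unfolding sums_unique[OF eq] by (rule sum_le_suminf[OF sums_summable[OF eq]]) auto
        then show ?thesis using B bT by (intro mult_left_mono) auto
      qed
      finally show ?thesis by (simp add: mult_ac)
    qed
    have cK: "continuous_on UNIV K" unfolding K_def[abs_def] by (intro continuous_intros)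
    \<comment> \<open>The kernel error at \<open>x - \<delta>\<close> and the mean-value error of
      the translation both carry the factor \<open>M q j\<close>, so they are small in the semi-norm
      and not only pointwise.\<close>
    have close: "bd q k (\<lambda>x. restr (F 0) x - restr (G 0) x) (A * ((2 + 2 * (T - b)) / real n) + A * \<delta>)"
    proof -
      have eq: "(\<lambda>x. restr (F 0) x - restr (G 0) x) = restr (\<lambda>x. F 0 x + (- 1) * G 0 x)"
        by (auto simp: restr_def fun_eq_iff)
      have j: "jet_on \<Omega> (\<lambda>j x. F j x + (- 1) * G j x)" by (intro jet_on_add jF jet_on_scale jG)
      show ?thesis unfolding eq bd_restr[OF j]
      proof (intro allI ballI)
        fix j x assume x: "x \<in> {- c k..c k}"
        have "cmod (G j x - F j (x - \<delta>)) \<le> A * M q j * (2 / real n + 2 * (1 / real n) * (T - b))"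
          unfolding G
          by (rule kernel_convolution_close[OF F(1) less_imp_le[OF bT] z A(2) cK])
            (use m x n0 in \<open>auto simp: K_def\<close>)
        moreover have "cmod (F j x - F j (x - \<delta>)) \<le> A * M q j * (x - (x - \<delta>))"
          by (rule jet_on_mean_value[OF F(1) _ A(2)]) (use \<delta> in simp)
        moreover have "F j x + (- 1) * G j x = (F j x - F j (x - \<delta>)) - (G j x - F j (x - \<delta>))" by simp
        ultimately have "cmod (F j x + (- 1) * G j x)
            \<le> A * M q j * (x - (x - \<delta>)) + A * M q j * (2 / real n + 2 * (1 / real n) * (T - b))"
          using norm_triangle_ineq4[of "F j x - F j (x - \<delta>)" "G j x - F j (x - \<delta>)"] by simp
        also have "\<dots> = (A * ((2 + 2 * (T - b)) / real n) + A * \<delta>) * M q j"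
          using n0 by (simp add: field_simps)
        finally show "cmod (F j x + (- 1) * G j x) \<le> (A * ((2 + 2 * (T - b)) / real n) + A * \<delta>) * M q j" .
      qed
    qed
    have "cmod (S (\<lambda>x. restr (F 0) x - restr (G 0) x)) \<le> C * (A * ((2 + 2 * (T - b)) / real n) + A * \<delta>)"
      using Sbd close U_diff[OF FU] GS by blast
    then have "cmod (S (restr (F 0)) - S (restr (G 0))) \<le> C * (A * ((2 + 2 * (T - b)) / real n) + A * \<delta>)"
      using dual_diff[OF S FU, of "restr (G 0)"] GS by simp
    moreover have "C * (A * ((2 + 2 * (T - b)) / real n) + A * \<delta>) = C * A * (2 + 2 * (T - b)) / real n + C * A * \<delta>"
      by (simp add: algebra_simps)
    ultimately show ?thesis
      using SG norm_triangle_sub[of "S (restr (F 0))" "S (restr (G 0))"] by linarith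
  qed
  have le\<delta>: "cmod (S (restr (F 0))) \<le> C * A * \<delta>" if \<delta>: "\<delta> > 0" for \<delta>
  proof -
    have "\<forall>\<^sub>F r in at_top. cmod (S (exp_fun r)) \<le> exp (r * (b + \<delta> / 2))"
      using indicator_bound[OF ind, of "b + \<delta> / 2"] \<delta> by simp
    then obtain R where R: "\<And>r. r \<ge> R \<Longrightarrow> cmod (S (exp_fun r)) \<le> exp (r * (b + \<delta> / 2))"
      by (auto simp: eventually_at_top_linorder)
    obtain N where N: "real N \<ge> max R 1" using real_arch_simple by blast
    let ?g = "\<lambda>n. B * (T - b) * exp 1 * exp (- (real n * \<delta> / 2)) + C * A * (2 + 2 * (T - b)) / real n + C * A * \<delta>"
    have "\<exists>N. \<forall>n\<ge>N. cmod (S (restr (F 0))) \<le> ?g n"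
    proof (intro exI allI impI)
      fix n assume "n \<ge> N"
      then have "real n \<ge> R" "real n \<ge> 1" using N by auto
      then show "cmod (S (restr (F 0))) \<le> ?g n" by (intro main \<delta> R) auto
    qed
    moreover have "?g \<longlonglongrightarrow> C * A * \<delta>" using \<delta> by real_asymp
    ultimately show ?thesis by (meson LIMSEQ_le_const)
  qed
  have "cmod (S (restr (F 0))) \<le> 0"
  proof (rule ccontr)
    assume n: "\<not> cmod (S (restr (F 0))) \<le> 0"
    \<comment> \<open>The denominator exceeds \<open>C * A\<close> and stays positive when
      \<open>C * A = 0\<close>, so \<open>C * A * \<delta>\<close> falls strictly below the supposed
      positive value.\<close>
    define \<delta> where "\<delta> = cmod (S (restr (F 0))) / (2 * (C * A) + 2)"
    have CA: "C * A \<ge> 0" using q A by simp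
    then have \<delta>: "\<delta> > 0" using n by (simp add: \<delta>_def)
    have "C * A < 2 * (C * A) + 2" using CA by linarith
    then have "C * A * \<delta> < (2 * (C * A) + 2) * \<delta>" using \<delta> by (rule mult_strict_right_mono)
    also have "\<dots> = cmod (S (restr (F 0)))" using CA by (simp add: \<delta>_def)
    finally show False using le\<delta>[OF \<delta>] by simp
  qed
  then show ?thesis by simp
qed

end

section \<open>From compactly supported test functions to all functions of the space\<close>

context udiff_setting
begin

lemma leibniz_one_right:
  assumes "\<And>j. X j x = one_jet j x" shows "leibniz F X j x = F j x"
proof -
  have "leibniz F X j x = (\<Sum>i\<le>j. if i = j then F i x else 0)"
    unfolding leibniz_def assms by (intro sum.cong) (auto simp: one_jet_def)
  then show ?thesis by simp
qed

lemma vanishD: "f \<in> vanish A \<Longrightarrow> x \<in> A \<Longrightarrow> Dn j f x = 0"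
  and vanish_U: "f \<in> vanish A \<Longrightarrow> f \<in> U"
  by (auto simp: vanishing_space_def)

lemma vanishI: "f \<in> U \<Longrightarrow> (\<And>j x. x \<in> A \<Longrightarrow> Dn j f x = 0) \<Longrightarrow> f \<in> vanish A"
  by (auto simp: vanishing_space_def)

lemma vanish_mono: "A \<subseteq> B \<Longrightarrow> vanish B \<subseteq> vanish A"
  by (auto simp: vanishing_space_def)

text \<open>\<open>S\<close> sees \<open>f\<close> only through its jet on
  \<open>{- c k..c k}\<close>. Cutoffs placed between this interval and the two ends of
  \<open>\<Omega>\<close> replace \<open>f\<close> by a compactly supported \<open>F\<close> with
  the same jet there, to which \<open>kills_compact_of_indicator\<close> applies.\<close>

lemma kills_of_indicator:
  assumes S: "S \<in> dual" and ind: "indicator_fn (FL S) (pi / 2) \<le> b"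
    and f: "f \<in> vanish {x \<in> \<Omega>. ereal x \<le> b}"
  shows "S f = 0"
proof (cases "a \<le> b")
  case True
  have "f x = 0" for x
  proof (cases "x \<in> \<Omega>")
    case x: True
    then have "ereal x \<le> b" using True by (auto simp: dom_int_def)
    then show ?thesis using vanishD[OF f, of x 0] x by simp
  qed (use U_zero[OF vanish_U[OF f]] in simp)
  then have "f = (\<lambda>_. 0)" by (simp add: fun_eq_iff)
  then show ?thesis using dual_zero[OF S] by simp
next
  case False
  note fU = vanish_U[OF f]
  obtain q k C where q: "0 < q" "q < 1" "C > 0" and Sbd: "\<forall>f\<in>U. \<forall>B. bd q k f B \<longrightarrow> cmod (S f) \<le> C * B"
    using dual_bound[OF S] by blast
  have ck: "c k \<in> \<Omega>" using c_dom[of "c k" k] c_pos[of k] by simp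
  obtain y where y: "y \<in> \<Omega>" "c k < y" using dom_above[OF ck] by blast
  obtain y' where y': "y' \<in> \<Omega>" "y < y'" using dom_above[OF y(1)] by blast
  define p p' where "p = - y'" and "p' = - y"
  have p: "p \<in> \<Omega>" "p' \<in> \<Omega>" "p < p'" "p' < - c k"
    using y y' uminus_dom[of y] uminus_dom[of y'] by (auto simp: p_def p'_def)
  \<comment> \<open>The left cutoff makes \<open>F\<close> vanish up to \<open>p\<close> in any
    case, so a \<open>b\<close> below \<open>p\<close>, possibly \<open>-\<infinity>\<close>, may be
    raised to the real number \<open>p\<close>.\<close>
  define b0 where "b0 = (if b \<le> ereal p then p else real_of_ereal b)"
  have b0: "b0 \<in> \<Omega>" "b \<le> ereal b0" "p \<le> b0" "b0 \<noteq> p \<Longrightarrow> ereal b0 = b"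
  proof -
    have "ereal (real_of_ereal b) = b \<and> real_of_ereal b \<in> \<Omega> \<and> p \<le> real_of_ereal b" if nb: "\<not> b \<le> ereal p"
    proof -
      have "b < a" "ereal p < b" using False nb by auto
      then have e: "ereal (real_of_ereal b) = b" by (cases b) auto
      moreover have "- a < b" using p(1) nb by (auto simp: dom_int_def intro: less_trans)
      ultimately have "real_of_ereal b \<in> \<Omega>" using \<open>b < a\<close> by (simp add: dom_int_def)
      then show ?thesis using e nb by (metis ereal_less_eq(3) linear)
    qed
    then show "b0 \<in> \<Omega>" "b \<le> ereal b0" "p \<le> b0" "b0 \<noteq> p \<Longrightarrow> ereal b0 = b"
      using p(1) by (auto simp: b0_def)
  qed
  have "max (c k) b0 \<in> \<Omega>" using ck b0 by (simp add: max_def)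
  then obtain T where T: "T \<in> \<Omega>" "max (c k) b0 < T" using dom_above by blast
  obtain T' where T': "T' \<in> \<Omega>" "T < T'" using dom_above[OF T(1)] by blast
  obtain X1 Y1 where P1: "jet_on UNIV X1" "jet_on UNIV Y1" "tame UNIV X1" "tame UNIV Y1"
    "\<And>j x. x \<le> p \<Longrightarrow> X1 j x = 0" "\<And>j x. x \<ge> p' \<Longrightarrow> Y1 j x = 0" "\<And>j x. X1 j x + Y1 j x = one_jet j x"
    using partition_exists[OF p(3)] by blast
  obtain X2 Y2 where P2: "jet_on UNIV X2" "jet_on UNIV Y2" "tame UNIV X2" "tame UNIV Y2"
    "\<And>j x. x \<le> T \<Longrightarrow> X2 j x = 0" "\<And>j x. x \<ge> T' \<Longrightarrow> Y2 j x = 0" "\<And>j x. X2 j x + Y2 j x = one_jet j x"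
    using partition_exists[OF T'(2)] by blast
  define H where "H = leibniz (leibniz (\<lambda>j. Dn j f) X1) Y2"
  \<comment> \<open>\<open>H\<close> vanishes up to \<open>p\<close> and from \<open>T'\<close> on,
    and both points lie inside \<open>\<Omega>\<close>. So its extension by zero is a jet on the
    whole line, also across the ends of \<open>\<Omega>\<close>.\<close>
  define F where "F j x = (if x \<in> \<Omega> then H j x else 0)" for j x
  have jH: "jet_on \<Omega> H" unfolding H_def
    by (intro jet_on_leibniz U_jet fU jet_on_subset[OF P1(1)] jet_on_subset[OF P2(2)]) auto
  have tH: "tame {- c l..c l} H" for l unfolding H_def
    by (intro tame_leibniz U_tame fU tame_subset[OF P1(3)] tame_subset[OF P2(4)]) auto
  have F0: "F j x = 0" if "x \<le> b0" for j x
  proof (cases "x \<in> \<Omega> \<and> \<not> x \<le> p")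
    case True
    then have "b0 \<noteq> p" using that by auto
    then have "ereal x \<le> b" using b0(4) that by (metis ereal_less_eq(3))
    then have "Dn i f x = 0" for i using vanishD[OF f, of x i] True by auto
    then show ?thesis by (simp add: F_def H_def leibniz_zero_left)
  next
    case False
    then show ?thesis using P1(5) by (auto simp: F_def H_def leibniz_zero_right leibniz_zero_left)
  qed
  have F1: "F j x = 0" if "x \<ge> T'" for j x
    using P2(6)[OF that] by (simp add: F_def H_def leibniz_zero_right)
  have jF: "jet_on UNIV F"
    unfolding jet_on_def
  proof (intro allI ballI)
    fix j x
    show "(F j has_vector_derivative F (Suc j) x) (at x)"
    proof (cases "x \<in> \<Omega>")
      case True
      show ?thesis
        by (rule has_vector_derivative_transform_within_open[of "H j" _ _ \<Omega>])
          (use jet_onD[OF jH True] open_dom True in \<open>auto simp: F_def\<close>)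
    next
      case False
      have "x < p \<or> x > T'"
        using dom_mono[OF p(1) T'(1), of x] False by linarith
      then have "(F j has_vector_derivative 0) (at x)"
      proof
        assume "x < p"
        then show ?thesis
          by (intro has_vector_derivative_transform_within_open[OF has_vector_derivative_const[of 0], of "{..<p}"])
            (use F0 b0 in auto)
      next
        assume "x > T'"
        then show ?thesis
          by (intro has_vector_derivative_transform_within_open[OF has_vector_derivative_const[of 0], of "{T'<..}"])
            (use F1 in auto)
      qed
      then show ?thesis using False by (simp add: F_def)
    qed
  qed
  have tF: "tame UNIV F"
  proof -
    obtain l1 l2 where l: "p \<in> {- c l1..c l1}" "T' \<in> {- c l2..c l2}" using dom_c p(1) T'(1) by blast
    define l where "l = max l1 l2"
    have sub: "p \<in> {- c l..c l}" "T' \<in> {- c l..c l}"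
      using l c_mono[of l1 l] c_mono[of l2 l] by (auto simp: l_def)
    show ?thesis
    proof (rule tameI)
      fix q :: real assume "0 < q" "q < 1"
      then obtain B where B: "B \<ge> 0" "\<forall>j. \<forall>x\<in>{- c l..c l}. cmod (H j x) \<le> B * M q j"
        using tH[of l] unfolding tame_def by blast
      have "cmod (F j x) \<le> B * M q j" for j x
      proof (cases "x \<in> {- c l..c l}")
        case True
        then show ?thesis using B by (simp add: F_def)
      next
        case False
        then have "x \<le> b0 \<or> x \<ge> T'" using sub b0(3) by auto
        then have "F j x = 0" using F0 F1 by blast
        then show ?thesis using B by simp
      qed
      then show "\<exists>B. \<forall>j. \<forall>x\<in>UNIV. cmod (F j x) \<le> B * M q j" by blast
    qed
  qed
  have "indicator_fn (FL S) (pi / 2) \<le> ereal b0" using ind b0(2) by (rule order_trans)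
  then have SF: "S (restr (F 0)) = 0"
    by (rule kills_compact_of_indicator[OF S _ jF tF _ F0 F1]) (use T T' in auto)
  have FU: "restr (F 0) \<in> U"
    by (intro restr_in_U jet_on_subset[OF jF] tame_subset[OF tF]) auto
  \<comment> \<open>On \<open>{- c k..c k}\<close> both cutoffs equal 1 with all higher derivatives
    zero, so the semi-norm bounding \<open>S\<close> vanishes on the difference.\<close>
  have "bd q k (\<lambda>x. f x - restr (F 0) x) 0"
    unfolding bd_def Dn_diff[OF fU FU] D_iter[OF jet_on_subset[OF jF subset_UNIV]]
  proof (intro allI ballI)
    fix j x assume x: "x \<in> {- c k..c k}"
    have "X1 i x = one_jet i x" "Y2 i x = one_jet i x" for i
      using P1(6)[of x i] P1(7)[of i x] P2(5)[of x i] P2(7)[of i x] x p T by auto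
    then have "H j x = Dn j f x" by (simp add: H_def leibniz_one_right)
    then show "cmod (Dn j f x - restr (F j) x) \<le> 0 * M q j"
      using c_dom[OF x] by (simp add: restr_def F_def)
  qed
  then have "cmod (S (\<lambda>x. f x - restr (F 0) x)) \<le> C * 0" using Sbd U_diff[OF fU FU] by blast
  then show ?thesis using dual_diff[OF S fU FU] SF by simp
qed

section \<open>Residual interval\<close>

text \<open>The substitution \<open>x \<mapsto> - x\<close> exchanges the two ends of the segment: a
  statement about the lower end for \<open>S\<close> is one about the upper end for
  \<open>S \<circ> reflect\<close>.\<close>

definition reflect :: "(real \<Rightarrow> complex) \<Rightarrow> real \<Rightarrow> complex" where
  "reflect f x = f (- x)"

lemma reflect_reflect [simp]: "reflect (reflect f) = f"
  by (simp add: reflect_def fun_eq_iff)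

lemma reflect_jet:
  assumes f: "f \<in> U"
  shows "jet_on \<Omega> (\<lambda>j x. (- 1) ^ j * Dn j f (- x))" and "reflect f = restr (\<lambda>x. (- 1) ^ 0 * Dn 0 f (- x))"
proof -
  have "uminus ` \<Omega> = \<Omega>" using uminus_dom by (force simp: image_iff)
  then show "jet_on \<Omega> (\<lambda>j x. (- 1) ^ j * Dn j f (- x))"
    using jet_on_reflect[of \<Omega> "\<lambda>j. Dn j f"] U_jet[OF f] by simp
  show "reflect f = restr (\<lambda>x. (- 1) ^ 0 * Dn 0 f (- x))"
    using U_zero[OF f] uminus_dom by (auto simp: reflect_def restr_def fun_eq_iff)
qed

lemma reflect_U:
  assumes f: "f \<in> U" shows "reflect f \<in> U"
  unfolding reflect_jet(2)[OF f]
proof (rule restr_in_U[OF reflect_jet(1)[OF f]], rule tameI)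
  fix k and q :: real assume "0 < q" "q < 1"
  then obtain B where "\<forall>j. \<forall>x\<in>{- c k..c k}. cmod (Dn j f x) \<le> B * M q j"
    using U_tame[OF f, of k] unfolding tame_def by blast
  then have "\<forall>j. \<forall>x\<in>{- c k..c k}. cmod ((- 1) ^ j * Dn j f (- x)) \<le> B * M q j"
    by (simp add: norm_mult norm_power)
  then show "\<exists>B. \<forall>j. \<forall>x\<in>{- c k..c k}. cmod ((- 1) ^ j * Dn j f (- x)) \<le> B * M q j" by blast
qed

lemma Dn_reflect:
  assumes f: "f \<in> U" shows "Dn j (reflect f) x = (- 1) ^ j * Dn j f (- x)"
  using D_iter[OF reflect_jet(1)[OF f], of j] Dn_outside[OF f, of "- x" j] uminus_dom[of x]
  unfolding reflect_jet(2)[OF f] by (auto simp: restr_def)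

lemma reflect_U_iff: "reflect f \<in> U \<longleftrightarrow> f \<in> U"
  using reflect_U[of f] reflect_U[of "reflect f"] by auto

lemma bd_reflect: "f \<in> U \<Longrightarrow> bd q k f B \<Longrightarrow> bd q k (reflect f) B"
  by (auto simp: bd_def Dn_reflect norm_mult norm_power)

lemma reflect_dual:
  assumes S: "S \<in> dual" shows "S \<circ> reflect \<in> dual"
proof -
  obtain q k C where q: "0 < q" "q < 1" "C > 0" and Sbd: "\<forall>f\<in>U. \<forall>B. bd q k f B \<longrightarrow> cmod (S f) \<le> C * B"
    using dual_bound[OF S] by blast
  show ?thesis
  proof (rule dualI[OF _ _ _ q(1,2)])
    show "(S \<circ> reflect) (\<lambda>x. f x + g x) = (S \<circ> reflect) f + (S \<circ> reflect) g" if "f \<in> U" "g \<in> U" for f g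
      using dual_add[OF S reflect_U[OF that(1)] reflect_U[OF that(2)]] by (simp add: reflect_def[abs_def])
    show "(S \<circ> reflect) (\<lambda>x. \<alpha> * f x) = \<alpha> * (S \<circ> reflect) f" if "f \<in> U" for \<alpha> f
      using dual_scale[OF S reflect_U[OF that]] by (simp add: reflect_def[abs_def])
    show "(S \<circ> reflect) f = 0" if "f \<notin> U" for f
      using S that reflect_U_iff[of f] by (simp add: udiff_dual_def)
    show "cmod ((S \<circ> reflect) f) \<le> C * B" if "f \<in> U" "bd q k f B" for f B
      using Sbd reflect_U[OF that(1)] bd_reflect[OF that] by simp
  qed
qed

lemma indicator_reflect: "indicator_fn (FL S) (- pi / 2) = indicator_fn (FL (S \<circ> reflect)) (pi / 2)"
proof -
  have "FL (S \<circ> reflect) (complex_of_real r * cis (pi / 2)) = FL S (complex_of_real r * cis (- pi / 2))" for r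
  proof -
    have "reflect (\<lambda>t. if t \<in> \<Omega> then exp (- \<i> * complex_of_real t * (complex_of_real r * cis (pi / 2))) else 0)
        = (\<lambda>t. if t \<in> \<Omega> then exp (- \<i> * complex_of_real t * (complex_of_real r * cis (- pi / 2))) else 0)"
      using uminus_dom by (simp add: reflect_def fun_eq_iff)
    then show ?thesis by (simp only: fourier_laplace_def o_def)
  qed
  then show ?thesis by (simp only: indicator_fn_def)
qed

lemma kills_of_indicator_lower:
  assumes S: "S \<in> dual" and ind: "indicator_fn (FL S) (- pi / 2) \<le> - b"
    and f: "f \<in> vanish {x \<in> \<Omega>. b \<le> ereal x}"
  shows "S f = 0"
proof -
  have "reflect f \<in> vanish {x \<in> \<Omega>. ereal x \<le> - b}"
  proof (rule vanishI[OF reflect_U[OF vanish_U[OF f]]])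
    fix j x assume "x \<in> {x \<in> \<Omega>. ereal x \<le> - b}"
    then have "- x \<in> {x \<in> \<Omega>. b \<le> ereal x}" using uminus_dom[of x] by (cases b) auto
    then show "Dn j (reflect f) x = 0" using vanishD[OF f] Dn_reflect[OF vanish_U[OF f]] by simp
  qed
  then have "(S \<circ> reflect) (reflect f) = 0"
    using ind unfolding indicator_reflect by (intro kills_of_indicator reflect_dual S)
  then show ?thesis by simp
qed

lemma indicator_le_of_support_lower:
  assumes S: "S \<in> dual" and kills: "\<And>f. f \<in> vanish {x \<in> \<Omega>. b \<le> x} \<Longrightarrow> S f = 0"
  shows "indicator_fn (FL S) (- pi / 2) \<le> ereal (- b)"
  unfolding indicator_reflect
proof (rule indicator_le_of_support[OF reflect_dual[OF S]])
  fix f assume f: "f \<in> vanish {x \<in> \<Omega>. x \<le> - b}"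
  have "reflect f \<in> vanish {x \<in> \<Omega>. b \<le> x}"
  proof (rule vanishI[OF reflect_U[OF vanish_U[OF f]]])
    fix j x assume "x \<in> {x \<in> \<Omega>. b \<le> x}"
    then have "- x \<in> {x \<in> \<Omega>. x \<le> - b}" using uminus_dom[of x] by simp
    then show "Dn j (reflect f) x = 0" using vanishD[OF f] Dn_reflect[OF vanish_U[OF f]] by simp
  qed
  then show "(S \<circ> reflect) f = 0" using kills by simp
qed

text \<open>\<open>f\<close> is split into a summand flat where \<open>x \<le> d\<close> and one
  flat where \<open>b \<le> x\<close>, each killed by one of the two indicator bounds. For
  \<open>d < b\<close> the gap accommodates a partition of unity; for \<open>b \<le> d\<close> the
  function is flat at a point \<open>p\<close> of the segment and is truncated there.\<close>

lemma kills_of_segment: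
  assumes S: "S \<in> dual" and up: "indicator_fn (FL S) (pi / 2) \<le> d" and lo: "indicator_fn (FL S) (- pi / 2) \<le> - b"
    and f: "f \<in> vanish {x \<in> \<Omega>. b \<le> ereal x \<and> ereal x \<le> d}"
  shows "S f = 0"
proof -
  note fU = vanish_U[OF f]
  have split: "S f = 0" if g: "g \<in> vanish {x \<in> \<Omega>. ereal x \<le> d}" "h \<in> vanish {x \<in> \<Omega>. b \<le> ereal x}"
    and gh: "(\<lambda>x. g x + h x) = f" for g h
    using kills_of_indicator[OF S up g(1)] kills_of_indicator_lower[OF S lo g(2)]
      dual_add[OF S vanish_U[OF g(1)] vanish_U[OF g(2)]] gh by simp
  \<comment> \<open>In the first three cases the segment misses \<open>\<Omega>\<close>, so
    \<open>f\<close> is arbitrary and \<open>S\<close> is shown to be zero; in the fourth it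
    contains a point of \<open>\<Omega>\<close>.\<close>
  consider "d \<le> - a" | "a \<le> b" | "- a < d" "b < a" "d < b" | "- a < d" "b < a" "b \<le> d" by force
  then show ?thesis
  proof cases
    case 1
    then have "{x \<in> \<Omega>. ereal x \<le> d} = {}" by (auto simp: dom_int_def)
    then show ?thesis by (intro kills_of_indicator[OF S up] vanishI fU) blast
  next
    case 2
    then have "{x \<in> \<Omega>. b \<le> ereal x} = {}" by (auto simp: dom_int_def)
    then show ?thesis by (intro kills_of_indicator_lower[OF S lo] vanishI fU) blast
  next
    case 3
    obtain p where p: "d < ereal p" "ereal p < b" using ereal_dense2[OF 3(3)] by blast
    obtain p' where p': "ereal p < ereal p'" "ereal p' < b" using ereal_dense2[OF p(2)] by blast
    obtain X Y where P: "jet_on UNIV X" "jet_on UNIV Y" "tame UNIV X" "tame UNIV Y"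
      "\<And>j x. x \<le> p \<Longrightarrow> X j x = 0" "\<And>j x. x \<ge> p' \<Longrightarrow> Y j x = 0" "\<And>j x. X j x + Y j x = one_jet j x"
      using partition_exists[of p p'] p' by auto
    show ?thesis
    proof (rule split[OF vanishI vanishI restr_leibniz_split[of f X Y]])
      fix j x assume "x \<in> {x \<in> \<Omega>. ereal x \<le> d}"
      then have "ereal x < ereal p" using p(1) by (blast intro: le_less_trans)
      then have "x \<le> p" by simp
      with P(5) have "X i x = 0" for i by blast
      then show "Dn j (restr (leibniz (\<lambda>j. Dn j f) X 0)) x = 0"
        unfolding restr_leibniz_U(2)[OF fU P(1,3)] by (simp add: restr_def leibniz_zero_right)
    next
      fix j x assume "x \<in> {x \<in> \<Omega>. b \<le> ereal x}"
      then have "ereal p' < ereal x" using p'(2) by (blast intro: less_le_trans)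
      then have "x \<ge> p'" by simp
      with P(6) have "Y i x = 0" for i by blast
      then show "Dn j (restr (leibniz (\<lambda>j. Dn j f) Y 0)) x = 0"
        unfolding restr_leibniz_U(2)[OF fU P(2,4)] by (simp add: restr_def leibniz_zero_right)
    qed (auto intro!: restr_leibniz_U fU P(1-4) simp: P(7))
  next
    case 4
    \<comment> \<open>For \<open>b = d\<close> there is no open interval to choose \<open>p\<close>
      from, and the common value is taken; this is where flatness at a single point is
      needed.\<close>
    obtain p where p: "b \<le> ereal p" "ereal p \<le> d" "p \<in> \<Omega>"
    proof (cases "b = d")
      case True
      then obtain r where "d = ereal r" using 4 by (cases d) auto
      then show thesis using that[of r] 4 True by (simp add: dom_int_def)
    next
      case False
      have "- a < a" using a_pos by (cases a) auto
      then have "max b (- a) < min d a" using 4 False by auto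
      then obtain r where "max b (- a) < ereal r" "ereal r < min d a" using ereal_dense2 by blast
      then show thesis using that[of r] by (auto simp: dom_int_def)
    qed
    define g where "g = restr (trunc p (\<lambda>j. Dn j f) 0)"
    have jt: "jet_on \<Omega> (trunc p (\<lambda>j. Dn j f))"
      by (rule jet_on_trunc[OF U_jet[OF fU]]) (use vanishD[OF f, of p] p in auto)
    have gU: "g \<in> U" unfolding g_def by (intro restr_in_U jt tame_trunc U_tame fU)
    have Dg: "Dn j g x = (if x > p then Dn j f x else 0)" for j x
      unfolding g_def D_iter[OF jt] using Dn_outside[OF fU] by (simp add: restr_def trunc_def)
    show ?thesis
    proof (rule split[of g "\<lambda>x. f x - g x", OF vanishI vanishI])
      fix j x assume "x \<in> {x \<in> \<Omega>. ereal x \<le> d}"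
      moreover have "b \<le> ereal x" if "x > p" using p(1) that by (meson ereal_less_eq(3) less_imp_le order_trans)
      ultimately show "Dn j g x = 0" unfolding Dg using vanishD[OF f, of x] by auto
    next
      fix j x assume "x \<in> {x \<in> \<Omega>. b \<le> ereal x}"
      moreover have "ereal x \<le> d" if "x \<le> p" using p(2) that by (meson ereal_less_eq(3) order_trans)
      ultimately show "Dn j (\<lambda>x. f x - g x) x = 0"
        unfolding Dn_diff[OF fU gU] Dg using vanishD[OF f, of x] by auto
    qed (auto intro!: gU U_diff fU)
  qed
qed

text \<open>A point \<open>x\<close> outside \<open>I\<close> has a positive distance
  \<open>e\<close> from it, and the whole interval lies on one side of \<open>x\<close>. If it lies
  to the left, \<open>I\<close> is contained in the half-line up to \<open>x - e\<close>, so
  \<open>indicator_le_of_support\<close> puts the upper end of the segment at most at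
  \<open>x - e\<close>; the right side is symmetric. For empty \<open>I\<close> the first
  alternative holds vacuously.\<close>

lemma segment_subset:
  assumes I: "rel_closed_interval a I" and kills: "\<And>f S. f \<in> vanish I \<Longrightarrow> S \<in> P \<Longrightarrow> S f = 0"
    and P: "P \<subseteq> dual" and x: "x \<in> \<Omega>" "seg_lower (FL ` P) \<le> ereal x" "ereal x \<le> seg_upper (FL ` P)"
  shows "x \<in> I"
proof (rule ccontr)
  assume xI: "x \<notin> I"
  have cl: "closedin (top_of_set \<Omega>) I" and int: "is_interval I"
    using I by (auto simp: rel_closed_interval_def)
  have sub: "I \<subseteq> \<Omega>" using closedin_imp_subset[OF cl] .
  have "openin (top_of_set \<Omega>) (\<Omega> - I)" using cl by (simp add: closedin_def)
  then have "open (\<Omega> - I)" using open_dom openin_open_eq by blast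
  then obtain e where e: "e > 0" "ball x e \<subseteq> \<Omega> - I" using xI x(1) openE by blast
  have far: "\<bar>y - x\<bar> \<ge> e" if "y \<in> I" for y
  proof (rule ccontr)
    assume "\<not> \<bar>y - x\<bar> \<ge> e"
    then have "y \<in> ball x e" by (simp add: dist_real_def abs_minus_commute)
    then show False using e(2) that by blast
  qed
  have "(\<forall>y\<in>I. y \<le> x - e) \<or> (\<forall>y\<in>I. y \<ge> x + e)"
  proof (rule ccontr)
    assume "\<not> ?thesis"
    then obtain y z where yz: "y \<in> I" "z \<in> I" "\<not> y \<le> x - e" "\<not> z \<ge> x + e" by blast
    then have "z \<le> x" "x \<le> y" using far[OF yz(1)] far[OF yz(2)] e(1) by linarith+
    then show False using int yz xI unfolding is_interval_1 by blast
  qed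
  then consider "\<forall>y\<in>I. y \<le> x - e" | "\<forall>y\<in>I. y \<ge> x + e" by blast
  then show False
  proof cases
    case 1
    have "indicator_fn (FL S) (pi / 2) \<le> ereal (x - e)" if S: "S \<in> P" for S
    proof (rule indicator_le_of_support)
      fix f assume f: "f \<in> vanish {y \<in> \<Omega>. y \<le> x - e}"
      have "I \<subseteq> {y \<in> \<Omega>. y \<le> x - e}" using 1 sub by auto
      then show "S f = 0" using kills vanish_mono f S by blast
    qed (use P S in auto)
    then have "seg_upper (FL ` P) \<le> ereal (x - e)"
      unfolding seg_upper_def by (intro SUP_least) auto
    then have "ereal x \<le> ereal (x - e)" using x(3) by (rule order_trans[rotated])
    then show False using e(1) by simp
  next
    case 2
    have "indicator_fn (FL S) (- pi / 2) \<le> ereal (- (x + e))" if S: "S \<in> P" for S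
    proof (rule indicator_le_of_support_lower)
      fix f assume f: "f \<in> vanish {y \<in> \<Omega>. x + e \<le> y}"
      have "I \<subseteq> {y \<in> \<Omega>. x + e \<le> y}" using 2 sub by auto
      then show "S f = 0" using kills vanish_mono f S by blast
    qed (use P S in auto)
    then have "(SUP \<phi>\<in>FL ` P. indicator_fn \<phi> (- pi / 2)) \<le> ereal (- (x + e))"
      by (intro SUP_least) auto
    then have "- ereal (- (x + e)) \<le> seg_lower (FL ` P)"
      unfolding seg_lower_def by (simp only: ereal_minus_le_minus)
    then have "ereal (x + e) \<le> seg_lower (FL ` P)" by (simp add: add.commute)
    then have "ereal (x + e) \<le> ereal x" using x(2) by (rule order_trans)
    then show False using e(1) by simp
  qed
qed

text \<open>\<open>I\<close> turns out to be the least relatively closed interval whose vanishing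
  space lies in \<open>W\<close>: \<open>VI\<close> comes from separation and
  \<open>kills_of_segment\<close>, \<open>least\<close> from \<open>segment_subset\<close>.
  Leastness excludes every proper subinterval. Any other residual interval contains
  \<open>I\<close>, and it cannot be strictly larger, because \<open>I\<close> itself would then
  violate its minimality.\<close>

lemma residual_interval_characterization:
  assumes W: "D_invariant_subspace a \<omega> c W"
  defines "J \<equiv> FL ` polar a \<omega> c W"
  shows "(\<exists>I. residual_interval a \<omega> c W I) \<and>
         (\<forall>I. residual_interval a \<omega> c W I \<longrightarrow> I = {x. ereal x \<in> indicator_segment J} \<inter> \<Omega>)"
proof -
  define I where "I = {x. ereal x \<in> indicator_segment J} \<inter> \<Omega>"
  have I_eq: "I = {x \<in> \<Omega>. seg_lower J \<le> ereal x \<and> ereal x \<le> seg_upper J}"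
    by (auto simp: I_def indicator_segment_def)
  have PU: "polar a \<omega> c W \<subseteq> dual" and PW: "\<And>S f. S \<in> polar a \<omega> c W \<Longrightarrow> f \<in> W \<Longrightarrow> S f = 0"
    by (auto simp: polar_def)
  have WU: "W \<subseteq> U" using W by (simp add: D_invariant_subspace_def)
  have closedI: "rel_closed_interval a I"
    unfolding rel_closed_interval_def
  proof
    have "ereal u \<le> ereal z \<and> ereal z \<le> ereal v" if "u \<le> z" "z \<le> v" for u v z using that by simp
    then show "is_interval I"
      unfolding is_interval_1 I_eq using dom_mono by (blast intro: order_trans)
    have "closed {x. ereal x \<in> {seg_lower J..seg_upper J}}"
      using continuous_closed_vimage[of "{seg_lower J..seg_upper J}" ereal] by (simp add: vimage_def)
    then show "closedin (top_of_set \<Omega>) I"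
      unfolding I_def indicator_segment_def by (subst Int_commute) (rule closedin_closed_Int)
  qed
  have VI: "vanish I \<subseteq> W"
  proof
    fix f assume f: "f \<in> vanish I"
    show "f \<in> W"
    proof (rule ccontr)
      assume "f \<notin> W"
      then obtain S where S: "S \<in> dual" "\<And>g. g \<in> W \<Longrightarrow> S g = 0" "S f \<noteq> 0"
        using separating_functional[of W f] W vanish_U[OF f] by (auto simp: D_invariant_subspace_def)
      then have "FL S \<in> J" by (auto simp: J_def polar_def)
      then have "indicator_fn (FL S) (pi / 2) \<le> seg_upper J" "indicator_fn (FL S) (- pi / 2) \<le> - seg_lower J"
        unfolding seg_upper_def seg_lower_def ereal_uminus_uminus by (rule SUP_upper)+
      then have "S f = 0" using kills_of_segment[OF S(1)] f unfolding I_eq by blast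
      then show False using S(3) by simp
    qed
  qed
  have least: "I \<subseteq> I'" if I': "rel_closed_interval a I'" "vanish I' \<subseteq> W" for I'
  proof
    fix x assume "x \<in> I"
    then show "x \<in> I'" unfolding I_eq J_def
      by (intro segment_subset[OF I'(1) _ PU]) (use I'(2) PW in auto)
  qed
  have res: "residual_interval a \<omega> c W I"
    unfolding residual_interval_def using closedI VI least by blast
  moreover have "I' = I" if I': "residual_interval a \<omega> c W I'" for I'
  proof -
    have "I \<subseteq> I'" using I' least by (simp add: residual_interval_def)
    then show ?thesis using I' closedI VI unfolding residual_interval_def by blast
  qed
  ultimately show ?thesis unfolding I_def by blast
qed

end

theorem proposition2p3:
  fixes \<omega> :: "real \<Rightarrow> real" and a :: ereal and c :: "nat \<Rightarrow> real"
    and W :: "(real \<Rightarrow> complex) set"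
  assumes "weight \<omega>" and "0 < a" and "exhausting_seq a c"
    and "D_invariant_subspace a \<omega> c W"
  defines "J \<equiv> fourier_laplace a ` polar a \<omega> c W"
  shows "(\<exists>I. residual_interval a \<omega> c W I) \<and>
         (\<forall>I. residual_interval a \<omega> c W I \<longrightarrow>
            I = {x. ereal x \<in> indicator_segment J} \<inter> dom_int a)"
proof -
  interpret udiff_setting a \<omega> c using assms(1-3) by unfold_locales
  show ?thesis unfolding J_def by (rule residual_interval_characterization[OF assms(4)])
qed

end
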